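(* Let $G$ be a finite simple graph without isolated vertices that is one of the following: (a) a clique-star graph; (b) a generalized caterpillar graph. Let $\mathbf{k}$ be the degree-vector of $G$. Then $$\operatorname{reg}(S/\mathrm{NI}_{\mathbf{k}}(G))\le\tau(G)-1.$$
   Context: Let $K$ be a field. For a graph $G$ on $[n]$ without isolated vertices, $S=K[x_1,\ldots,x_n]$; $N_G[i]$ is the closed neighborhood of $i$; $\mathbf{x}_W=\prod_{j\in W}x_j$. For $\mathbf{k}=(k_1,\ldots,k_n)$ with $1\le k_i\le\deg_G(i)+1$, the $\mathbf{k}$-neighborhood ideal is $\mathrm{NI}_{\mathbf{k}}(G)=\sum_{i=1}^n(\mathbf{x}_W: W\subseteq N_G[i],\ |W|=k_i)\subseteq S$. The degree-vector of $G$ is $\mathbf{k}$ with $k_i=\deg_G(i)$ for all $i$. $\tau(G)$ is the vertex cover number; $\operatorname{reg}$ is Castelnuovo-Mumford regularity. Clique-star graph: let $\{F_1,\ldots,F_r\}$ be the set of maximal cliques of $G$. The clique $F_1$ is called a central clique of $G$ if $F_i\cap F_1\ne\emptyset$ for all $2\le i\le r$. $G$ is a clique-star graph if (after renumbering) it has a central clique $F_1$ and $F_i\cap F_j\subseteq F_1$ for any distinct $i,j\in[r]$. Generalized caterpillar graph: $G$ is a generalized caterpillar graph if there exists a path graph $P$ such that $G$ is obtained by attaching complete graphs $K_1,K_2,\ldots,K_t$ (of arbitrary sizes; the subscript is only an index) to $P$, where each attachment is performed by identifying either a vertex of $K_i$ with a vertex of $P$, or an edge of $K_i$ with an edge of $P$.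 *)

theory Defs
  imports
    "HOL-Library.Poly_Mapping"
    "HOL-Library.Extended_Real"
    "Jordan_Normal_Form.Matrix"
begin

section \<open>Finite simple graphs\<close>

definition simple_graph :: "'v set \<Rightarrow> 'v set set \<Rightarrow> bool" where
  "simple_graph V E \<longleftrightarrow> finite V \<and> (\<forall>e\<in>E. e \<subseteq> V \<and> card e = 2)"

definition no_isolated_vertices :: "'v set \<Rightarrow> 'v set set \<Rightarrow> bool" where
  "no_isolated_vertices V E \<longleftrightarrow> (\<forall>v\<in>V. \<exists>e\<in>E. v \<in> e)"

text \<open>For a simple graph, \<open>{v, u} \<in> E\<close> forces \<open>u \<noteq> v\<close>.\<close>

definition nbhd :: "'v set set \<Rightarrow> 'v \<Rightarrow> 'v set" where
  "nbhd E v = {u. {v, u} \<in> E}"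

definition closed_nbhd :: "'v set set \<Rightarrow> 'v \<Rightarrow> 'v set" where
  "closed_nbhd E v = insert v (nbhd E v)"

definition vertex_degree :: "'v set set \<Rightarrow> 'v \<Rightarrow> nat" where
  "vertex_degree E v = card (nbhd E v)"

definition vertex_cover :: "'v set \<Rightarrow> 'v set set \<Rightarrow> 'v set \<Rightarrow> bool" where
  "vertex_cover V E C \<longleftrightarrow> C \<subseteq> V \<and> (\<forall>e\<in>E. e \<inter> C \<noteq> {})"

definition vertex_cover_number :: "'v set \<Rightarrow> 'v set set \<Rightarrow> nat" where
  "vertex_cover_number V E = Min (card ` {C. vertex_cover V E C})"

definition complete_edges :: "'v set \<Rightarrow> 'v set set" where
  "complete_edges Q = {e. e \<subseteq> Q \<and> card e = 2}"

definition clique :: "'v set \<Rightarrow> 'v set set \<Rightarrow> 'v set \<Rightarrow> bool" where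
  "clique V E C \<longleftrightarrow> C \<subseteq> V \<and> complete_edges C \<subseteq> E"

definition maximal_clique :: "'v set \<Rightarrow> 'v set set \<Rightarrow> 'v set \<Rightarrow> bool" where
  "maximal_clique V E C \<longleftrightarrow> clique V E C \<and> (\<forall>C'. clique V E C' \<and> C \<subseteq> C' \<longrightarrow> C' = C)"

definition central_clique :: "'v set \<Rightarrow> 'v set set \<Rightarrow> 'v set \<Rightarrow> bool" where
  "central_clique V E F \<longleftrightarrow> maximal_clique V E F \<and>
     (\<forall>F'. maximal_clique V E F' \<and> F' \<noteq> F \<longrightarrow> F' \<inter> F \<noteq> {})"

definition clique_star_graph :: "'v set \<Rightarrow> 'v set set \<Rightarrow> bool" where
  "clique_star_graph V E \<longleftrightarrow> (\<exists>F. central_clique V E F \<and>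
     (\<forall>A B. maximal_clique V E A \<and> maximal_clique V E B \<and> A \<noteq> B \<longrightarrow> A \<inter> B \<subseteq> F))"

definition path_edges :: "'v list \<Rightarrow> 'v set set" where
  "path_edges p = {{p ! i, p ! Suc i} | i. Suc i < length p}"

text \<open>\<open>attached_to_path p V E\<close>: the graph \<open>(V, E)\<close> arises from the path graph with consecutive
  vertices \<open>p\<close> by successively attaching complete graphs to that path. The vertices of each
  attached complete graph are named so that the identified vertices are literally shared; all
  other vertices of \<open>Q\<close> are new, i.e. outside the graph built so far.\<close>

inductive attached_to_path :: "'v list \<Rightarrow> 'v set \<Rightarrow> 'v set set \<Rightarrow> bool"
  for p :: "'v list"
where
  path: "p \<noteq> [] \<Longrightarrow> distinct p \<Longrightarrow> attached_to_path p (set p) (path_edges p)"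
| attach_at_vertex: "attached_to_path p V E \<Longrightarrow> v \<in> set p \<Longrightarrow> finite Q \<Longrightarrow> Q \<inter> V = {v} \<Longrightarrow>
    attached_to_path p (V \<union> Q) (E \<union> complete_edges Q)"
| attach_at_edge: "attached_to_path p V E \<Longrightarrow> e \<in> path_edges p \<Longrightarrow> finite Q \<Longrightarrow> Q \<inter> V = e \<Longrightarrow>
    attached_to_path p (V \<union> Q) (E \<union> complete_edges Q)"

definition generalized_caterpillar_graph :: "'v set \<Rightarrow> 'v set set \<Rightarrow> bool" where
  "generalized_caterpillar_graph V E \<longleftrightarrow> (\<exists>p. attached_to_path p V E)"


section \<open>Polynomials in the variables indexed by a finite set\<close>

type_synonym ('v, 'k) mpoly = "('v \<Rightarrow>\<^sub>0 nat) \<Rightarrow>\<^sub>0 'k"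

text \<open>\<open>poly_ring V\<close> is the polynomial ring over \<open>'k\<close> in the variables indexed by \<open>V\<close>.\<close>

definition poly_ring :: "'v set \<Rightarrow> ('v, 'k::field) mpoly set" where
  "poly_ring V = {f. \<forall>m\<in>Poly_Mapping.keys f. Poly_Mapping.keys m \<subseteq> V}"

definition var :: "'v \<Rightarrow> ('v, 'k::field) mpoly" where
  "var v = Poly_Mapping.single (Poly_Mapping.single v 1) 1"

definition mon_degree :: "('v \<Rightarrow>\<^sub>0 nat) \<Rightarrow> nat" where
  "mon_degree m = (\<Sum>v\<in>Poly_Mapping.keys m. Poly_Mapping.lookup m v)"

text \<open>The zero polynomial is homogeneous of every degree, and it is the only polynomial that is
  homogeneous of a negative degree.\<close>

definition homogeneous :: "int \<Rightarrow> ('v, 'k::field) mpoly \<Rightarrow> bool" where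
  "homogeneous j f \<longleftrightarrow> (\<forall>m\<in>Poly_Mapping.keys f. int (mon_degree m) = j)"

definition ideal_generated :: "'v set \<Rightarrow> ('v, 'k::field) mpoly set \<Rightarrow> ('v, 'k) mpoly set" where
  "ideal_generated V A = {\<Sum>a\<in>B. c a * a | B c. finite B \<and> B \<subseteq> A \<and> (\<forall>a\<in>B. c a \<in> poly_ring V)}"

definition ideal_sum :: "'i set \<Rightarrow> ('i \<Rightarrow> ('v, 'k::field) mpoly set) \<Rightarrow> ('v, 'k) mpoly set" where
  "ideal_sum A I = {\<Sum>i\<in>A. f i | f. \<forall>i\<in>A. f i \<in> I i}"

definition neighborhood_ideal ::
    "'v set \<Rightarrow> 'v set set \<Rightarrow> ('v \<Rightarrow> nat) \<Rightarrow> ('v, 'k::field) mpoly set" where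
  "neighborhood_ideal V E k = ideal_sum V
     (\<lambda>i. ideal_generated V {\<Prod>j\<in>W. var j | W. W \<subseteq> closed_nbhd E i \<and> card W = k i})"


section \<open>Minimal graded free resolutions and regularity\<close>

definition free_module :: "'v set \<Rightarrow> nat \<Rightarrow> ('v, 'k::field) mpoly vec set" where
  "free_module V r = {v \<in> carrier_vec r. \<forall>a<r. v $ a \<in> poly_ring V}"

text \<open>A list \<open>ds\<close> of integers stands for the graded free module with one summand \<open>S(-j)\<close> for each
  entry \<open>j\<close> of \<open>ds\<close>, so its basis elements have the degrees listed in \<open>ds\<close>. The following
  predicate describes the matrices of the degree-preserving linear maps from the module of
  \<open>ds\<close> to that of \<open>es\<close>.\<close>

definition graded_map :: "'v set \<Rightarrow> int list \<Rightarrow> int list \<Rightarrow> ('v, 'k::field) mpoly mat \<Rightarrow> bool" where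
  "graded_map V ds es M \<longleftrightarrow> M \<in> carrier_mat (length es) (length ds) \<and>
     (\<forall>a<length es. \<forall>b<length ds.
        M $$ (a, b) \<in> poly_ring V \<and> homogeneous (ds ! b - es ! a) (M $$ (a, b)))"

text \<open>\<open>graded_free_resolution V I d g M\<close>: with \<open>S = poly_ring V\<close> and \<open>F i\<close> the graded free module of
  \<open>d i\<close>, the sequence \<open>\<dots> \<rightarrow> F 2 \<rightarrow> F 1 \<rightarrow> F 0 \<rightarrow> S/I \<rightarrow> 0\<close> is exact and its maps preserve degrees.
  Here \<open>M i\<close> is the matrix of \<open>F (i + 1) \<rightarrow> F i\<close>, and the map \<open>F 0 \<rightarrow> S/I\<close> sends the basis element
  with index \<open>a\<close> to the class of \<open>g $ a\<close>.\<close>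

definition graded_free_resolution :: "'v set \<Rightarrow> ('v, 'k::field) mpoly set \<Rightarrow>
    (nat \<Rightarrow> int list) \<Rightarrow> ('v, 'k) mpoly vec \<Rightarrow> (nat \<Rightarrow> ('v, 'k) mpoly mat) \<Rightarrow> bool" where
  "graded_free_resolution V I d g M \<longleftrightarrow>
     g \<in> free_module V (length (d 0)) \<and>
     (\<forall>a<length (d 0). homogeneous (d 0 ! a) (g $ a)) \<and>
     (\<forall>i. graded_map V (d (Suc i)) (d i) (M i)) \<and>
     (\<forall>f\<in>poly_ring V. \<exists>v\<in>free_module V (length (d 0)). f - g \<bullet> v \<in> I) \<and>
     {v \<in> free_module V (length (d 0)). g \<bullet> v \<in> I} =
       (\<lambda>w. M 0 *\<^sub>v w) ` free_module V (length (d 1)) \<and>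
     (\<forall>i. {v \<in> free_module V (length (d (Suc i))). M i *\<^sub>v v = 0\<^sub>v (length (d i))} =
       (\<lambda>w. M (Suc i) *\<^sub>v w) ` free_module V (length (d (Suc (Suc i)))))"

text \<open>Minimality: the image of \<open>F (i + 1)\<close> lies in \<open>\<mm> F i\<close>, where \<open>\<mm>\<close> is the ideal generated by
  the variables; that is, all matrix entries have zero constant term.\<close>

definition minimal_graded_free_resolution :: "'v set \<Rightarrow> ('v, 'k::field) mpoly set \<Rightarrow>
    (nat \<Rightarrow> int list) \<Rightarrow> ('v, 'k) mpoly vec \<Rightarrow> (nat \<Rightarrow> ('v, 'k) mpoly mat) \<Rightarrow> bool" where
  "minimal_graded_free_resolution V I d g M \<longleftrightarrow> graded_free_resolution V I d g M \<and>
     (\<forall>i. \<forall>a<length (d i). \<forall>b<length (d (Suc i)). Poly_Mapping.lookup (M i $$ (a, b)) 0 = 0)"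

text \<open>Degree shifts of a minimal graded free resolution of \<open>S/I\<close>. Such a resolution exists for
  every homogeneous ideal \<open>I\<close> when \<open>V\<close> is finite, and it is unique up to isomorphism, so the graded
  Betti numbers do not depend on the choice.\<close>

definition minimal_shifts :: "'v set \<Rightarrow> ('v, 'k::field) mpoly set \<Rightarrow> nat \<Rightarrow> int list" where
  "minimal_shifts V I = (SOME d. \<exists>g M. minimal_graded_free_resolution V I d g M)"

definition graded_betti :: "'v set \<Rightarrow> ('v, 'k::field) mpoly set \<Rightarrow> nat \<Rightarrow> int \<Rightarrow> nat" where
  "graded_betti V I i j = count_list (minimal_shifts V I i) j"

text \<open>\<open>quotient_regularity V I\<close> is the Castelnuovo-Mumford regularity of \<open>S/I\<close>, the maximum of
  \<open>j - i\<close> over the nonzero graded Betti numbers of \<open>S/I\<close>; it is \<open>-\<infinity>\<close> for the zero module.\<close>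

definition quotient_regularity :: "'v set \<Rightarrow> ('v, 'k::field) mpoly set \<Rightarrow> ereal" where
  "quotient_regularity V I =
     Sup {ereal (of_int (j - int i)) | i j. graded_betti V I i j \<noteq> 0}"

end

theory Submission
  imports Defs "HOL-Library.Function_Algebras"
begin

text \<open>Let \<open>R\<close> be the polynomial ring. The neighborhood ideal \<open>\<aa>\<close> is a
squarefree monomial ideal: a monomial belongs to it exactly if its support misses at most one vertex of some
closed neighborhood (\<open>neighborhood_ideal_eq\<close>). The bound on the regularity is proved through Koszul
homology rather than by comparing resolutions.

Suppose that every Koszul cycle of \<open>R/\<aa>\<close> whose coefficients have only monomials of degree
greater than \<open>r\<close> is a boundary (\<open>koszul_vanishes\<close>). This property passes from a module
presented by graded free modules to its syzygies, with \<open>r\<close> replaced by \<open>r + 1\<close>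
(\<open>module_vanishes_syzygies\<close>), and a basis element of too large degree in a minimal resolution would
be a cycle that is not a boundary (\<open>module_vanishes_shifts\<close>). So the shifts in homological degree
\<open>i\<close> are at most \<open>r + i\<close>. The property also shows that every syzygy module is generated
in bounded degree, hence by finitely many elements. This gives the existence of a minimal resolution
(\<open>minimal_resolution_exists\<close>), so that the shifts selected in the definition of the Betti numbers
are those of a resolution.

Vanishing for a squarefree ideal is decided by querying one variable \<open>x\<close> after the other: it holds
for \<open>\<aa>\<close> with bound \<open>r\<close> if it holds for \<open>\<aa> : x\<close> with bound
\<open>r - 1\<close> and for \<open>\<aa> + (x)\<close> with bound \<open>r\<close>
(\<open>koszul_vanishes_split\<close>). A variable that occurs in no generator costs nothing, because
multiplication by it is null-homotopic on the Koszul complex (\<open>koszul_vanishes_cone\<close>). If all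
variables of \<open>W\<close> are queried and the other ones are then free of cost, \<open>r\<close> may be
taken as the largest size of a subset of \<open>W\<close> that is a face, that is, supports no monomial of
\<open>\<aa>\<close> (\<open>koszul_vanishes_by_faces\<close>).

For a graph, let \<open>S\<close> be a maximal independent set of simplicial vertices, let \<open>I\<close> be
an independent set of vertices that lie in no closed neighborhood of a simplicial vertex, and put \<open>J = S
\<union> I\<close>. A vertex of \<open>S\<close> is free of cost once its neighbors are queried: its variable
lies in the resulting ideal or has become irrelevant, as \<open>N[s]\<close> is contained in \<open>N[i]\<close>
whenever \<open>s \<in> N[i]\<close>. A face \<open>L\<close> misses at least two vertices of every closed
neighborhood. If \<open>L\<close> avoids \<open>I\<close>, it therefore misses a vertex of \<open>V - J\<close>,
and if it contains a nonempty \<open>I' \<subseteq> I\<close>, it misses more than \<open>card I'\<close>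
vertices of \<open>V - J\<close>, provided that the neighborhoods of the elements of \<open>I\<close> do not
overlap too much. In both cases \<open>card L \<le> card (V - J) - 1\<close>. If moreover \<open>V\<close> is
covered by one clique per element of \<open>J\<close>, then \<open>card (V - J) \<le> \<tau>(G)\<close>, since a
vertex cover leaves out at most one vertex of a clique (\<open>regularity_le_vertex_cover_number\<close>).

In a clique-star graph every vertex lies in the closed neighborhood of a simplicial one, and \<open>I\<close> is
empty. In a generalized caterpillar graph the remaining vertices are on the path and have only their path
neighbors, and \<open>I\<close> selects every second one of each run of them. If \<open>L\<close> contains such
vertices, it misses the path neighbors on both sides of each, and the right neighbors together with the left
neighbor of the first one are one more than the vertices themselves.\<close>

section \<open>Polynomials with restricted monomials\<close>

definition monomial_span :: "(('v \<Rightarrow>\<^sub>0 nat) \<Rightarrow> bool) \<Rightarrow> ('v, 'k::field) mpoly set" where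
  "monomial_span P = {f. \<forall>m\<in>Poly_Mapping.keys f. P m}"

lemma monomial_spanD: "f \<in> monomial_span P \<Longrightarrow> Poly_Mapping.lookup f m \<noteq> 0 \<Longrightarrow> P m"
  by (auto simp: monomial_span_def in_keys_iff)

lemma monomial_spanI: "(\<And>m. Poly_Mapping.lookup f m \<noteq> 0 \<Longrightarrow> P m) \<Longrightarrow> f \<in> monomial_span P"
  by (auto simp: monomial_span_def in_keys_iff)

lemma monomial_span_mono:
  "f \<in> monomial_span P \<Longrightarrow> (\<And>m. P m \<Longrightarrow> Q m) \<Longrightarrow> f \<in> monomial_span Q"
  by (auto simp: monomial_span_def)

lemma monomial_span_conj:
  "f \<in> monomial_span P \<Longrightarrow> f \<in> monomial_span Q \<Longrightarrow> f \<in> monomial_span (\<lambda>m. P m \<and> Q m)"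
  by (auto simp: monomial_span_def)

lemma monomial_span_0 [simp]: "0 \<in> monomial_span P"
  by (simp add: monomial_span_def)

lemma monomial_span_add: "f \<in> monomial_span P \<Longrightarrow> g \<in> monomial_span P \<Longrightarrow> f + g \<in> monomial_span P"
  using keys_add[of f g] by (auto simp: monomial_span_def)

lemma monomial_span_uminus [simp]: "- f \<in> monomial_span P \<longleftrightarrow> f \<in> monomial_span P"
  by (simp add: monomial_span_def)

lemma monomial_span_diff: "f \<in> monomial_span P \<Longrightarrow> g \<in> monomial_span P \<Longrightarrow> f - g \<in> monomial_span P"
  using monomial_span_add[of f P "- g"] by simp

lemma monomial_span_sum: "(\<And>i. i \<in> A \<Longrightarrow> f i \<in> monomial_span P) \<Longrightarrow> sum f A \<in> monomial_span P"
  by (induction A rule: infinite_finite_induct) (auto intro: monomial_span_add)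

lemma monomial_span_mult:
  assumes "f \<in> monomial_span P" "g \<in> monomial_span Q" "\<And>p q. P p \<Longrightarrow> Q q \<Longrightarrow> R (p + q)"
  shows "f * g \<in> monomial_span R"
  using keys_mult[of f g] assms by (fastforce simp: monomial_span_def)

lemma monomial_span_single: "P m \<Longrightarrow> Poly_Mapping.single m c \<in> monomial_span P"
  by (auto simp: monomial_span_def)

lemma poly_ring_eq: "poly_ring V = monomial_span (\<lambda>m. Poly_Mapping.keys m \<subseteq> V)"
  by (simp add: poly_ring_def monomial_span_def)

lemma homogeneous_eq: "homogeneous j f \<longleftrightarrow> f \<in> monomial_span (\<lambda>m. int (mon_degree m) = j)"
  by (simp add: homogeneous_def monomial_span_def)

lemma keys_plus_nat: "Poly_Mapping.keys (p + q :: 'v \<Rightarrow>\<^sub>0 nat) = Poly_Mapping.keys p \<union> Poly_Mapping.keys q"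
  by (auto simp: in_keys_iff lookup_add)

lemma mon_degree_superset:
  "finite A \<Longrightarrow> Poly_Mapping.keys m \<subseteq> A \<Longrightarrow> mon_degree m = (\<Sum>v\<in>A. Poly_Mapping.lookup m v)"
  unfolding mon_degree_def by (rule sum.mono_neutral_left) (auto simp: in_keys_iff)

lemma mon_degree_add [simp]: "mon_degree (p + q) = mon_degree p + mon_degree q"
proof -
  have "mon_degree (p + q) = (\<Sum>v\<in>Poly_Mapping.keys p \<union> Poly_Mapping.keys q. Poly_Mapping.lookup (p + q) v)"
    by (simp add: mon_degree_def keys_plus_nat)
  also have "\<dots> = mon_degree p + mon_degree q"
    by (simp add: lookup_add sum.distrib
        mon_degree_superset[of "Poly_Mapping.keys p \<union> Poly_Mapping.keys q"])
  finally show ?thesis .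
qed

lemma mon_degree_single [simp]: "mon_degree (Poly_Mapping.single v n) = n"
  by (cases "n = 0") (simp_all add: mon_degree_def)

lemma mon_degree_zero [simp]: "mon_degree 0 = 0"
  by (simp add: mon_degree_def)

lemma mon_degree_eq_0: "mon_degree m = 0 \<longleftrightarrow> m = 0"
  by (auto simp: mon_degree_def in_keys_iff intro!: poly_mapping_eqI)

lemma monomial_span_imp_poly_ring:
  "f \<in> monomial_span (\<lambda>m. Poly_Mapping.keys m \<subseteq> V \<and> P m) \<Longrightarrow> f \<in> poly_ring V"
  unfolding poly_ring_eq by (erule monomial_span_mono) simp

lemma poly_ring_add: "f \<in> poly_ring V \<Longrightarrow> g \<in> poly_ring V \<Longrightarrow> f + g \<in> poly_ring V"
  unfolding poly_ring_eq by (rule monomial_span_add)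

lemma poly_ring_diff: "f \<in> poly_ring V \<Longrightarrow> g \<in> poly_ring V \<Longrightarrow> f - g \<in> poly_ring V"
  unfolding poly_ring_eq by (rule monomial_span_diff)

lemma poly_ring_mult: "f \<in> poly_ring V \<Longrightarrow> g \<in> poly_ring V \<Longrightarrow> f * g \<in> poly_ring V"
  unfolding poly_ring_eq by (erule monomial_span_mult, assumption) (auto simp: keys_plus_nat)

lemma poly_ring_sum: "(\<And>i. i \<in> A \<Longrightarrow> f i \<in> poly_ring V) \<Longrightarrow> sum f A \<in> poly_ring V"
  unfolding poly_ring_eq by (rule monomial_span_sum)

lemma poly_ring_0 [simp]: "0 \<in> poly_ring V"
  unfolding poly_ring_eq by simp

lemma poly_ring_single: "Poly_Mapping.keys m \<subseteq> V \<Longrightarrow> Poly_Mapping.single m c \<in> poly_ring V"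
  unfolding poly_ring_eq by (rule monomial_span_single)

lemma poly_ring_1 [simp]: "1 \<in> poly_ring V"
  by (simp add: poly_ring_single flip: single_one)

lemma poly_ring_var: "v \<in> V \<Longrightarrow> var v \<in> poly_ring V"
  by (simp add: var_def poly_ring_single)

text \<open>Truncations, homogeneous components and the splitting of a polynomial along a monomial ideal
  are all of this one kind.\<close>

definition restrict_monomials ::
    "(('v \<Rightarrow>\<^sub>0 nat) \<Rightarrow> bool) \<Rightarrow> ('v, 'k::field) mpoly \<Rightarrow> ('v, 'k) mpoly" where
  "restrict_monomials P f = Abs_poly_mapping (\<lambda>m. Poly_Mapping.lookup f m when P m)"

lemma lookup_restrict_monomials:
  "Poly_Mapping.lookup (restrict_monomials P f) m = (if P m then Poly_Mapping.lookup f m else 0)"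
proof -
  have "finite {m. (Poly_Mapping.lookup f m when P m) \<noteq> 0}"
    by (rule finite_subset[OF _ finite_keys[of f]]) (auto simp: in_keys_iff)
  then show ?thesis by (simp add: restrict_monomials_def)
qed

lemma restrict_monomials_in: "f \<in> monomial_span Q \<Longrightarrow> restrict_monomials P f \<in> monomial_span (\<lambda>m. P m \<and> Q m)"
  by (rule monomial_spanI) (auto simp: lookup_restrict_monomials dest: monomial_spanD split: if_splits)

lemma restrict_monomials_poly_ring: "f \<in> poly_ring V \<Longrightarrow> restrict_monomials P f \<in> poly_ring V"
  unfolding poly_ring_eq by (drule restrict_monomials_in[of _ _ P]) (auto elim: monomial_span_mono)

lemma restrict_monomials_span: "restrict_monomials P f \<in> monomial_span P"
  by (rule monomial_spanI) (auto simp: lookup_restrict_monomials split: if_splits)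

lemma restrict_monomials_add:
  "restrict_monomials P (f + g) = restrict_monomials P f + restrict_monomials P g"
  by (rule poly_mapping_eqI) (simp add: lookup_restrict_monomials lookup_add)

lemma restrict_monomials_diff:
  "restrict_monomials P (f - g) = restrict_monomials P f - restrict_monomials P g"
  by (rule poly_mapping_eqI) (simp add: lookup_restrict_monomials lookup_minus)

lemma restrict_monomials_0 [simp]: "restrict_monomials P 0 = 0"
  by (rule poly_mapping_eqI) (simp add: lookup_restrict_monomials)

lemma restrict_monomials_sum:
  "restrict_monomials P (sum f A) = (\<Sum>i\<in>A. restrict_monomials P (f i))"
  by (rule poly_mapping_eqI) (simp add: lookup_restrict_monomials lookup_sum)

lemma restrict_monomials_id: "f \<in> monomial_span P \<Longrightarrow> restrict_monomials P f = f"
  by (rule poly_mapping_eqI) (auto simp: lookup_restrict_monomials dest: monomial_spanD)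

lemma restrict_monomials_none: "f \<in> monomial_span (\<lambda>m. \<not> P m) \<Longrightarrow> restrict_monomials P f = 0"
  by (rule poly_mapping_eqI) (auto simp: lookup_restrict_monomials dest: monomial_spanD)

lemma restrict_monomials_split:
  "restrict_monomials P f + restrict_monomials (\<lambda>m. \<not> P m) f = f"
  by (rule poly_mapping_eqI) (auto simp: lookup_restrict_monomials lookup_add)

text \<open>Multiplication by \<open>g\<close> commutes with restriction if all monomials of \<open>g\<close>
turn the condition \<open>P\<close> into \<open>Q\<close>. This covers truncation in low degrees
(\<open>g\<close> a variable) and homogeneous components (\<open>g\<close> homogeneous).\<close>
lemma restrict_monomials_mult:
  assumes "g \<in> monomial_span G" and PQ: "\<And>p m. G p \<Longrightarrow> Q (p + m) \<longleftrightarrow> P m"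
  shows "restrict_monomials Q (g * f) = g * restrict_monomials P f"
proof -
  have a: "g * restrict_monomials P f \<in> monomial_span Q"
    by (rule monomial_span_mult[OF assms(1) restrict_monomials_span]) (simp add: PQ)
  have b: "g * restrict_monomials (\<lambda>m. \<not> P m) f \<in> monomial_span (\<lambda>m. \<not> Q m)"
    by (rule monomial_span_mult[OF assms(1) restrict_monomials_span]) (simp add: PQ)
  have "g * f = g * restrict_monomials P f + g * restrict_monomials (\<lambda>m. \<not> P m) f"
    by (metis restrict_monomials_split distrib_left)
  then show ?thesis
    by (simp add: restrict_monomials_add restrict_monomials_id[OF a] restrict_monomials_none[OF b])
qed

lemma sum_monomials: "(\<Sum>m\<in>Poly_Mapping.keys f. Poly_Mapping.single m (Poly_Mapping.lookup f m)) = f"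
  by (rule poly_mapping_eqI)
    (auto simp: lookup_sum lookup_single when_def in_keys_iff sum.delta)

lemma var_in_span: "var v \<in> monomial_span (\<lambda>m. m = Poly_Mapping.single v 1)"
  unfolding var_def by (rule monomial_span_single) simp

lemma lookup_var_mult:
  "Poly_Mapping.lookup (var v * f) (Poly_Mapping.single v 1 + m) = Poly_Mapping.lookup f m"
proof -
  let ?Q = "\<lambda>p. p = Poly_Mapping.single v 1 + m"
  have "restrict_monomials ?Q (var v * f) = var v * restrict_monomials (\<lambda>p. p = m) f"
    by (rule restrict_monomials_mult[OF var_in_span]) simp
  also have "restrict_monomials (\<lambda>p. p = m) f = Poly_Mapping.single m (Poly_Mapping.lookup f m)"
    by (rule poly_mapping_eqI) (simp add: lookup_restrict_monomials lookup_single when_def)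
  also have "var v * \<dots> = Poly_Mapping.single (Poly_Mapping.single v 1 + m) (Poly_Mapping.lookup f m)"
    by (simp add: var_def mult_single)
  finally have "Poly_Mapping.lookup (restrict_monomials ?Q (var v * f)) (Poly_Mapping.single v 1 + m)
    = Poly_Mapping.lookup f m" by simp
  then show ?thesis by (simp add: lookup_restrict_monomials)
qed

lemma var_mult_in_span_iff:
  "var v * f \<in> monomial_span Q \<longleftrightarrow> f \<in> monomial_span (\<lambda>m. Q (Poly_Mapping.single v 1 + m))"
proof
  assume "var v * f \<in> monomial_span Q"
  then show "f \<in> monomial_span (\<lambda>m. Q (Poly_Mapping.single v 1 + m))"
    by (metis lookup_var_mult monomial_spanD monomial_spanI)
next
  assume "f \<in> monomial_span (\<lambda>m. Q (Poly_Mapping.single v 1 + m))"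
  from var_in_span this show "var v * f \<in> monomial_span Q"
    by (rule monomial_span_mult) simp
qed

lemma divisible_by_var:
  assumes "f \<in> monomial_span (\<lambda>m. v \<in> Poly_Mapping.keys m)"
  shows "\<exists>e. f = var v * e"
proof
  let ?s = "Poly_Mapping.single v (1::nat)"
  let ?e = "\<Sum>m\<in>Poly_Mapping.keys f. Poly_Mapping.single (m - ?s) (Poly_Mapping.lookup f m)"
  have "?s + (m - ?s) = m" if "m \<in> Poly_Mapping.keys f" for m
    using assms that
    by (intro poly_mapping_eqI)
      (auto simp: monomial_span_def in_keys_iff lookup_add lookup_minus lookup_single when_def)
  then have "var v * ?e = (\<Sum>m\<in>Poly_Mapping.keys f. Poly_Mapping.single m (Poly_Mapping.lookup f m))"
    by (simp add: sum_distrib_left var_def mult_single)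
  then show "f = var v * ?e" by (simp add: sum_monomials)
qed

section \<open>The Koszul complex\<close>

text \<open>The enumeration \<open>ord\<close> of the variables serves only to fix the signs of the Koszul
complex. A chain with coefficients in the polynomial ring is a function \<open>c\<close> on sets of variables:
\<open>c T\<close> is the coefficient of the exterior monomial of \<open>T\<close>. Chains of all homological
degrees are treated at once.\<close>
locale koszul =
  fixes V :: "'v set" and ord :: "'v \<Rightarrow> nat"
  assumes finite_V: "finite V" and inj_ord: "inj_on ord V"
begin

definition ksign :: "'v \<Rightarrow> 'v set \<Rightarrow> ('v, 'k::field) mpoly" where
  "ksign v T = (- 1) ^ card {u \<in> T \<inter> V. ord u < ord v}"

text \<open>The Koszul differential, read off coefficientwise: the exterior monomials whose boundary involves
that of \<open>T\<close> are those of \<open>T\<close> with one further variable. It raises the polynomial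
degree of the coefficients by one.\<close>
definition bd :: "('v set \<Rightarrow> ('v, 'k::field) mpoly) \<Rightarrow> 'v set \<Rightarrow> ('v, 'k) mpoly" where
  "bd c T = (\<Sum>v\<in>V - T. ksign v T * (var v * c (insert v T)))"

text \<open>Exterior multiplication by \<open>x\<close>, the homotopy between multiplication by \<open>x\<close>
and zero.\<close>
definition insertion :: "'v \<Rightarrow> ('v set \<Rightarrow> ('v, 'k::field) mpoly) \<Rightarrow> 'v set \<Rightarrow> ('v, 'k) mpoly" where
  "insertion x c T = (if x \<in> T then ksign x (T - {x}) * c (T - {x}) else 0)"

lemma ksign_cases: "(ksign v T :: ('v, 'k::field) mpoly) = 1 \<or> (ksign v T :: ('v, 'k) mpoly) = - 1"
  unfolding ksign_def using neg_one_even_power neg_one_odd_power by blast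

lemma ksign_square: "ksign v T * ksign v T = (1 :: ('v, 'k::field) mpoly)"
  using ksign_cases[of v T, where 'k='k] by auto

lemma ksign_mult_in_span [simp]:
  fixes f :: "('v, 'k::field) mpoly"
  shows "ksign v T * f \<in> monomial_span P \<longleftrightarrow> f \<in> monomial_span P"
  using ksign_cases[of v T, where 'k='k] by auto

lemma ksign_insert:
  assumes "u \<in> V" "u \<notin> T"
  shows "ksign v (insert u T) = ksign v T * (if ord u < ord v then - 1 else 1)"
proof (cases "ord u < ord v")
  case True
  have eq: "{w \<in> insert u T \<inter> V. ord w < ord v} = insert u {w \<in> T \<inter> V. ord w < ord v}"
    using True assms by auto
  have "finite {w \<in> T \<inter> V. ord w < ord v}" using finite_V by auto
  with True show ?thesis unfolding ksign_def eq using assms(2) by simp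
next
  case False
  have "{w \<in> insert u T \<inter> V. ord w < ord v} = {w \<in> T \<inter> V. ord w < ord v}"
    using False by auto
  with False show ?thesis unfolding ksign_def by simp
qed

lemma ksign_self: "ksign x (insert x T) = ksign x T"
proof -
  have "{w \<in> insert x T \<inter> V. ord w < ord x} = {w \<in> T \<inter> V. ord w < ord x}" by auto
  then show ?thesis unfolding ksign_def by simp
qed

lemma ksign_swap:
  assumes "v \<in> V" "u \<in> V" "v \<noteq> u" "v \<notin> T" "u \<notin> T"
  shows "ksign v T * ksign u (insert v T) = - (ksign u T * ksign v (insert u T) :: ('v, 'k::field) mpoly)"
proof -
  have "ord v \<noteq> ord u" using inj_ord assms by (auto dest: inj_onD)
  then show ?thesis using assms by (auto simp: ksign_insert mult.commute)
qed

lemma bd_sum: "bd (\<lambda>T. \<Sum>i\<in>A. p i * c i T) T = (\<Sum>i\<in>A. p i * bd (c i) T)"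
  unfolding bd_def by (simp add: sum_distrib_left sum.swap[of _ A] ac_simps)

lemma bd_add: "bd (\<lambda>T. c T + d T) T = bd c T + bd d T"
  unfolding bd_def by (simp add: algebra_simps sum.distrib)

lemma bd_diff: "bd (\<lambda>T. c T - d T) T = bd c T - bd d T"
  unfolding bd_def by (simp add: algebra_simps sum_subtractf)

lemma bd_mult: "bd (\<lambda>T. p * c T) T = p * bd c T"
  unfolding bd_def by (simp add: sum_distrib_left ac_simps)

lemma bd_bd:
  fixes c :: "'v set \<Rightarrow> ('v, 'k::field) mpoly"
  shows "bd (bd c) T = 0"
proof -
  define g where "g = (\<lambda>(v, u). ksign v T * ksign u (insert v T) * (var v * (var u * c (insert v (insert u T)))))"
  define A where "A = {(v, u). v \<in> V - T \<and> u \<in> V - T \<and> ord v < ord u}"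
  define B where "B = {(v, u). v \<in> V - T \<and> u \<in> V - T \<and> ord u < ord v}"
  have finA: "finite A" and finB: "finite B"
    by (rule finite_subset[of _ "V \<times> V"]; use finite_V in \<open>auto simp: A_def B_def\<close>)+
  \<comment> \<open>The terms of the double sum for \<open>(v, u)\<close> and \<open>(u, v)\<close> cancel. They
    are matched by splitting at the order of \<open>v\<close> and \<open>u\<close>, which is valid in
    characteristic 2 as well.\<close>
  have AB: "(SIGMA v : V - T. V - insert v T) = A \<union> B"
    using inj_ord by (fastforce simp: A_def B_def dest: inj_onD)
  have "bd (bd c) T = (\<Sum>v\<in>V - T. \<Sum>u\<in>V - insert v T. g (v, u))"
    unfolding bd_def g_def by (simp add: sum_distrib_left insert_commute ac_simps)
  also have "\<dots> = sum g (A \<union> B)"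
    using finite_V by (simp add: sum.Sigma AB)
  also have "\<dots> = sum g A + sum g B"
    by (rule sum.union_disjoint[OF finA finB]) (auto simp: A_def B_def)
  also have "sum g B = (\<Sum>p\<in>A. g (snd p, fst p))"
    by (rule sum.reindex_bij_witness[of _ "\<lambda>(v, u). (u, v)" "\<lambda>(v, u). (u, v)"])
      (auto simp: A_def B_def)
  also have "sum g A + \<dots> = (\<Sum>p\<in>A. g p + g (snd p, fst p))"
    by (simp add: sum.distrib)
  also have "\<dots> = 0"
  proof (rule sum.neutral, clarify)
    fix v u assume "(v, u) \<in> A"
    then have "v \<in> V" "u \<in> V" "v \<noteq> u" "v \<notin> T" "u \<notin> T" by (auto simp: A_def)
    then have swap: "ksign v T * ksign u (insert v T) = - (ksign u T * ksign v (insert u T) :: ('v, 'k) mpoly)"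
      by (rule ksign_swap)
    have "g (u, v) = ksign u T * ksign v (insert u T) * (var v * (var u * c (insert v (insert u T))))"
      by (simp add: g_def insert_commute mult.left_commute[of "var u" "var v"])
    moreover have "g (v, u) = - (ksign u T * ksign v (insert u T)) * (var v * (var u * c (insert v (insert u T))))"
      by (simp only: g_def prod.case swap)
    ultimately show "g (v, u) + g (snd (v, u), fst (v, u)) = 0" by simp
  qed
  finally show ?thesis .
qed

lemma insertion_homotopy:
  fixes e :: "'v set \<Rightarrow> ('v, 'k::field) mpoly"
  assumes x: "x \<in> V"
  shows "bd (insertion x e) T + insertion x (bd e) T = var x * e T"
proof (cases "x \<in> T")
  case False
  have "bd (insertion x e) T = (\<Sum>v\<in>V - T. if v = x then ksign x T * (var x * (ksign x T * e T)) else 0)"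
    unfolding bd_def by (rule sum.cong) (use False in \<open>auto simp: insertion_def ksign_self\<close>)
  also have "\<dots> = ksign x T * ksign x T * (var x * e T)"
    using x False finite_V by (simp add: ac_simps)
  finally show ?thesis using False by (simp add: insertion_def ksign_square)
next
  case True
  define S where "S = T - {x}"
  have T: "T = insert x S" and xS: "x \<notin> S" using True by (auto simp: S_def)
  have VS: "V - S = insert x (V - T)" and xVT: "x \<notin> V - T" using x xS T by auto
  have "insertion x (bd e) T = ksign x S * (\<Sum>v\<in>V - S. ksign v S * (var v * e (insert v S)))"
    using True by (simp add: insertion_def bd_def S_def)
  also have "\<dots> = ksign x S * ksign x S * (var x * e T)
      + (\<Sum>v\<in>V - T. ksign x S * (ksign v S * (var v * e (insert v S))))"
    unfolding VS using xVT finite_V by (simp add: sum_distrib_left T distrib_left ac_simps)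
  also have "(\<Sum>v\<in>V - T. ksign x S * (ksign v S * (var v * e (insert v S))))
      = (\<Sum>v\<in>V - T. - (ksign v T * (var v * insertion x e (insert v T))))"
  proof (rule sum.cong[OF refl])
    fix v assume v: "v \<in> V - T"
    then have eq: "insert v T - {x} = insert v S" using T xS by auto
    have neq: "v \<noteq> x" "v \<notin> S" using v T by auto
    have "ksign v T * ksign x (insert v S) = - (ksign x S * ksign v S :: ('v, 'k) mpoly)"
    proof -
      have "ord v \<noteq> ord x" using v x neq inj_ord by (auto dest: inj_onD)
      then show ?thesis using v x xS neq by (auto simp: T ksign_insert mult.commute)
    qed
    then have "ksign v T * (ksign x (insert v S) * (var v * e (insert v S)))
        = - (ksign x S * ksign v S) * (var v * e (insert v S))"
      by (simp only: mult.assoc[symmetric])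
    moreover have "insertion x e (insert v T) = ksign x (insert v S) * e (insert v S)"
      using True by (simp add: insertion_def eq)
    ultimately show "ksign x S * (ksign v S * (var v * e (insert v S)))
        = - (ksign v T * (var v * insertion x e (insert v T)))"
      by (simp add: ac_simps)
  qed
  also have "\<dots> = - bd (insertion x e) T" by (simp add: bd_def sum_negf)
  finally show ?thesis by (simp add: ksign_square)
qed

lemma bd_in_span:
  assumes "\<And>T. c T \<in> monomial_span P" "\<And>v m. v \<in> V \<Longrightarrow> P m \<Longrightarrow> Q (Poly_Mapping.single v 1 + m)"
  shows "bd c T \<in> monomial_span Q"
  unfolding bd_def
proof (rule monomial_span_sum)
  fix v assume "v \<in> V - T"
  then show "ksign v T * (var v * c (insert v T)) \<in> monomial_span Q"
    using assms by (auto simp: var_mult_in_span_iff intro: monomial_span_mono[OF assms(1)])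
qed

lemma bd_in_poly_ring: "(\<And>T. c T \<in> poly_ring V) \<Longrightarrow> bd c T \<in> poly_ring V"
  unfolding poly_ring_eq by (rule bd_in_span) (auto simp: keys_plus_nat)

lemma restrict_ksign:
  fixes f :: "('v, 'k::field) mpoly"
  shows "restrict_monomials P (ksign v T * f) = ksign v T * restrict_monomials P f"
  using ksign_cases[of v T, where 'k='k] restrict_monomials_diff[of P 0 f] by auto

lemma restrict_bd:
  assumes "\<And>v m. v \<in> V \<Longrightarrow> Q (Poly_Mapping.single v 1 + m) \<longleftrightarrow> P m"
  shows "restrict_monomials Q (bd c T) = bd (\<lambda>T. restrict_monomials P (c T)) T"
  unfolding bd_def restrict_monomials_sum restrict_ksign
  by (rule sum.cong) (use assms in \<open>auto intro!: arg_cong2[where f = "(*)"] restrict_monomials_mult[OF var_in_span]\<close>)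

lemma insertion_in_span:
  "(\<And>T. c T \<in> monomial_span P) \<Longrightarrow> insertion x c T \<in> monomial_span P"
  by (simp add: insertion_def)

section \<open>Vanishing of Koszul homology in high degrees\<close>

text \<open>\<open>U\<close> is an upward closed condition on supports and describes the ideal spanned by all
monomials whose support satisfies it. The condition says that \<open>Tor\<^sub>p\<close> of the residue field
with the quotient by this ideal is zero in all internal degrees greater than \<open>p + r\<close>: a coefficient
at \<open>T\<close> of polynomial degree \<open>n\<close> has internal degree \<open>n + card T\<close>, so the
bound on the coefficients does not depend on \<open>p\<close>. The coefficient field appears only in the type of
the chains and is passed as a type argument.\<close>
definition koszul_vanishes :: "'k::field itself \<Rightarrow> ('v set \<Rightarrow> bool) \<Rightarrow> int \<Rightarrow> bool" where
  "koszul_vanishes K U r \<longleftrightarrow> (\<forall>c :: 'v set \<Rightarrow> ('v, 'k) mpoly.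
     (\<forall>T. c T \<in> monomial_span (\<lambda>m. Poly_Mapping.keys m \<subseteq> V \<and> r < int (mon_degree m))) \<longrightarrow>
     (\<forall>T. bd c T \<in> monomial_span (\<lambda>m. U (Poly_Mapping.keys m))) \<longrightarrow>
     (\<exists>b. (\<forall>T. b T \<in> poly_ring V) \<and>
        (\<forall>T. c T - bd b T \<in> monomial_span (\<lambda>m. U (Poly_Mapping.keys m)))))"

lemma koszul_vanishesD:
  fixes c :: "'v set \<Rightarrow> ('v, 'k::field) mpoly"
  assumes "koszul_vanishes TYPE('k) U r"
    "\<And>T. c T \<in> monomial_span (\<lambda>m. Poly_Mapping.keys m \<subseteq> V \<and> r < int (mon_degree m))"
    "\<And>T. bd c T \<in> monomial_span (\<lambda>m. U (Poly_Mapping.keys m))"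
  obtains b where "\<And>T. b T \<in> poly_ring V"
    "\<And>T. c T - bd b T \<in> monomial_span (\<lambda>m. U (Poly_Mapping.keys m))"
  using assms unfolding koszul_vanishes_def by blast

lemma upward_closedD: "mono U \<Longrightarrow> U S \<Longrightarrow> S \<subseteq> T \<Longrightarrow> U T"
  by (auto dest: monoD)

lemma koszul_vanishes_unit: "U {} \<Longrightarrow> mono U \<Longrightarrow> koszul_vanishes K U r"
  unfolding koszul_vanishes_def monomial_span_def
  by (intro allI impI exI[of _ "\<lambda>_. 0"]) (simp, blast intro: upward_closedD)

lemma koszul_vanishes_cong:
  assumes eq: "\<And>T. T \<subseteq> V \<Longrightarrow> U T \<longleftrightarrow> U' T" and "koszul_vanishes TYPE('k::field) U r"
  shows "koszul_vanishes TYPE('k) U' r"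
  unfolding koszul_vanishes_def
proof (intro allI impI)
  fix c :: "'v set \<Rightarrow> ('v, 'k) mpoly"
  assume c: "\<forall>T. c T \<in> monomial_span (\<lambda>m. Poly_Mapping.keys m \<subseteq> V \<and> r < int (mon_degree m))"
    and dc: "\<forall>T. bd c T \<in> monomial_span (\<lambda>m. U' (Poly_Mapping.keys m))"
  have swap: "f \<in> monomial_span (\<lambda>m. U1 (Poly_Mapping.keys m)) \<Longrightarrow> f \<in> monomial_span (\<lambda>m. U2 (Poly_Mapping.keys m))"
    if "f \<in> poly_ring V" "\<And>T. T \<subseteq> V \<Longrightarrow> U1 T \<longleftrightarrow> U2 T" for f :: "('v, 'k) mpoly" and U1 U2
    using that by (auto simp: monomial_span_def poly_ring_def)
  have c_ring: "c T \<in> poly_ring V" for T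
    by (rule monomial_span_imp_poly_ring[OF spec[OF c]])
  have "bd c T \<in> monomial_span (\<lambda>m. U (Poly_Mapping.keys m))" for T
    by (rule swap[OF bd_in_poly_ring[OF c_ring] _ spec[OF dc]]) (simp add: eq)
  then obtain b where b: "\<And>T. b T \<in> poly_ring V"
      "\<And>T. c T - bd b T \<in> monomial_span (\<lambda>m. U (Poly_Mapping.keys m))"
    using koszul_vanishesD[OF assms(2), of c] c by blast
  have "c T - bd b T \<in> monomial_span (\<lambda>m. U' (Poly_Mapping.keys m))" for T
    by (rule swap[OF _ eq b(2)]) (intro poly_ring_diff c_ring bd_in_poly_ring b)
  with b(1) show "\<exists>b. (\<forall>T. b T \<in> poly_ring V) \<and>
      (\<forall>T. c T - bd b T \<in> monomial_span (\<lambda>m. U' (Poly_Mapping.keys m)))" by blast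
qed

text \<open>The first step in the two exact-sequence arguments below: an element of \<open>I + (x)\<close> is
split into its part in \<open>I\<close> and a multiple of \<open>x\<close>, and the cofactor \<open>e\<close>
inherits, up to the shift by \<open>x\<close>, every condition on the monomials.\<close>
lemma split_off_variable:
  fixes d :: "'v set \<Rightarrow> ('v, 'k::field) mpoly"
  assumes "\<And>T. d T \<in> monomial_span (\<lambda>m. U (Poly_Mapping.keys m) \<or> x \<in> Poly_Mapping.keys m)"
  obtains i e where "\<And>T. d T = i T + var x * e T"
    "\<And>T. i T \<in> monomial_span (\<lambda>m. U (Poly_Mapping.keys m))"
    "\<And>T P. d T \<in> monomial_span P \<Longrightarrow> e T \<in> monomial_span (\<lambda>m. P (Poly_Mapping.single x 1 + m))"
proof -
  define i where "i = (\<lambda>T. restrict_monomials (\<lambda>m. U (Poly_Mapping.keys m)) (d T))"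
  define k where "k = (\<lambda>T. restrict_monomials (\<lambda>m. \<not> U (Poly_Mapping.keys m)) (d T))"
  have "\<exists>e. k T = var x * e" for T
    by (rule divisible_by_var)
      (use restrict_monomials_in[OF assms[of T], of "\<lambda>m. \<not> U (Poly_Mapping.keys m)"] in
        \<open>auto simp: k_def elim!: monomial_span_mono\<close>)
  then obtain e where e: "\<And>T. k T = var x * e T" by metis
  show ?thesis
  proof
    show "d T = i T + var x * e T" for T
      unfolding e[symmetric] i_def k_def by (simp add: restrict_monomials_split)
    show "i T \<in> monomial_span (\<lambda>m. U (Poly_Mapping.keys m))" for T
      by (simp add: i_def restrict_monomials_span)
    show "e T \<in> monomial_span (\<lambda>m. P (Poly_Mapping.single x 1 + m))" if "d T \<in> monomial_span P" for T P
      unfolding var_mult_in_span_iff[symmetric] e[symmetric] k_def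
      by (rule monomial_span_mono[OF restrict_monomials_in[OF that]]) simp
  qed
qed

text \<open>This is the long exact sequence of \<open>0 \<rightarrow> S/(I : x)(-1) \<rightarrow> S/I
\<rightarrow> S/(I + (x)) \<rightarrow> 0\<close>, on elements. A cycle \<open>c\<close> of \<open>S/I\<close>
bounds modulo \<open>I + (x)\<close>, so that \<open>c = bd b + i + x e\<close>; then \<open>e\<close> is a
cycle of \<open>S/(I : x)\<close> of degree one less, and a primitive of it corrects \<open>b\<close>.\<close>
lemma koszul_vanishes_split:
  assumes x: "x \<in> V"
    and colon: "koszul_vanishes TYPE('k::field) (\<lambda>T. U (insert x T)) (r - 1)"
    and plus: "koszul_vanishes TYPE('k) (\<lambda>T. U T \<or> x \<in> T) r"
    and mono: "mono U"
  shows "koszul_vanishes TYPE('k) U r"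
  unfolding koszul_vanishes_def
proof (intro allI impI)
  fix c :: "'v set \<Rightarrow> ('v, 'k) mpoly"
  let ?I = "monomial_span (\<lambda>m. U (Poly_Mapping.keys m)) :: ('v, 'k) mpoly set"
  let ?Q = "\<lambda>m :: 'v \<Rightarrow>\<^sub>0 nat. r < int (mon_degree m)"
  let ?P = "\<lambda>m :: 'v \<Rightarrow>\<^sub>0 nat. r - 1 < int (mon_degree m)"
  assume c: "\<forall>T. c T \<in> monomial_span (\<lambda>m. Poly_Mapping.keys m \<subseteq> V \<and> r < int (mon_degree m))"
    and dc: "\<forall>T. bd c T \<in> ?I"
  obtain b0 where b0: "\<And>T. b0 T \<in> poly_ring V"
      "\<And>T. c T - bd b0 T \<in> monomial_span (\<lambda>m. U (Poly_Mapping.keys m) \<or> x \<in> Poly_Mapping.keys m)"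
    by (rule koszul_vanishesD[OF plus]) (use c dc in \<open>auto elim: monomial_span_mono\<close>)
  \<comment> \<open>The low-degree part of \<open>b0\<close> is discarded, in order that \<open>e\<close> lie in
    the range of degrees in which the homology of \<open>S/(I : x)\<close> vanishes. All ideals here are
    homogeneous, so nothing else changes.\<close>
  define b where "b = (\<lambda>T. restrict_monomials ?P (b0 T))"
  have b_ring: "b T \<in> poly_ring V" for T
    unfolding b_def by (rule restrict_monomials_poly_ring[OF b0(1)])
  define d where "d = (\<lambda>T. c T - bd b T)"
  have d_eq: "d T = restrict_monomials ?Q (c T - bd b0 T)" for T
  proof -
    have "restrict_monomials ?Q (c T) = c T"
      by (rule restrict_monomials_id) (use c in \<open>auto elim: monomial_span_mono\<close>)
    moreover have "restrict_monomials ?Q (bd b0 T) = bd b T"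
      unfolding b_def by (rule restrict_bd) auto
    ultimately show ?thesis by (simp add: d_def restrict_monomials_diff)
  qed
  have d_split: "d T \<in> monomial_span (\<lambda>m. U (Poly_Mapping.keys m) \<or> x \<in> Poly_Mapping.keys m)" for T
    unfolding d_eq by (rule monomial_span_mono[OF restrict_monomials_in[OF b0(2)]]) simp
  have d_deg: "d T \<in> monomial_span (\<lambda>m. Poly_Mapping.keys m \<subseteq> V \<and> r < int (mon_degree m))" for T
  proof -
    have "c T - bd b0 T \<in> poly_ring V"
      by (rule poly_ring_diff[OF _ bd_in_poly_ring[OF b0(1)]])
        (rule monomial_span_imp_poly_ring[OF spec[OF c]])
    then show ?thesis
      unfolding d_eq poly_ring_eq by (rule monomial_span_mono[OF restrict_monomials_in]) simp
  qed
  obtain i e where ie: "\<And>T. d T = i T + var x * e T" "\<And>T. i T \<in> ?I"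
      "\<And>T P. d T \<in> monomial_span P \<Longrightarrow> e T \<in> monomial_span (\<lambda>m. P (Poly_Mapping.single x 1 + m))"
    using split_off_variable[where d=d and U=U and x=x, OF d_split] by blast
  have e_deg: "e T \<in> monomial_span (\<lambda>m. Poly_Mapping.keys m \<subseteq> V \<and> r - 1 < int (mon_degree m))" for T
    by (rule monomial_span_mono[OF ie(3)[OF d_deg]]) (simp_all add: keys_plus_nat)
  have de: "bd e T \<in> monomial_span (\<lambda>m. U (insert x (Poly_Mapping.keys m)))" for T
  proof -
    have "d = (\<lambda>T. i T + var x * e T)" by (rule ext) (rule ie(1))
    then have "bd d T = bd i T + var x * bd e T" by (simp only: bd_add bd_mult)
    moreover have "bd d T = bd c T" by (simp add: d_def bd_diff bd_bd)
    moreover have "bd i T \<in> ?I"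
      by (rule bd_in_span[OF ie(2)]) (erule upward_closedD[OF mono], auto simp: keys_plus_nat)
    ultimately have "var x * bd e T \<in> ?I"
      using dc monomial_span_diff[of "bd c T" _ "bd i T"] by (metis add_diff_cancel_left')
    then show ?thesis by (simp add: var_mult_in_span_iff keys_plus_nat)
  qed
  obtain b2 where b2: "\<And>T. b2 T \<in> poly_ring V"
      "\<And>T. e T - bd b2 T \<in> monomial_span (\<lambda>m. U (insert x (Poly_Mapping.keys m)))"
    using koszul_vanishesD[OF colon e_deg de] by blast
  show "\<exists>b. (\<forall>T. b T \<in> poly_ring V) \<and> (\<forall>T. c T - bd b T \<in> ?I)"
  proof (intro exI conjI allI)
    show "b T + var x * b2 T \<in> poly_ring V" for T
      by (intro poly_ring_add poly_ring_mult b_ring b2 poly_ring_var x)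
    fix T
    have "var x * (e T - bd b2 T) \<in> ?I"
      unfolding var_mult_in_span_iff by (rule monomial_span_mono[OF b2(2)]) (simp add: keys_plus_nat)
    then have "i T + var x * (e T - bd b2 T) \<in> ?I" by (rule monomial_span_add[OF ie(2)])
    moreover have "i T + var x * (e T - bd b2 T) = c T - bd (\<lambda>T. b T + var x * b2 T) T"
      using ie(1)[of T] by (simp add: d_def bd_add bd_mult algebra_simps)
    ultimately show "c T - bd (\<lambda>T. b T + var x * b2 T) T \<in> ?I" by simp
  qed
qed

text \<open>If \<open>I : x = I\<close>, the remainder \<open>x e\<close> in \<open>c = bd b + i + x e\<close>
needs no vanishing result: \<open>e\<close> is a cycle modulo \<open>I\<close>, and \<open>x\<close> times a
cycle bounds by \<open>insertion_homotopy\<close>. Adjoining \<open>x\<close> to the ideal therefore leaves the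
bound as it is.\<close>
lemma koszul_vanishes_cone:
  assumes x: "x \<in> V" and free: "\<And>T. U (insert x T) \<Longrightarrow> U T"
    and plus: "koszul_vanishes TYPE('k::field) (\<lambda>T. U T \<or> x \<in> T) r"
    and mono: "mono U"
  shows "koszul_vanishes TYPE('k) U r"
  unfolding koszul_vanishes_def
proof (intro allI impI)
  fix c :: "'v set \<Rightarrow> ('v, 'k) mpoly"
  let ?I = "monomial_span (\<lambda>m. U (Poly_Mapping.keys m)) :: ('v, 'k) mpoly set"
  assume c: "\<forall>T. c T \<in> monomial_span (\<lambda>m. Poly_Mapping.keys m \<subseteq> V \<and> r < int (mon_degree m))"
    and dc: "\<forall>T. bd c T \<in> ?I"
  obtain b where b: "\<And>T. b T \<in> poly_ring V"
      "\<And>T. c T - bd b T \<in> monomial_span (\<lambda>m. U (Poly_Mapping.keys m) \<or> x \<in> Poly_Mapping.keys m)"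
    by (rule koszul_vanishesD[OF plus]) (use c dc in \<open>auto elim: monomial_span_mono\<close>)
  define d where "d = (\<lambda>T. c T - bd b T)"
  have d_ring: "d T \<in> poly_ring V" for T
    unfolding d_def by (rule poly_ring_diff[OF _ bd_in_poly_ring[OF b(1)]])
      (rule monomial_span_imp_poly_ring[OF spec[OF c]])
  obtain i e where ie: "\<And>T. d T = i T + var x * e T" "\<And>T. i T \<in> ?I"
      "\<And>T P. d T \<in> monomial_span P \<Longrightarrow> e T \<in> monomial_span (\<lambda>m. P (Poly_Mapping.single x 1 + m))"
    using split_off_variable[where d=d and U=U and x=x] b(2) unfolding d_def by blast
  have e_ring: "e T \<in> poly_ring V" for T
    unfolding poly_ring_eq
    by (rule monomial_span_mono[OF ie(3)[OF d_ring[unfolded poly_ring_eq]]]) (simp add: keys_plus_nat)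
  have "bd e T \<in> ?I" for T
  proof -
    have "d = (\<lambda>T. i T + var x * e T)" by (rule ext) (rule ie(1))
    then have "bd d T = bd i T + var x * bd e T" by (simp only: bd_add bd_mult)
    moreover have "bd d T = bd c T" by (simp add: d_def bd_diff bd_bd)
    moreover have "bd i T \<in> ?I"
      by (rule bd_in_span[OF ie(2)]) (erule upward_closedD[OF mono], auto simp: keys_plus_nat)
    ultimately have "var x * bd e T \<in> ?I"
      using dc monomial_span_diff[of "bd c T" _ "bd i T"] by (metis add_diff_cancel_left')
    then show ?thesis unfolding var_mult_in_span_iff
      by (rule monomial_span_mono) (auto simp: keys_plus_nat intro: free)
  qed
  then have *: "insertion x (bd e) T \<in> ?I" for T by (rule insertion_in_span)
  show "\<exists>b. (\<forall>T. b T \<in> poly_ring V) \<and> (\<forall>T. c T - bd b T \<in> ?I)"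
  proof (intro exI conjI allI)
    show "b T + insertion x e T \<in> poly_ring V" for T
      unfolding poly_ring_eq
      by (intro monomial_span_add insertion_in_span b(1)[unfolded poly_ring_eq] e_ring[unfolded poly_ring_eq])
    fix T
    have "c T - bd (\<lambda>T. b T + insertion x e T) T = i T + insertion x (bd e) T"
      using ie(1)[of T] insertion_homotopy[OF x, of e T] by (simp add: d_def bd_add algebra_simps)
    then show "c T - bd (\<lambda>T. b T + insertion x e T) T \<in> ?I"
      using monomial_span_add[OF ie(2) *] by simp
  qed
qed

text \<open>The quotient by an ideal generated by variables has regularity 0. If all variables are generators,
the coefficients of positive degree lie in the ideal. From there the variables outside \<open>D\<close> are removed
one at a time with \<open>koszul_vanishes_cone\<close>.\<close>
lemma koszul_vanishes_variables:
  assumes "0 \<le> r" "D \<subseteq> V"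
  shows "koszul_vanishes TYPE('k::field) (\<lambda>T. T \<inter> D \<noteq> {}) r"
proof -
  have "finite (V - D)" using finite_V by simp
  then show ?thesis using assms(2)
  proof (induction "V - D" arbitrary: D rule: finite_induct)
    case empty
    then have D: "D = V" by auto
    show ?case
      unfolding koszul_vanishes_def
    proof (intro allI impI exI[of _ "\<lambda>_. 0"] conjI)
      fix c :: "'v set \<Rightarrow> ('v, 'k) mpoly" and T
      assume "\<forall>T. c T \<in> monomial_span (\<lambda>m. Poly_Mapping.keys m \<subseteq> V \<and> r < int (mon_degree m))"
      then have "c T \<in> monomial_span (\<lambda>m. Poly_Mapping.keys m \<inter> D \<noteq> {})"
        unfolding D using assms(1)
        by (auto elim!: allE[of _ T] monomial_span_mono simp: mon_degree_def Int_absorb2)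
      then show "c T - bd (\<lambda>_. 0) T \<in> monomial_span (\<lambda>m. Poly_Mapping.keys m \<inter> D \<noteq> {})"
        by (simp add: bd_def)
    qed simp
  next
    case (insert x F)
    have x: "x \<in> V" "x \<notin> D" using insert.hyps(4) by auto
    have "koszul_vanishes TYPE('k) (\<lambda>T. T \<inter> insert x D \<noteq> {}) r"
      by (rule insert.hyps(3)) (use insert.hyps insert.prems x in auto)
    moreover have "(\<lambda>T. T \<inter> insert x D \<noteq> {}) = (\<lambda>T. T \<inter> D \<noteq> {} \<or> x \<in> T)" by auto
    ultimately have plus: "koszul_vanishes TYPE('k) (\<lambda>T. T \<inter> D \<noteq> {} \<or> x \<in> T) r" by simp
    have up: "mono (\<lambda>T. T \<inter> D \<noteq> {})" by (rule monoI) auto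
    show ?case by (rule koszul_vanishes_cone[OF x(1) _ plus up]) (use x in auto)
  qed
qed

text \<open>The supports of the monomials in \<open>(I : x\<^sub>L) + (D)\<close>, where
\<open>x\<^sub>L\<close> is the product of the variables in \<open>L\<close>. The queried variables were put
into \<open>L\<close> by a colon ideal and into \<open>D\<close> by an added generator.\<close>
definition after_queries :: "('v set \<Rightarrow> bool) \<Rightarrow> 'v set \<Rightarrow> 'v set \<Rightarrow> 'v set \<Rightarrow> bool" where
  "after_queries U L D T \<longleftrightarrow> U (T \<union> L) \<or> T \<inter> D \<noteq> {}"

lemma mono_after_queries: "mono U \<Longrightarrow> mono (after_queries U L D)"
proof (rule monoI, rule le_boolI)
  fix S T :: "'v set"
  assume "mono U" "S \<subseteq> T" "after_queries U L D S"
  then show "after_queries U L D T"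
    using upward_closedD[of U "S \<union> L" "T \<union> L"] by (auto simp: after_queries_def)
qed

text \<open>Querying all variables of \<open>W\<close> in turn: only the steps that form a colon ideal lower the
bound, so that a leaf of the decision tree is charged with the size of its set \<open>L'\<close>.\<close>
lemma koszul_vanishes_query:
  assumes mono: "mono U"
    and "finite W" "W \<subseteq> V" "W \<inter> D = {}"
    and "\<And>L'. L' \<subseteq> W \<Longrightarrow>
      koszul_vanishes TYPE('k::field) (after_queries U (L \<union> L') (D \<union> (W - L'))) (r - int (card L'))"
  shows "koszul_vanishes TYPE('k) (after_queries U L D) r"
  using assms(2-)
proof (induction W arbitrary: L D r rule: finite_induct)
  case empty
  then show ?case using empty.prems(3)[of "{}"] by simp
next
  case (insert x W)
  have xD: "x \<notin> D" using insert.prems(2) by auto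
  have "koszul_vanishes TYPE('k) (after_queries U (insert x L) D) (r - 1)"
  proof (rule insert.IH)
    fix L' assume L': "L' \<subseteq> W"
    then have "finite L'" "x \<notin> L'" using insert.hyps finite_subset by auto
    then have c: "r - int (card (insert x L')) = r - 1 - int (card L')" by simp
    have e: "insert x W - insert x L' = W - L'" using insert.hyps by auto
    show "koszul_vanishes TYPE('k) (after_queries U (insert x L \<union> L') (D \<union> (W - L'))) (r - 1 - int (card L'))"
      using insert.prems(3)[of "insert x L'"] L' unfolding c e by auto
  qed (use insert.prems(1,2) in auto)
  moreover have "(\<lambda>T. after_queries U L D (insert x T)) = after_queries U (insert x L) D"
    using xD by (auto simp: after_queries_def fun_eq_iff)
  ultimately have 1: "koszul_vanishes TYPE('k) (\<lambda>T. after_queries U L D (insert x T)) (r - 1)" by simp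
  have "koszul_vanishes TYPE('k) (after_queries U L (insert x D)) r"
  proof (rule insert.IH)
    fix L' assume L': "L' \<subseteq> W"
    then have e: "D \<union> (insert x W - L') = insert x D \<union> (W - L')" using insert.hyps by auto
    show "koszul_vanishes TYPE('k) (after_queries U (L \<union> L') (insert x D \<union> (W - L'))) (r - int (card L'))"
      using insert.prems(3)[of L'] L' unfolding e by auto
  qed (use insert.prems(1,2) insert.hyps in auto)
  moreover have "(\<lambda>T. after_queries U L D T \<or> x \<in> T) = after_queries U L (insert x D)"
    by (auto simp: after_queries_def fun_eq_iff)
  ultimately have 2: "koszul_vanishes TYPE('k) (\<lambda>T. after_queries U L D T \<or> x \<in> T) r" by simp
  show ?case
    by (rule koszul_vanishes_split[OF _ 1 2 mono_after_queries[OF mono]]) (use insert.prems(1) in blast)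
qed

text \<open>A variable is free of cost if it already lies in the ideal, since adding it changes nothing, or if
it does not occur in the generators that survive the queries, by \<open>koszul_vanishes_cone\<close>.\<close>
lemma koszul_vanishes_drop:
  assumes mono: "mono U"
    and "finite A" "A \<subseteq> V"
    and "\<And>j. j \<in> A \<Longrightarrow> U (insert j L) \<or> (\<forall>T. T \<inter> D = {} \<longrightarrow> U (insert j T \<union> L) \<longrightarrow> U (T \<union> L))"
    and "koszul_vanishes TYPE('k::field) (after_queries U L (D \<union> A)) r" "A \<inter> D = {}"
  shows "koszul_vanishes TYPE('k) (after_queries U L D) r"
  using assms(2-)
proof (induction A arbitrary: D rule: finite_induct)
  case empty
  then show ?case by simp
next
  case (insert x A)
  have "koszul_vanishes TYPE('k) (after_queries U L (insert x D)) r"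
  proof (rule insert.IH)
    fix j assume "j \<in> A"
    then show "U (insert j L) \<or> (\<forall>T. T \<inter> insert x D = {} \<longrightarrow> U (insert j T \<union> L) \<longrightarrow> U (T \<union> L))"
      using insert.prems(2)[of j] by auto
  next
    have "insert x D \<union> A = D \<union> insert x A" by auto
    then show "koszul_vanishes TYPE('k) (after_queries U L (insert x D \<union> A)) r"
      using insert.prems(3) by simp
  qed (use insert.prems(1,4) insert.hyps in auto)
  moreover have "(\<lambda>T. after_queries U L D T \<or> x \<in> T) = after_queries U L (insert x D)"
    by (auto simp: after_queries_def fun_eq_iff)
  ultimately have *: "koszul_vanishes TYPE('k) (\<lambda>T. after_queries U L D T \<or> x \<in> T) r" by simp
  have x: "x \<in> V" "x \<notin> D" using insert.prems(1,4) by auto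
  show ?case
  proof (cases "U (insert x L)")
    case True
    have "x \<in> T \<Longrightarrow> U (T \<union> L)" for T by (rule upward_closedD[OF mono True]) auto
    then have "(\<lambda>T. after_queries U L D T \<or> x \<in> T) = after_queries U L D"
      by (auto simp: after_queries_def fun_eq_iff)
    with * show ?thesis by simp
  next
    case False
    then have "T \<inter> D = {} \<longrightarrow> U (insert x T \<union> L) \<longrightarrow> U (T \<union> L)" for T
      using insert.prems(2)[of x] by blast
    then have "after_queries U L D (insert x T) \<Longrightarrow> after_queries U L D T" for T
      using x(2) by (auto simp: after_queries_def)
    then show ?thesis
      by (rule koszul_vanishes_cone[OF x(1) _ * mono_after_queries[OF mono]])
  qed
qed

text \<open>If \<open>L\<close> is a face, the ideal obtained after all queries and after adjoining \<open>V -
W\<close> is generated by the variables outside \<open>L\<close>, its quotient has regularity 0, and \<open>card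
L\<close> is what the path to it costs. If \<open>L\<close> is not a face, the ideal is the unit ideal and its
quotient has no homology.\<close>
theorem koszul_vanishes_by_faces:
  assumes mono: "mono U" and W: "W \<subseteq> V"
    and drop: "\<And>L j. L \<subseteq> W \<Longrightarrow> \<not> U L \<Longrightarrow> j \<in> V - W \<Longrightarrow>
      U (insert j L) \<or> (\<forall>T. T \<inter> (W - L) = {} \<longrightarrow> U (insert j T \<union> L) \<longrightarrow> U (T \<union> L))"
    and face: "\<And>L. L \<subseteq> W \<Longrightarrow> \<not> U L \<Longrightarrow> int (card L) \<le> r"
  shows "koszul_vanishes TYPE('k::field) U r"
proof -
  have fin: "finite W" using W finite_V finite_subset by blast
  have "koszul_vanishes TYPE('k) (after_queries U {} {}) r"
  proof (rule koszul_vanishes_query[OF mono fin W])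
    fix L assume L: "L \<subseteq> W"
    show "koszul_vanishes TYPE('k) (after_queries U ({} \<union> L) ({} \<union> (W - L))) (r - int (card L))"
    proof (cases "U L")
      case True
      then show ?thesis
        by (intro koszul_vanishes_unit mono_after_queries[OF mono]) (auto simp: after_queries_def)
    next
      case False
      have e: "W - L \<union> (V - W) = V - L" using W L by auto
      have eq: "(T \<inter> (V - L) \<noteq> {}) = after_queries U L (W - L \<union> (V - W)) T" if "T \<subseteq> V" for T
      proof -
        have "\<not> U (T \<union> L)" if "T \<inter> (V - L) = {}"
        proof -
          have "T \<union> L = L" using that \<open>T \<subseteq> V\<close> by blast
          then show ?thesis using False by simp
        qed
        then show ?thesis unfolding after_queries_def e by blast
      qed
      have "koszul_vanishes TYPE('k) (\<lambda>T. T \<inter> (V - L) \<noteq> {}) (r - int (card L))"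
        by (rule koszul_vanishes_variables) (use face[OF L False] in auto)
      then have "koszul_vanishes TYPE('k) (after_queries U L (W - L \<union> (V - W))) (r - int (card L))"
        by (rule koszul_vanishes_cong[rotated]) (rule eq)
      moreover have "finite (V - W)" "V - W \<subseteq> V" "(V - W) \<inter> (W - L) = {}" using finite_V by auto
      moreover have "\<And>j. j \<in> V - W \<Longrightarrow>
          U (insert j L) \<or> (\<forall>T. T \<inter> (W - L) = {} \<longrightarrow> U (insert j T \<union> L) \<longrightarrow> U (T \<union> L))"
        by (rule drop[OF L False])
      ultimately have "koszul_vanishes TYPE('k) (after_queries U L (W - L)) (r - int (card L))"
        by (metis (no_types, lifting) koszul_vanishes_drop[OF mono, of "V - W" L "W - L"])
      then show ?thesis by simp
    qed
  qed simp
  moreover have "after_queries U {} {} = U" by (simp add: after_queries_def fun_eq_iff)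
  ultimately show ?thesis by simp
qed

end

context koszul
begin

section \<open>Shifts of minimal resolutions\<close>

definition support_ideal :: "('v set \<Rightarrow> bool) \<Rightarrow> ('v, 'k::field) mpoly set" where
  "support_ideal U = monomial_span (\<lambda>m. Poly_Mapping.keys m \<subseteq> V \<and> U (Poly_Mapping.keys m))"

text \<open>The vanishing condition for the quotient of the graded free module with shifts \<open>ds\<close> by
the submodule \<open>Z\<close>. A chain is a family of chains of the polynomial ring, one for each basis
element; \<open>bd\<close> acts componentwise, and the degree bound of a component is lowered by the degree of
its basis element.\<close>
definition module_vanishes :: "int list \<Rightarrow> ('v, 'k::field) mpoly vec set \<Rightarrow> int \<Rightarrow> bool" where
  "module_vanishes ds Z r \<longleftrightarrow> (\<forall>c :: 'v set \<Rightarrow> nat \<Rightarrow> ('v, 'k) mpoly.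
     (\<forall>T. \<forall>a<length ds. c T a \<in>
        monomial_span (\<lambda>m. Poly_Mapping.keys m \<subseteq> V \<and> r - ds ! a < int (mon_degree m))) \<longrightarrow>
     (\<forall>T. vec (length ds) (\<lambda>a. bd (\<lambda>T. c T a) T) \<in> Z) \<longrightarrow>
     (\<exists>b. (\<forall>T. \<forall>a<length ds. b T a \<in> poly_ring V) \<and>
        (\<forall>T. vec (length ds) (\<lambda>a. c T a - bd (\<lambda>T. b T a) T) \<in> Z)))"

lemma module_vanishesD:
  assumes "module_vanishes ds Z r"
    "\<And>T a. a < length ds \<Longrightarrow>
      c T a \<in> monomial_span (\<lambda>m. Poly_Mapping.keys m \<subseteq> V \<and> r - ds ! a < int (mon_degree m))"
    "\<And>T. vec (length ds) (\<lambda>a. bd (\<lambda>T. c T a) T) \<in> Z"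
  shows "\<exists>b. (\<forall>T. \<forall>a<length ds. b T a \<in> poly_ring V) \<and>
     (\<forall>T. vec (length ds) (\<lambda>a. c T a - bd (\<lambda>T. b T a) T) \<in> Z)"
  using assms unfolding module_vanishes_def by blast

lemma mat_vec_entry:
  "M \<in> carrier_mat n k \<Longrightarrow> w \<in> carrier_vec k \<Longrightarrow> a < n \<Longrightarrow> (M *\<^sub>v w) $ a = (\<Sum>b<k. M $$ (a, b) * w $ b)"
  by (auto simp: scalar_prod_def atLeast0LessThan intro!: sum.cong)

lemma graded_map_entry:
  "graded_map V es ds M \<Longrightarrow> a < length ds \<Longrightarrow> b < length es \<Longrightarrow>
    M $$ (a, b) \<in> monomial_span (\<lambda>m. Poly_Mapping.keys m \<subseteq> V \<and> int (mon_degree m) = es ! b - ds ! a)"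
  unfolding graded_map_def poly_ring_eq homogeneous_eq by (intro monomial_span_conj) simp_all

text \<open>The Koszul complex of the polynomial ring is exact on coefficients of positive degree; this is the
case \<open>D = {}\<close> of \<open>koszul_vanishes_variables\<close>.\<close>
lemma koszul_exact:
  fixes z :: "'v set \<Rightarrow> ('v, 'k::field) mpoly"
  assumes "0 \<le> r" and z: "\<And>T. z T \<in> monomial_span (\<lambda>m. Poly_Mapping.keys m \<subseteq> V \<and> r < int (mon_degree m))"
    and dz: "\<And>T. bd z T = 0"
  shows "\<exists>b. (\<forall>T. b T \<in> monomial_span (\<lambda>m. Poly_Mapping.keys m \<subseteq> V \<and> r - 1 < int (mon_degree m))) \<and>
    (\<forall>T. z T = bd b T)"
proof -
  let ?P = "\<lambda>m :: 'v \<Rightarrow>\<^sub>0 nat. r - 1 < int (mon_degree m)"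
  have kv: "koszul_vanishes TYPE('k) (\<lambda>T. T \<inter> {} \<noteq> {}) r"
    by (rule koszul_vanishes_variables) (use assms(1) in auto)
  have "bd z T \<in> monomial_span (\<lambda>m. Poly_Mapping.keys m \<inter> {} \<noteq> {})" for T by (simp add: dz)
  from koszul_vanishesD[OF kv, of z, OF z this] obtain b where b: "\<And>T. b T \<in> poly_ring V"
      "\<And>T. z T - bd b T \<in> monomial_span (\<lambda>m. Poly_Mapping.keys m \<inter> {} \<noteq> {})" by blast
  have zb: "z T = bd b T" for T
    using b(2)[of T] by (simp add: monomial_span_def)
  show ?thesis
  proof (intro exI conjI allI)
    show "restrict_monomials ?P (b T) \<in> monomial_span (\<lambda>m. Poly_Mapping.keys m \<subseteq> V \<and> ?P m)" for T
      by (rule monomial_span_mono[OF restrict_monomials_in[OF b(1)[unfolded poly_ring_eq]]]) simp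
    fix T
    have "z T = restrict_monomials (\<lambda>m. r < int (mon_degree m)) (z T)"
      by (rule restrict_monomials_id[symmetric]) (rule monomial_span_mono[OF z], simp)
    also have "\<dots> = bd (\<lambda>T. restrict_monomials ?P (b T)) T"
      unfolding zb by (rule restrict_bd) auto
    finally show "z T = bd (\<lambda>T. restrict_monomials ?P (b T)) T" .
  qed
qed

text \<open>A cycle with values in \<open>Z\<close> bounds in the free module, whose Koszul complex is exact.
The primitive \<open>b\<close> is a cycle modulo \<open>Z\<close>, so it differs from a boundary by a chain
\<open>y\<close> with values in \<open>Z\<close>, and \<open>y\<close> is a primitive of the given cycle within
\<open>Z\<close>.\<close>
lemma cycles_are_boundaries:
  fixes Z :: "('v, 'k::field) mpoly vec set"
  assumes van: "module_vanishes ds Z r" and ds: "\<And>a. a < length ds \<Longrightarrow> ds ! a \<le> r"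
    and z_deg: "\<And>T a. a < length ds \<Longrightarrow>
      z T a \<in> monomial_span (\<lambda>m. Poly_Mapping.keys m \<subseteq> V \<and> r + 1 - ds ! a < int (mon_degree m))"
    and dz: "\<And>T a. a < length ds \<Longrightarrow> bd (\<lambda>T. z T a) T = 0"
    and zZ: "\<And>T. vec (length ds) (z T) \<in> Z"
  obtains y where "\<And>T. y T \<in> Z" "\<And>T a. a < length ds \<Longrightarrow> z T a = bd (\<lambda>T. y T $ a) T"
proof -
  let ?n = "length ds"
  have "\<forall>a\<in>{..<?n}. \<exists>b.
      (\<forall>T. b T \<in> monomial_span (\<lambda>m. Poly_Mapping.keys m \<subseteq> V \<and> r + 1 - ds ! a - 1 < int (mon_degree m)))
      \<and> (\<forall>T. z T a = bd b T)"
  proof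
    fix a assume "a \<in> {..<?n}"
    then have a: "a < ?n" by simp
    show "\<exists>b. (\<forall>T. b T \<in> monomial_span
          (\<lambda>m. Poly_Mapping.keys m \<subseteq> V \<and> r + 1 - ds ! a - 1 < int (mon_degree m)))
        \<and> (\<forall>T. z T a = bd b T)"
      by (rule koszul_exact[OF _ z_deg[OF a] dz[OF a]]) (use ds[OF a] in simp)
  qed
  from bchoice[OF this] obtain b where "\<forall>a\<in>{..<?n}.
        (\<forall>T. b a T \<in> monomial_span (\<lambda>m. Poly_Mapping.keys m \<subseteq> V \<and> r + 1 - ds ! a - 1 < int (mon_degree m)))
        \<and> (\<forall>T. z T a = bd (b a) T)" ..
  then have b: "b a T \<in> monomial_span (\<lambda>m. Poly_Mapping.keys m \<subseteq> V \<and> r - ds ! a < int (mon_degree m))"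
      "z T a = bd (b a) T" if "a < ?n" for T a
    using that by (simp_all add: algebra_simps)
  have "vec ?n (\<lambda>a. bd (\<lambda>T. b a T) T) \<in> Z" for T
  proof -
    have "vec ?n (\<lambda>a. bd (\<lambda>T. b a T) T) = vec ?n (z T)" by (rule eq_vecI) (simp_all add: b(2))
    then show ?thesis using zZ by simp
  qed
  from module_vanishesD[OF van, of "\<lambda>T a. b a T", OF b(1) this]
  obtain b2 where b2: "\<And>T. vec ?n (\<lambda>a. b a T - bd (\<lambda>T. b2 T a) T) \<in> Z" by blast
  show ?thesis
  proof (rule that[OF b2])
    show "z T a = bd (\<lambda>T. vec ?n (\<lambda>a. b a T - bd (\<lambda>T. b2 T a) T) $ a) T" if "a < ?n" for T a
      using that by (simp add: b(2) bd_diff bd_bd)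
  qed
qed

text \<open>Dimension shifting. The image under \<open>M\<close> of a cycle modulo the syzygies is a genuine
cycle with values in \<open>Z\<close>. It bounds in \<open>Z\<close> by \<open>cycles_are_boundaries\<close>,
and a lift of the primitive along \<open>M\<close> shows that the original chain bounds modulo the
syzygies.\<close>
lemma module_vanishes_syzygies:
  fixes M :: "('v, 'k::field) mpoly mat"
  assumes M: "graded_map V es ds M" and ds: "\<And>a. a < length ds \<Longrightarrow> ds ! a \<le> r"
    and Z: "Z = (\<lambda>w. M *\<^sub>v w) ` free_module V (length es)"
    and van: "module_vanishes ds Z r"
  shows "module_vanishes es {v \<in> free_module V (length es). M *\<^sub>v v = 0\<^sub>v (length ds)} (r + 1)"
  unfolding module_vanishes_def
proof (intro allI impI)
  let ?n = "length ds" and ?k = "length es"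
  let ?Z' = "{v \<in> free_module V ?k. M *\<^sub>v v = 0\<^sub>v ?n}"
  fix c :: "'v set \<Rightarrow> nat \<Rightarrow> ('v, 'k) mpoly"
  assume c: "\<forall>T. \<forall>b<?k. c T b \<in>
      monomial_span (\<lambda>m. Poly_Mapping.keys m \<subseteq> V \<and> r + 1 - es ! b < int (mon_degree m))"
    and dc: "\<forall>T. vec ?k (\<lambda>b. bd (\<lambda>T. c T b) T) \<in> ?Z'"
  have Mc: "M \<in> carrier_mat ?n ?k" using M by (simp add: graded_map_def)
  have c_ring: "c T b \<in> poly_ring V" if "b < ?k" for T b
    by (rule monomial_span_imp_poly_ring[OF mp[OF spec[OF spec[OF c]] that]])
  define z where "z = (\<lambda>T a. \<Sum>b<?k. M $$ (a, b) * c T b)"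
  have z_deg: "z T a \<in> monomial_span (\<lambda>m. Poly_Mapping.keys m \<subseteq> V \<and> r + 1 - ds ! a < int (mon_degree m))"
    if "a < ?n" for T a
    unfolding z_def
  proof (rule monomial_span_sum)
    fix b assume b: "b \<in> {..<?k}"
    then have "M $$ (a, b) \<in> monomial_span (\<lambda>m. Poly_Mapping.keys m \<subseteq> V \<and> int (mon_degree m) = es ! b - ds ! a)"
      by (intro graded_map_entry[OF M that]) simp
    moreover have "c T b \<in> monomial_span (\<lambda>m. Poly_Mapping.keys m \<subseteq> V \<and> r + 1 - es ! b < int (mon_degree m))"
      using c b by simp
    ultimately show "M $$ (a, b) * c T b \<in>
        monomial_span (\<lambda>m. Poly_Mapping.keys m \<subseteq> V \<and> r + 1 - ds ! a < int (mon_degree m))"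
      by (rule monomial_span_mult) (auto simp: keys_plus_nat)
  qed
  have dz: "bd (\<lambda>T. z T a) T = 0" if a: "a < ?n" for T a
  proof -
    have "bd (\<lambda>T. z T a) T = (\<Sum>b<?k. M $$ (a, b) * bd (\<lambda>T. c T b) T)"
      unfolding z_def by (rule bd_sum)
    also have "\<dots> = (M *\<^sub>v vec ?k (\<lambda>b. bd (\<lambda>T. c T b) T)) $ a"
      by (simp add: mat_vec_entry[OF Mc _ a])
    also have "\<dots> = 0" using dc a by simp
    finally show ?thesis .
  qed
  have "vec ?n (z T) \<in> Z" for T
  proof -
    have "(M *\<^sub>v vec ?k (c T)) $ a = z T a" if "a < ?n" for a
      by (simp add: mat_vec_entry[OF Mc _ that] z_def del: index_mult_mat_vec)
    then have "vec ?n (z T) = M *\<^sub>v vec ?k (c T)"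
      by (intro eq_vecI) (use Mc in \<open>simp_all del: index_mult_mat_vec\<close>)
    moreover have "vec ?k (c T) \<in> free_module V ?k"
      using c_ring by (simp add: free_module_def)
    ultimately show ?thesis unfolding Z by auto
  qed
  from cycles_are_boundaries[OF van ds, of z, OF _ z_deg dz this]
  obtain y where y: "\<And>T. y T \<in> Z" "\<And>T a. a < ?n \<Longrightarrow> z T a = bd (\<lambda>T. y T $ a) T" by blast
  have "\<forall>T. \<exists>w. w \<in> free_module V ?k \<and> y T = M *\<^sub>v w"
    using y(1) unfolding Z by blast
  then obtain w where w: "\<And>T. w T \<in> free_module V ?k" "\<And>T. y T = M *\<^sub>v w T" by metis
  have w_carrier: "w T \<in> carrier_vec ?k" for T using w(1) by (simp add: free_module_def)
  have w_ring: "w T $ j \<in> poly_ring V" if "j < ?k" for T j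
    using w(1) that by (simp add: free_module_def)
  show "\<exists>b. (\<forall>T. \<forall>a<?k. b T a \<in> poly_ring V) \<and> (\<forall>T. vec ?k (\<lambda>a. c T a - bd (\<lambda>T. b T a) T) \<in> ?Z')"
  proof (intro exI[of _ "\<lambda>T j. w T $ j"] conjI allI impI w_ring)
    fix T
    let ?v = "vec ?k (\<lambda>j. c T j - bd (\<lambda>T. w T $ j) T)"
    have v_free: "?v \<in> free_module V ?k"
      by (auto simp: free_module_def intro!: poly_ring_diff c_ring bd_in_poly_ring w_ring)
    have "(M *\<^sub>v ?v) $ a = 0" if a: "a < ?n" for a
    proof -
      have wa: "(\<Sum>j<?k. M $$ (a, j) * w T $ j) = y T $ a" for T
        by (simp only: w(2) mat_vec_entry[OF Mc w_carrier a])
      have "(M *\<^sub>v ?v) $ a = z T a - (\<Sum>j<?k. M $$ (a, j) * bd (\<lambda>T. w T $ j) T)"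
        by (simp add: mat_vec_entry[OF Mc _ a] z_def right_diff_distrib sum_subtractf)
      also have "(\<Sum>j<?k. M $$ (a, j) * bd (\<lambda>T. w T $ j) T) = bd (\<lambda>T. y T $ a) T"
        unfolding bd_sum[symmetric] wa ..
      finally show ?thesis by (simp add: y(2)[OF a])
    qed
    then have "M *\<^sub>v ?v = 0\<^sub>v ?n" using Mc by (intro eq_vecI) auto
    with v_free show "?v \<in> ?Z'" by simp
  qed
qed

text \<open>Homological degree 0: a basis element of degree greater than \<open>r\<close> would be congruent
modulo \<open>Z\<close> to an element of the maximal ideal times the free module. If \<open>Z\<close> is
contained in that submodule, as is the case in a minimal resolution, then the constant term 1 of the basis
element yields a contradiction.\<close>
lemma module_vanishes_shifts:
  fixes Z :: "('v, 'k::field) mpoly vec set"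
  assumes van: "module_vanishes es Z r" and "0\<^sub>v (length es) \<in> Z" and j: "j < length es"
    and const: "\<And>v b. v \<in> Z \<Longrightarrow> b < length es \<Longrightarrow> Poly_Mapping.lookup (v $ b) 0 = 0"
  shows "es ! j \<le> r"
proof (rule ccontr)
  assume not: "\<not> es ! j \<le> r"
  let ?k = "length es"
  define c :: "'v set \<Rightarrow> nat \<Rightarrow> ('v, 'k) mpoly" where "c = (\<lambda>T b. if T = {} \<and> b = j then 1 else 0)"
  have "c T b \<in> monomial_span (\<lambda>m. Poly_Mapping.keys m \<subseteq> V \<and> r - es ! b < int (mon_degree m))" for T b
    using not by (auto simp: c_def monomial_span_def)
  moreover have "vec ?k (\<lambda>b. bd (\<lambda>T. c T b) T) \<in> Z" for T
  proof -
    have "vec ?k (\<lambda>b. bd (\<lambda>T. c T b) T) = 0\<^sub>v ?k" by (rule eq_vecI) (auto simp: bd_def c_def)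
    with assms(2) show ?thesis by simp
  qed
  ultimately have "\<exists>b. (\<forall>T. \<forall>a<?k. b T a \<in> poly_ring V) \<and>
      (\<forall>T. vec ?k (\<lambda>a. c T a - bd (\<lambda>T. b T a) T) \<in> Z)"
    by (intro module_vanishesD[OF van])
  then obtain b where b: "\<And>T a. a < ?k \<Longrightarrow> b T a \<in> poly_ring V"
      "\<And>T. vec ?k (\<lambda>a. c T a - bd (\<lambda>T. b T a) T) \<in> Z" by blast
  have "Poly_Mapping.lookup (vec ?k (\<lambda>a. c {} a - bd (\<lambda>T. b T a) {}) $ j) 0 = 0"
    by (rule const[OF b(2) j])
  then have one: "Poly_Mapping.lookup (bd (\<lambda>T. b T j) {}) 0 = 1"
    using j by (simp add: c_def lookup_minus)
  have "bd (\<lambda>T. b T j) {} \<in> monomial_span (\<lambda>m. m \<noteq> 0)"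
  proof (rule bd_in_span)
    show "b T j \<in> monomial_span (\<lambda>m. Poly_Mapping.keys m \<subseteq> V)" for T
      using b(1)[OF j] by (simp add: poly_ring_eq)
    show "Poly_Mapping.single v 1 + m \<noteq> 0" for v and m :: "'v \<Rightarrow>\<^sub>0 nat"
      by (metis mon_degree_add mon_degree_single mon_degree_zero add_is_0 one_neq_zero)
  qed
  from monomial_spanD[OF this, of 0] one show False by simp
qed

text \<open>The generators of \<open>S/I\<close> given by \<open>g\<close> may be arbitrary homogeneous ones, so
that the condition has to be transported from \<open>S/I\<close> to its presentation by the first free
module.\<close>
lemma module_vanishes_start:
  fixes g :: "('v, 'k::field) mpoly vec"
  assumes mono: "mono U" and van: "koszul_vanishes TYPE('k) U r"
    and g: "g \<in> free_module V (length ds)" "\<And>a. a < length ds \<Longrightarrow> homogeneous (ds ! a) (g $ a)"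
    and surj: "\<And>f. f \<in> poly_ring V \<Longrightarrow> \<exists>v\<in>free_module V (length ds). f - g \<bullet> v \<in> support_ideal U"
  shows "module_vanishes ds {v \<in> free_module V (length ds). g \<bullet> v \<in> support_ideal U} r"
  unfolding module_vanishes_def
proof (intro allI impI)
  let ?n = "length ds"
  let ?Z = "{v \<in> free_module V ?n. g \<bullet> v \<in> support_ideal U}"
  fix c :: "'v set \<Rightarrow> nat \<Rightarrow> ('v, 'k) mpoly"
  assume c: "\<forall>T. \<forall>a<?n. c T a \<in>
      monomial_span (\<lambda>m. Poly_Mapping.keys m \<subseteq> V \<and> r - ds ! a < int (mon_degree m))"
    and dc: "\<forall>T. vec ?n (\<lambda>a. bd (\<lambda>T. c T a) T) \<in> ?Z"
  have c_ring: "c T a \<in> poly_ring V" if "a < ?n" for T a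
    by (rule monomial_span_imp_poly_ring[OF mp[OF spec[OF spec[OF c]] that]])
  have gv: "g \<bullet> v = (\<Sum>a<?n. g $ a * v $ a)" if "v \<in> carrier_vec ?n" for v
    using that by (auto simp: scalar_prod_def atLeast0LessThan)
  define z where "z = (\<lambda>T. \<Sum>a<?n. g $ a * c T a)"
  have z_deg: "z T \<in> monomial_span (\<lambda>m. Poly_Mapping.keys m \<subseteq> V \<and> r < int (mon_degree m))" for T
    unfolding z_def
  proof (rule monomial_span_sum)
    fix a assume a: "a \<in> {..<?n}"
    have "g $ a \<in> monomial_span (\<lambda>m. Poly_Mapping.keys m \<subseteq> V \<and> int (mon_degree m) = ds ! a)"
      using g a unfolding homogeneous_eq free_module_def poly_ring_eq by (intro monomial_span_conj) simp_all
    moreover have "c T a \<in> monomial_span (\<lambda>m. Poly_Mapping.keys m \<subseteq> V \<and> r - ds ! a < int (mon_degree m))"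
      using c a by simp
    ultimately show "g $ a * c T a \<in> monomial_span (\<lambda>m. Poly_Mapping.keys m \<subseteq> V \<and> r < int (mon_degree m))"
      by (rule monomial_span_mult) (auto simp: keys_plus_nat)
  qed
  have "bd z T \<in> monomial_span (\<lambda>m. U (Poly_Mapping.keys m))" for T
  proof -
    have "bd z T = g \<bullet> vec ?n (\<lambda>a. bd (\<lambda>T. c T a) T)"
      unfolding z_def bd_sum by (simp add: gv)
    then have "bd z T \<in> support_ideal U" using dc by simp
    then show ?thesis unfolding support_ideal_def by (rule monomial_span_mono) simp
  qed
  from koszul_vanishesD[OF van, of z, OF z_deg this] obtain b where b: "\<And>T. b T \<in> poly_ring V"
      "\<And>T. z T - bd b T \<in> monomial_span (\<lambda>m. U (Poly_Mapping.keys m))" by blast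
  have "\<forall>T. \<exists>v. v \<in> free_module V ?n \<and> b T - g \<bullet> v \<in> support_ideal U" using surj b(1) by blast
  then obtain w where w: "\<And>T. w T \<in> free_module V ?n" "\<And>T. b T - g \<bullet> w T \<in> support_ideal U" by metis
  have w_carrier: "w T \<in> carrier_vec ?n" for T using w(1) by (simp add: free_module_def)
  have w_ring: "w T $ j \<in> poly_ring V" if "j < ?n" for T j
    using w(1) that by (simp add: free_module_def)
  show "\<exists>b. (\<forall>T. \<forall>a<?n. b T a \<in> poly_ring V) \<and> (\<forall>T. vec ?n (\<lambda>a. c T a - bd (\<lambda>T. b T a) T) \<in> ?Z)"
  proof (intro exI[of _ "\<lambda>T j. w T $ j"] conjI allI impI w_ring)
    fix T
    let ?v = "vec ?n (\<lambda>j. c T j - bd (\<lambda>T. w T $ j) T)"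
    have v_free: "?v \<in> free_module V ?n"
      by (auto simp: free_module_def intro!: poly_ring_diff c_ring bd_in_poly_ring w_ring)
    have gw: "bd (\<lambda>T. g \<bullet> w T) T = (\<Sum>j<?n. g $ j * bd (\<lambda>T. w T $ j) T)"
      by (simp add: gv[OF w_carrier] bd_sum)
    have "g \<bullet> ?v = z T - bd (\<lambda>T. g \<bullet> w T) T"
      by (simp add: gv z_def right_diff_distrib sum_subtractf gw)
    also have "\<dots> = (z T - bd b T) + bd (\<lambda>T. b T - g \<bullet> w T) T" by (simp add: bd_diff)
    also have "\<dots> \<in> support_ideal U"
      unfolding support_ideal_def
    proof (rule monomial_span_add)
      have "z T - bd b T \<in> poly_ring V"
        by (intro poly_ring_diff bd_in_poly_ring b(1) monomial_span_imp_poly_ring[OF z_deg])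
      then show "z T - bd b T \<in> monomial_span (\<lambda>m. Poly_Mapping.keys m \<subseteq> V \<and> U (Poly_Mapping.keys m))"
        unfolding poly_ring_eq using b(2) by (rule monomial_span_conj)
    next
      show "bd (\<lambda>T. b T - g \<bullet> w T) T \<in> monomial_span (\<lambda>m. Poly_Mapping.keys m \<subseteq> V \<and> U (Poly_Mapping.keys m))"
        by (rule bd_in_span[OF w(2)[unfolded support_ideal_def]])
          (auto simp: keys_plus_nat intro: upward_closedD[OF mono])
    qed
    finally show "?v \<in> ?Z" using v_free by simp
  qed
qed

theorem minimal_resolution_shifts:
  fixes M :: "nat \<Rightarrow> ('v, 'k::field) mpoly mat"
  assumes mono: "mono U" and van: "koszul_vanishes TYPE('k) U r"
    and res: "minimal_graded_free_resolution V (support_ideal U) d g M"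
    and j: "j \<in> set (d i)"
  shows "j \<le> r + int i"
proof -
  define Z where "Z i = (\<lambda>w. M i *\<^sub>v w) ` free_module V (length (d (Suc i)))" for i
  note R = res[unfolded minimal_graded_free_resolution_def graded_free_resolution_def]
  have gm: "graded_map V (d (Suc i)) (d i) (M i)" for i
    using R by (elim conjE) (erule spec)
  have const: "Poly_Mapping.lookup (M i $$ (a, b)) 0 = 0"
    if "a < length (d i)" "b < length (d (Suc i))" for i a b
    using R that by (elim conjE) simp
  have Z0: "{v \<in> free_module V (length (d 0)). g \<bullet> v \<in> support_ideal U} = Z 0"
    using R unfolding Z_def One_nat_def by (elim conjE)
  have ZSuc: "{v \<in> free_module V (length (d (Suc i))). M i *\<^sub>v v = 0\<^sub>v (length (d i))} = Z (Suc i)" for i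
    using R unfolding Z_def by (elim conjE) (erule spec)
  have g: "g \<in> free_module V (length (d 0))" "\<And>a. a < length (d 0) \<Longrightarrow> homogeneous (d 0 ! a) (g $ a)"
    "\<And>f. f \<in> poly_ring V \<Longrightarrow> \<exists>v\<in>free_module V (length (d 0)). f - g \<bullet> v \<in> support_ideal U"
    using R by (elim conjE, simp)+
  have carrier: "M i \<in> carrier_mat (length (d i)) (length (d (Suc i)))" for i
    using gm[of i] by (simp add: graded_map_def)
  have Z_zero: "0\<^sub>v (length (d i)) \<in> Z i" for i
  proof -
    have "M i *\<^sub>v 0\<^sub>v (length (d (Suc i))) = 0\<^sub>v (length (d i))"
      using carrier[of i] by (intro eq_vecI) auto
    moreover have "0\<^sub>v (length (d (Suc i))) \<in> free_module V (length (d (Suc i)))"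
      by (simp add: free_module_def)
    ultimately show ?thesis unfolding Z_def by (metis image_eqI)
  qed
  have Z_const: "Poly_Mapping.lookup (v $ a) 0 = 0" if "v \<in> Z i" "a < length (d i)" for v a i
  proof -
    from that(1)[unfolded Z_def] obtain w where
      vw: "v = M i *\<^sub>v w" and w_free: "w \<in> free_module V (length (d (Suc i)))" by (rule imageE)
    from w_free have "w \<in> carrier_vec (length (d (Suc i)))" by (simp add: free_module_def)
    note w = vw this
    have "v $ a \<in> monomial_span (\<lambda>m. m \<noteq> 0)"
      unfolding w(1) mat_vec_entry[OF carrier w(2) that(2)]
    proof (rule monomial_span_sum)
      fix b assume b: "b \<in> {..<length (d (Suc i))}"
      have "M i $$ (a, b) \<in> monomial_span (\<lambda>m. m \<noteq> 0)"
        by (rule monomial_spanI) (use const[OF that(2), of b] b in auto)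
      moreover have "w $ b \<in> monomial_span (\<lambda>m. True)" by (rule monomial_spanI) simp
      ultimately show "M i $$ (a, b) * w $ b \<in> monomial_span (\<lambda>m. m \<noteq> 0)"
        by (rule monomial_span_mult) (metis mon_degree_add mon_degree_eq_0 add_is_0)
    qed
    then show ?thesis by (auto dest: monomial_spanD)
  qed
  have shifts: "d i ! a \<le> r + int i" if "module_vanishes (d i) (Z i) (r + int i)" "a < length (d i)" for i a
    by (rule module_vanishes_shifts[OF that(1) Z_zero that(2)]) (rule Z_const)
  have "module_vanishes (d i) (Z i) (r + int i)" for i
  proof (induction i)
    case 0
    have "module_vanishes (d 0) {v \<in> free_module V (length (d 0)). g \<bullet> v \<in> support_ideal U} r"
      by (rule module_vanishes_start[OF mono van g])
    then show ?case unfolding Z0 by simp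
  next
    case (Suc i)
    have "module_vanishes (d (Suc i)) {v \<in> free_module V (length (d (Suc i))). M i *\<^sub>v v = 0\<^sub>v (length (d i))} (r + int i + 1)"
      by (rule module_vanishes_syzygies[OF gm shifts[OF Suc] Z_def Suc])
    then show ?case unfolding ZSuc by (simp add: ac_simps)
  qed
  with shifts j show ?thesis by (metis in_set_conv_nth)
qed

end

section \<open>Existence of minimal resolutions\<close>

lemma sum_fun_apply: "(\<Sum>i\<in>A. f i) x = (\<Sum>i\<in>A. f i x)"
  by (induction A rule: infinite_finite_induct) auto

text \<open>Elements whose coordinates vanish outside a fixed finite set span a finite-dimensional space, so
finitely many of them suffice. The elements need not belong to a vector space type; \<open>coord\<close> maps
them into one.\<close>
lemma finite_spanning_subset:
  fixes coord :: "'b \<Rightarrow> 'x \<Rightarrow> 'k::field"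
  assumes "finite X" and supp: "\<forall>h\<in>H. \<forall>x. x \<notin> X \<longrightarrow> coord h x = 0"
  shows "\<exists>B\<subseteq>H. finite B \<and> (\<forall>h\<in>H. \<exists>c. \<forall>x. coord h x = (\<Sum>b\<in>B. c b * coord b x))"
proof -
  interpret vs: vector_space "\<lambda>(c::'k) (f::'x \<Rightarrow> 'k) x. c * f x"
    by unfold_locales (auto simp: fun_eq_iff algebra_simps)
  define e :: "'x \<Rightarrow> 'x \<Rightarrow> 'k" where "e = (\<lambda>y x. if x = y then 1 else 0)"
  obtain B' where B': "B' \<subseteq> coord ` H" "\<not> vs.dependent B'" "coord ` H \<subseteq> vs.span B'"
    using vs.maximal_independent_subset by blast
  have "coord h \<in> vs.span (e ` X)" if "h \<in> H" for h
  proof -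
    have "coord h = (\<Sum>y\<in>X. (\<lambda>x. coord h y * e y x))"
    proof
      fix x
      have "(\<Sum>y\<in>X. coord h y * e y x) = (\<Sum>y\<in>X. if y = x then coord h x else 0)"
        by (rule sum.cong) (auto simp: e_def)
      also have "\<dots> = coord h x" using supp that assms(1) by auto
      finally show "coord h x = (\<Sum>y\<in>X. (\<lambda>x. coord h y * e y x)) x" by (simp add: sum_fun_apply)
    qed
    moreover have "(\<Sum>y\<in>X. (\<lambda>x. coord h y * e y x)) \<in> vs.span (e ` X)"
      by (intro vs.span_sum vs.span_scale vs.span_base imageI)
    ultimately show ?thesis by simp
  qed
  then have "B' \<subseteq> vs.span (e ` X)" using B'(1) by auto
  with vs.independent_span_bound[OF _ B'(2)] assms(1) have finB': "finite B'" by blast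
  from B'(1) obtain B where B: "B \<subseteq> H" "inj_on coord B" "coord ` B = B'"
    by (metis subset_image_inj)
  show ?thesis
  proof (intro exI[of _ B] conjI ballI)
    show "finite B" using finB' B finite_imageD by blast
    fix h assume "h \<in> H"
    then have "coord h \<in> vs.span B'" using B'(3) by auto
    then obtain u where u: "coord h = (\<Sum>v\<in>B'. (\<lambda>x. u v * v x))"
      using vs.span_finite[OF finB'] by auto
    have "coord h x = (\<Sum>b\<in>B. u (coord b) * coord b x)" for x
      using arg_cong[OF u, of "\<lambda>f. f x"] sum.reindex[OF B(2), of "\<lambda>v. u v * v x"]
      by (simp add: sum_fun_apply B(3))
    then show "\<exists>c. \<forall>x. coord h x = (\<Sum>b\<in>B. c b * coord b x)"
      by (intro exI[of _ "\<lambda>b. u (coord b)"] allI)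
  qed (rule B(1))
qed

lemma finite_monomials:
  assumes "finite V"
  shows "finite {m :: 'v \<Rightarrow>\<^sub>0 nat. Poly_Mapping.keys m \<subseteq> V \<and> mon_degree m \<le> N}"
proof (rule finite_imageD)
  let ?M = "{m :: 'v \<Rightarrow>\<^sub>0 nat. Poly_Mapping.keys m \<subseteq> V \<and> mon_degree m \<le> N}"
  have le: "Poly_Mapping.lookup m x \<le> mon_degree m" for m :: "'v \<Rightarrow>\<^sub>0 nat" and x
  proof (cases "x \<in> Poly_Mapping.keys m")
    case True
    then show ?thesis unfolding mon_degree_def by (intro member_le_sum) auto
  qed (simp add: in_keys_iff)
  have "Poly_Mapping.lookup ` ?M \<subseteq> {f. \<forall>x. (x \<in> V \<longrightarrow> f x \<in> {..N}) \<and> (x \<notin> V \<longrightarrow> f x = 0)}"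
  proof (rule image_subsetI)
    fix m assume m: "m \<in> ?M"
    have "Poly_Mapping.lookup m x \<le> N" for x using le[of m x] m by simp
    moreover have "Poly_Mapping.lookup m x = 0" if "x \<notin> V" for x
      using m that by (auto simp: in_keys_iff)
    ultimately show "Poly_Mapping.lookup m \<in> {f. \<forall>x. (x \<in> V \<longrightarrow> f x \<in> {..N}) \<and> (x \<notin> V \<longrightarrow> f x = 0)}"
      by simp
  qed
  moreover have "finite {f :: 'v \<Rightarrow> nat. \<forall>x. (x \<in> V \<longrightarrow> f x \<in> {..N}) \<and> (x \<notin> V \<longrightarrow> f x = 0)}"
    by (rule finite_set_of_finite_funs) (use assms in auto)
  ultimately show "finite (Poly_Mapping.lookup ` ?M)" by (rule finite_subset)
  show "inj_on Poly_Mapping.lookup ?M" by (rule inj_onI) (rule poly_mapping_eqI, simp)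
qed

context koszul
begin

definition component :: "int list \<Rightarrow> int \<Rightarrow> ('v, 'k::field) mpoly vec \<Rightarrow> ('v, 'k) mpoly vec" where
  "component ds j v =
     vec (length ds) (\<lambda>a. restrict_monomials (\<lambda>m. int (mon_degree m) = j - ds ! a) (v $ a))"

definition is_homogeneous :: "int list \<Rightarrow> int \<Rightarrow> ('v, 'k::field) mpoly vec \<Rightarrow> bool" where
  "is_homogeneous ds j v \<longleftrightarrow> (\<forall>a<length ds. homogeneous (j - ds ! a) (v $ a))"

definition graded_submodule :: "int list \<Rightarrow> ('v, 'k::field) mpoly vec set \<Rightarrow> bool" where
  "graded_submodule ds Z \<longleftrightarrow> Z \<subseteq> free_module V (length ds) \<and> 0\<^sub>v (length ds) \<in> Z \<and>
     (\<forall>u\<in>Z. \<forall>v\<in>Z. u + v \<in> Z) \<and> (\<forall>p\<in>poly_ring V. \<forall>v\<in>Z. p \<cdot>\<^sub>v v \<in> Z) \<and>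
     (\<forall>v\<in>Z. \<forall>j. component ds j v \<in> Z)"

text \<open>Equality is required for the first \<open>n\<close> entries, which avoids finite sums of vectors of
undetermined dimension.\<close>
definition combination :: "nat \<Rightarrow> ('v, 'k::field) mpoly vec set \<Rightarrow> ('v, 'k) mpoly vec \<Rightarrow> bool" where
  "combination n B v \<longleftrightarrow>
     (\<exists>c. (\<forall>b\<in>B. c b \<in> poly_ring V) \<and> (\<forall>a<n. v $ a = (\<Sum>b\<in>B. c b * b $ a)))"

lemma graded_submoduleD:
  assumes "graded_submodule ds Z"
  shows "v \<in> Z \<Longrightarrow> v \<in> free_module V (length ds)" "0\<^sub>v (length ds) \<in> Z"
    "u \<in> Z \<Longrightarrow> v \<in> Z \<Longrightarrow> u + v \<in> Z" "p \<in> poly_ring V \<Longrightarrow> v \<in> Z \<Longrightarrow> p \<cdot>\<^sub>v v \<in> Z"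
    "v \<in> Z \<Longrightarrow> component ds j v \<in> Z" "v \<in> Z \<Longrightarrow> v \<in> carrier_vec (length ds)"
    "v \<in> Z \<Longrightarrow> a < length ds \<Longrightarrow> v $ a \<in> poly_ring V"
  using assms by (simp_all add: graded_submodule_def free_module_def subset_iff)

lemma component_homogeneous: "is_homogeneous ds j (component ds j v)"
  by (simp add: is_homogeneous_def component_def homogeneous_eq restrict_monomials_span)

lemma restrict_homogeneous_mult:
  assumes "homogeneous i g" "k = j + i"
  shows "restrict_monomials (\<lambda>m. int (mon_degree m) = k) (f * g)
     = restrict_monomials (\<lambda>m. int (mon_degree m) = j) f * g"
  using restrict_monomials_mult[of g "\<lambda>m. int (mon_degree m) = i" "\<lambda>m. int (mon_degree m) = k"
      "\<lambda>m. int (mon_degree m) = j" f] assms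
  by (simp add: homogeneous_eq mult.commute)

lemma combination_in_submodule:
  assumes Z: "graded_submodule ds Z" and "finite B" "B \<subseteq> Z" "\<And>b. b \<in> B \<Longrightarrow> c b \<in> poly_ring V"
  shows "vec (length ds) (\<lambda>a. \<Sum>b\<in>B. c b * b $ a) \<in> Z"
  using assms(2-)
proof (induction B rule: finite_induct)
  case empty
  have "vec (length ds) (\<lambda>a. \<Sum>b\<in>{}. c b * b $ a) = 0\<^sub>v (length ds)" by auto
  then show ?case using graded_submoduleD(2)[OF Z] by simp
next
  case (insert x B)
  have x: "x \<in> carrier_vec (length ds)" using graded_submoduleD(6)[OF Z] insert.prems by blast
  have "vec (length ds) (\<lambda>a. \<Sum>b\<in>insert x B. c b * b $ a)
      = c x \<cdot>\<^sub>v x + vec (length ds) (\<lambda>a. \<Sum>b\<in>B. c b * b $ a)"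
    by (rule eq_vecI) (use insert.hyps x in auto)
  then show ?case
    using graded_submoduleD(3,4)[OF Z] insert by auto
qed

lemma combination_sum:
  assumes "finite I" and "\<And>i. i \<in> I \<Longrightarrow> combination n B (u i)" and p: "\<And>i. i \<in> I \<Longrightarrow> p i \<in> poly_ring V"
    and v: "\<And>a. a < n \<Longrightarrow> v $ a = (\<Sum>i\<in>I. p i * u i $ a)"
  shows "combination n B v"
proof -
  have "\<forall>i\<in>I. \<exists>c. (\<forall>b\<in>B. c b \<in> poly_ring V) \<and> (\<forall>a<n. u i $ a = (\<Sum>b\<in>B. c b * b $ a))"
    using assms(2) unfolding combination_def by blast
  from bchoice[OF this] obtain c where c: "\<forall>i\<in>I. (\<forall>b\<in>B. c i b \<in> poly_ring V) \<and>
      (\<forall>a<n. u i $ a = (\<Sum>b\<in>B. c i b * b $ a))" ..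
  have "v $ a = (\<Sum>b\<in>B. (\<Sum>i\<in>I. p i * c i b) * b $ a)" if a: "a < n" for a
  proof -
    have "v $ a = (\<Sum>i\<in>I. \<Sum>b\<in>B. p i * (c i b * b $ a))"
      unfolding v[OF a] using c a by (intro sum.cong) (auto simp: sum_distrib_left)
    also have "\<dots> = (\<Sum>b\<in>B. \<Sum>i\<in>I. p i * (c i b * b $ a))" by (rule sum.swap)
    finally show ?thesis by (simp add: sum_distrib_right mult.assoc)
  qed
  moreover have "(\<Sum>i\<in>I. p i * c i b) \<in> poly_ring V" if "b \<in> B" for b
    using c that p by (intro poly_ring_sum poly_ring_mult) auto
  ultimately show ?thesis unfolding combination_def
    by (intro exI[of _ "\<lambda>b. \<Sum>i\<in>I. p i * c i b"]) simp
qed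

text \<open>A homogeneous element of \<open>Z\<close> of degree greater than \<open>r + 1\<close>, seen as a
chain concentrated at the empty set, is a cycle with values in \<open>Z\<close>. It is the boundary of a chain
with values in \<open>Z\<close>, hence a combination of elements of \<open>Z\<close> of smaller degree with the
variables as coefficients.\<close>
lemma high_degree_decomposition:
  fixes Z :: "('v, 'k::field) mpoly vec set"
  assumes Z: "graded_submodule ds Z" and van: "module_vanishes ds Z r"
    and ds: "\<And>a. a < length ds \<Longrightarrow> ds ! a \<le> r"
    and v: "v \<in> Z" "is_homogeneous ds j v" "r + 1 < j"
  obtains y where "\<And>x. y x \<in> Z" "\<And>x. is_homogeneous ds (j - 1) (y x)"
    "\<And>a. a < length ds \<Longrightarrow> v $ a = (\<Sum>x\<in>V. var x * y x $ a)"
proof -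
  let ?n = "length ds"
  define c where "c = (\<lambda>(T :: 'v set) a. if T = {} then v $ a else 0)"
  have c_deg: "c T a \<in> monomial_span (\<lambda>m. Poly_Mapping.keys m \<subseteq> V \<and> r + 1 - ds ! a < int (mon_degree m))"
    if a: "a < ?n" for T :: "'v set" and a
  proof -
    have "v $ a \<in> monomial_span (\<lambda>m. Poly_Mapping.keys m \<subseteq> V \<and> int (mon_degree m) = j - ds ! a)"
      using graded_submoduleD(7)[OF Z v(1) a] v(2) a
      unfolding poly_ring_eq is_homogeneous_def homogeneous_eq by (intro monomial_span_conj) auto
    then show ?thesis using v(3) by (auto simp: c_def elim!: monomial_span_mono)
  qed
  have dc: "bd (\<lambda>T. c T a) T = 0" for T a by (simp add: bd_def c_def)
  have cZ: "vec ?n (c T) \<in> Z" for T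
  proof (cases "T = {}")
    case True
    have "vec ?n (c T) = v" using graded_submoduleD(6)[OF Z v(1)] by (auto simp: c_def True)
    with v(1) show ?thesis by simp
  next
    case False
    then have "vec ?n (c T) = 0\<^sub>v ?n" by (auto simp: c_def)
    with graded_submoduleD(2)[OF Z] show ?thesis by simp
  qed
  obtain y where y: "\<And>T. y T \<in> Z" "\<And>T a. a < ?n \<Longrightarrow> c T a = bd (\<lambda>T. y T $ a) T"
    using cycles_are_boundaries[OF van ds, of c, OF _ c_deg dc cZ] by blast
  show ?thesis
  proof
    show "component ds (j - 1) (y {x}) \<in> Z" for x
      by (rule graded_submoduleD(5)[OF Z y(1)])
    show "is_homogeneous ds (j - 1) (component ds (j - 1) (y {x}))" for x
      by (rule component_homogeneous)
    fix a assume a: "a < ?n"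
    let ?P = "\<lambda>m :: 'v \<Rightarrow>\<^sub>0 nat. int (mon_degree m) = j - 1 - ds ! a"
    let ?Q = "\<lambda>m :: 'v \<Rightarrow>\<^sub>0 nat. int (mon_degree m) = j - ds ! a"
    have eq: "v $ a = (\<Sum>x\<in>V. var x * y {x} $ a)"
      using y(2)[OF a, of "{}"] by (simp add: c_def bd_def ksign_def)
    have "v $ a = restrict_monomials ?Q (v $ a)"
      using v(2) a by (simp add: is_homogeneous_def homogeneous_eq restrict_monomials_id)
    also have "\<dots> = (\<Sum>x\<in>V. var x * restrict_monomials ?P (y {x} $ a))"
      unfolding eq restrict_monomials_sum
      by (intro sum.cong refl restrict_monomials_mult[OF var_in_span]) auto
    finally show "v $ a = (\<Sum>x\<in>V. var x * component ds (j - 1) (y {x}) $ a)"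
      using a by (simp add: component_def)
  qed
qed

text \<open>The homogeneous elements of degree at most \<open>r + 1\<close> involve finitely many monomials, so
finitely many of them span the others over the field. By \<open>high_degree_decomposition\<close> and induction
on the degree they generate all homogeneous elements. This takes the place of the Hilbert basis theorem.\<close>
lemma finite_homogeneous_generators:
  fixes Z :: "('v, 'k::field) mpoly vec set"
  assumes Z: "graded_submodule ds Z" and van: "module_vanishes ds Z r"
    and ds: "\<And>a. a < length ds \<Longrightarrow> ds ! a \<le> r"
  shows "\<exists>B. finite B \<and> B \<subseteq> {v \<in> Z. \<exists>j. is_homogeneous ds j v} \<and> (\<forall>v\<in>Z. combination (length ds) B v)"
proof -
  let ?n = "length ds"
  define H where "H = {v \<in> Z. \<exists>j\<le>r + 1. is_homogeneous ds j v}"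
  define X where "X = (SIGMA a : {..<?n}.
      {m. Poly_Mapping.keys m \<subseteq> V \<and> mon_degree m \<le> nat (r + 1 - ds ! a)})"
  define coord where "coord = (\<lambda>(v :: ('v, 'k) mpoly vec) (a, m). if a < ?n then Poly_Mapping.lookup (v $ a) m else 0)"
  have finX: "finite X" unfolding X_def by (intro finite_SigmaI finite_monomials finite_V) auto
  have coord0: "\<forall>h\<in>H. \<forall>p. p \<notin> X \<longrightarrow> coord h p = 0"
  proof (intro ballI allI impI, rule ccontr)
    fix h p assume hH: "h \<in> H" and pX: "p \<notin> X" and nz: "coord h p \<noteq> 0"
    obtain a m where p: "p = (a, m)" by (cases p)
    from nz have a: "a < ?n" and m: "Poly_Mapping.lookup (h $ a) m \<noteq> 0"
      by (auto simp: coord_def p split: if_splits)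
    obtain j where j: "j \<le> r + 1" "is_homogeneous ds j h" and hZ: "h \<in> Z"
      using hH by (auto simp: H_def)
    have "Poly_Mapping.keys m \<subseteq> V"
      using graded_submoduleD(7)[OF Z hZ a] m unfolding poly_ring_eq by (rule monomial_spanD)
    moreover have "int (mon_degree m) = j - ds ! a"
      using j(2) a m unfolding is_homogeneous_def homogeneous_eq by (auto dest: monomial_spanD)
    ultimately show False using pX a j(1) by (auto simp: p X_def)
  qed
  from finite_spanning_subset[of X H coord, OF finX coord0] obtain B where
      BH: "B \<subseteq> H" and finB: "finite B" and
      span: "\<forall>h\<in>H. \<exists>c. \<forall>p. coord h p = (\<Sum>b\<in>B. c b * coord b p)"
    by (elim exE conjE)
  have low: "combination ?n B h" if h: "h \<in> H" for h
  proof -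
    from bspec[OF span h] obtain c where c: "\<forall>p. coord h p = (\<Sum>b\<in>B. c b * coord b p)" ..
    have mult: "Poly_Mapping.lookup (Poly_Mapping.single 0 k * f) m = k * Poly_Mapping.lookup f m"
      for k :: 'k and f :: "('v, 'k) mpoly" and m
      by (simp add: mult_map_scale_conv_mult[symmetric] Poly_Mapping.map.rep_eq when_def)
    have "h $ a = (\<Sum>b\<in>B. Poly_Mapping.single 0 (c b) * b $ a)" if a: "a < ?n" for a
    proof (rule poly_mapping_eqI)
      fix m
      have "Poly_Mapping.lookup (h $ a) m = (\<Sum>b\<in>B. c b * Poly_Mapping.lookup (b $ a) m)"
        using c[rule_format, of "(a, m)"] a by (simp add: coord_def)
      then show "Poly_Mapping.lookup (h $ a) m =
          Poly_Mapping.lookup (\<Sum>b\<in>B. Poly_Mapping.single 0 (c b) * b $ a) m"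
        by (simp add: lookup_sum mult)
    qed
    then show ?thesis unfolding combination_def
      by (intro exI[of _ "\<lambda>b. Poly_Mapping.single 0 (c b)"]) (simp add: poly_ring_single)
  qed
  have homog: "combination ?n B v" if "v \<in> Z" "is_homogeneous ds (r + 1 + int k) v" for v k
    using that
  proof (induction k arbitrary: v)
    case 0
    then show ?case by (intro low) (auto simp: H_def)
  next
    case (Suc k)
    obtain y where y: "\<And>x. y x \<in> Z" "\<And>x. is_homogeneous ds (r + 1 + int (Suc k) - 1) (y x)"
        "\<And>a. a < ?n \<Longrightarrow> v $ a = (\<Sum>x\<in>V. var x * y x $ a)"
      using high_degree_decomposition[OF Z van ds Suc.prems] by auto
    show ?case
    proof (rule combination_sum[OF finite_V _ _ y(3)])
      show "combination ?n B (y x)" for x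
        by (rule Suc.IH[OF y(1)]) (use y(2)[of x] in \<open>simp add: ac_simps\<close>)
    qed (simp_all add: poly_ring_var)
  qed
  have homog': "combination ?n B v" if "v \<in> Z" "is_homogeneous ds j v" for v j
  proof (cases "j \<le> r + 1")
    case True
    with that show ?thesis by (intro low) (auto simp: H_def)
  next
    case False
    then have "j = r + 1 + int (nat (j - r - 1))" by simp
    with homog[of v "nat (j - r - 1)"] that show ?thesis by simp
  qed
  have "combination ?n B v" if v: "v \<in> Z" for v
  proof -
    define J where "J = (\<Union>a<?n. (\<lambda>m. int (mon_degree m) + ds ! a) ` Poly_Mapping.keys (v $ a))"
    have finJ: "finite J" unfolding J_def by simp
    show ?thesis
    proof (rule combination_sum[OF finJ, where p = "\<lambda>_. 1" and u = "\<lambda>j. component ds j v"])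
      show "combination ?n B (component ds j v)" for j
        by (rule homog'[OF graded_submoduleD(5)[OF Z v] component_homogeneous])
      fix a assume a: "a < ?n"
      show "v $ a = (\<Sum>j\<in>J. 1 * component ds j v $ a)"
      proof (rule poly_mapping_eqI)
        fix m
        have "Poly_Mapping.lookup (\<Sum>j\<in>J. 1 * component ds j v $ a) m
            = (\<Sum>j\<in>J. if j = int (mon_degree m) + ds ! a then Poly_Mapping.lookup (v $ a) m else 0)"
          unfolding lookup_sum
          by (rule sum.cong) (use a in \<open>auto simp: component_def lookup_restrict_monomials\<close>)
        also have "\<dots> = Poly_Mapping.lookup (v $ a) m"
        proof (cases "m \<in> Poly_Mapping.keys (v $ a)")
          case True
          then have "int (mon_degree m) + ds ! a \<in> J" using a by (auto simp: J_def)
          then show ?thesis using finJ by simp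
        next
          case False
          then show ?thesis by (auto simp: in_keys_iff intro!: sum.neutral)
        qed
        finally show "Poly_Mapping.lookup (v $ a) m = Poly_Mapping.lookup (\<Sum>j\<in>J. 1 * component ds j v $ a) m" ..
      qed
    qed simp
  qed
  moreover have "B \<subseteq> {v \<in> Z. \<exists>j. is_homogeneous ds j v}" using BH by (auto simp: H_def)
  ultimately show ?thesis using finB by blast
qed

text \<open>Take a homogeneous generating set of least cardinality. If some relation had a coefficient with
nonzero constant term, a homogeneous component of that relation would have the constant itself as this
coefficient, and the corresponding generator could be left out.\<close>
lemma minimal_homogeneous_generators:
  fixes Z :: "('v, 'k::field) mpoly vec set"
  assumes Z: "graded_submodule ds Z" and van: "module_vanishes ds Z r"
    and ds: "\<And>a. a < length ds \<Longrightarrow> ds ! a \<le> r"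
  obtains B where "finite B" "B \<subseteq> Z" "\<And>b. b \<in> B \<Longrightarrow> \<exists>j. is_homogeneous ds j b"
    "\<And>v. v \<in> Z \<Longrightarrow> combination (length ds) B v"
    "\<And>c b. (\<And>a. a < length ds \<Longrightarrow> (\<Sum>b\<in>B. c b * b $ a) = 0) \<Longrightarrow> (\<And>b. b \<in> B \<Longrightarrow> c b \<in> poly_ring V) \<Longrightarrow>
      b \<in> B \<Longrightarrow> Poly_Mapping.lookup (c b) 0 = 0"
proof -
  let ?n = "length ds"
  define good where "good = (\<lambda>B. finite B \<and> B \<subseteq> {v \<in> Z. \<exists>j. is_homogeneous ds j v} \<and>
    (\<forall>v\<in>Z. combination ?n B v))"
  have "\<exists>B. good B" unfolding good_def by (rule finite_homogeneous_generators[OF assms])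
  then obtain B where B: "good B" and min: "\<And>B'. good B' \<Longrightarrow> card B \<le> card B'"
    using ex_has_least_nat[of good _ card] by blast
  from B have fin: "finite B" and BZ: "B \<subseteq> Z" and hom: "\<And>b. b \<in> B \<Longrightarrow> \<exists>j. is_homogeneous ds j b"
    and gen: "\<And>v. v \<in> Z \<Longrightarrow> combination ?n B v" unfolding good_def by auto
  from hom obtain \<delta> where \<delta>: "\<And>b. b \<in> B \<Longrightarrow> is_homogeneous ds (\<delta> b) b" by metis
  show ?thesis
  proof (rule that[OF fin BZ hom gen])
    fix c b0
    assume rel: "\<And>a. a < ?n \<Longrightarrow> (\<Sum>b\<in>B. c b * b $ a) = 0" and c: "\<And>b. b \<in> B \<Longrightarrow> c b \<in> poly_ring V"
      and b0: "b0 \<in> B"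
    show "Poly_Mapping.lookup (c b0) 0 = 0"
    proof (rule ccontr)
      assume k: "Poly_Mapping.lookup (c b0) 0 \<noteq> 0"
      define k where "k = Poly_Mapping.lookup (c b0) 0"
      \<comment> \<open>The component of the relation in the degree of \<open>b0\<close>.\<close>
      define c' where "c' b = restrict_monomials (\<lambda>m. int (mon_degree m) = \<delta> b0 - \<delta> b) (c b)" for b
      have c'0: "c' b0 = Poly_Mapping.single 0 k"
        by (rule poly_mapping_eqI)
          (auto simp: c'_def k_def lookup_restrict_monomials lookup_single when_def mon_degree_eq_0)
      have rel': "(\<Sum>b\<in>B. c' b * b $ a) = 0" if a: "a < ?n" for a
      proof -
        have "(\<Sum>b\<in>B. c' b * b $ a)
            = (\<Sum>b\<in>B. restrict_monomials (\<lambda>m. int (mon_degree m) = \<delta> b0 - ds ! a) (c b * b $ a))"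
          unfolding c'_def
          by (intro sum.cong refl restrict_homogeneous_mult[symmetric])
            (use \<delta> a in \<open>auto simp: is_homogeneous_def\<close>)
        also have "\<dots> = restrict_monomials (\<lambda>m. int (mon_degree m) = \<delta> b0 - ds ! a) (\<Sum>b\<in>B. c b * b $ a)"
          by (rule restrict_monomials_sum[symmetric])
        finally show ?thesis by (simp add: rel[OF a])
      qed
      let ?B = "B - {b0}"
      have b0_comb: "combination ?n ?B b0"
        unfolding combination_def
      proof (intro exI[of _ "\<lambda>b. - Poly_Mapping.single 0 (inverse k) * c' b"] conjI ballI allI impI)
        fix b assume "b \<in> ?B"
        then show "- Poly_Mapping.single 0 (inverse k) * c' b \<in> poly_ring V"
          by (intro poly_ring_mult) (auto simp: c'_def single_uminus[symmetric] intro!: poly_ring_single restrict_monomials_poly_ring c)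
      next
        fix a assume a: "a < ?n"
        have "c' b0 * b0 $ a = - (\<Sum>b\<in>?B. c' b * b $ a)"
          using rel'[OF a] fin b0 by (simp add: sum.remove[of B b0] eq_neg_iff_add_eq_0)
        then have "Poly_Mapping.single 0 (inverse k) * (c' b0 * b0 $ a)
            = (\<Sum>b\<in>?B. - Poly_Mapping.single 0 (inverse k) * c' b * b $ a)"
          by (simp add: sum_distrib_left sum_negf mult.assoc)
        moreover have "Poly_Mapping.single 0 (inverse k) * c' b0 = 1"
          using k by (simp add: c'0 mult_single k_def)
        ultimately show "b0 $ a = (\<Sum>b\<in>?B. - Poly_Mapping.single 0 (inverse k) * c' b * b $ a)"
          by (simp flip: mult.assoc)
      qed
      have B_comb: "combination ?n ?B b" if b: "b \<in> B" for b
      proof (cases "b = b0")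
        case False
        have "b $ a = (\<Sum>b'\<in>?B. (if b' = b then 1 else 0) * b' $ a)" for a
        proof -
          have "(\<Sum>b'\<in>?B. (if b' = b then 1 else 0) * b' $ a) = (\<Sum>b'\<in>?B. if b' = b then b $ a else 0)"
            by (rule sum.cong) auto
          then show ?thesis using fin b False by simp
        qed
        then show ?thesis unfolding combination_def
          by (intro exI[of _ "\<lambda>b'. if b' = b then 1 else 0"]) auto
      qed (simp add: b0_comb)
      have "combination ?n ?B v" if v: "v \<in> Z" for v
      proof -
        from gen[OF v] obtain q where q: "\<And>b. b \<in> B \<Longrightarrow> q b \<in> poly_ring V"
            "\<And>a. a < ?n \<Longrightarrow> v $ a = (\<Sum>b\<in>B. q b * b $ a)" unfolding combination_def by blast
        show ?thesis by (rule combination_sum[OF fin B_comb q]) 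
      qed
      then have "good ?B" using B unfolding good_def by auto
      from min[OF this] show False using fin b0 by (metis card_Diff1_less not_le)
    qed
  qed
qed

lemma syzygies_graded_submodule:
  fixes M :: "('v, 'k::field) mpoly mat"
  assumes M: "graded_map V es ds M"
  shows "graded_submodule es {w \<in> free_module V (length es). M *\<^sub>v w = 0\<^sub>v (length ds)}"
    (is "graded_submodule es ?Z")
proof -
  let ?n = "length ds" and ?k = "length es"
  have Mc: "M \<in> carrier_mat ?n ?k" using M by (simp add: graded_map_def)
  have iff: "w \<in> ?Z \<longleftrightarrow> w \<in> free_module V ?k \<and> (\<forall>a<?n. (\<Sum>b<?k. M $$ (a, b) * w $ b) = 0)" for w
  proof -
    have "M *\<^sub>v w = 0\<^sub>v ?n \<longleftrightarrow> (\<forall>a<?n. (\<Sum>b<?k. M $$ (a, b) * w $ b) = 0)"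
      if "w \<in> free_module V ?k"
    proof -
      have w: "w \<in> carrier_vec ?k" using that by (simp add: free_module_def)
      show ?thesis
      proof
        assume "M *\<^sub>v w = 0\<^sub>v ?n"
        then have "(\<Sum>b<?k. M $$ (a, b) * w $ b) = 0" if "a < ?n" for a
          using mat_vec_entry[OF Mc w that] that by simp
        then show "\<forall>a<?n. (\<Sum>b<?k. M $$ (a, b) * w $ b) = 0" by simp
      next
        assume "\<forall>a<?n. (\<Sum>b<?k. M $$ (a, b) * w $ b) = 0"
        then have "(M *\<^sub>v w) $ a = 0" if "a < ?n" for a
          using mat_vec_entry[OF Mc w that] that by simp
        then show "M *\<^sub>v w = 0\<^sub>v ?n" using Mc by (intro eq_vecI) (simp_all del: index_mult_mat_vec)
      qed
    qed
    then show ?thesis by auto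
  qed
  show ?thesis
    unfolding graded_submodule_def
  proof (intro conjI ballI allI)
    show "?Z \<subseteq> free_module V ?k" by auto
    show "0\<^sub>v ?k \<in> ?Z" unfolding iff by (simp add: free_module_def)
    show "u + v \<in> ?Z" if "u \<in> ?Z" "v \<in> ?Z" for u v
      using that unfolding iff
      by (auto simp: free_module_def distrib_left sum.distrib intro!: poly_ring_add)
    show "p \<cdot>\<^sub>v v \<in> ?Z" if "p \<in> poly_ring V" "v \<in> ?Z" for p v
    proof -
      have "(\<Sum>b<?k. M $$ (a, b) * (p * v $ b)) = p * (\<Sum>b<?k. M $$ (a, b) * v $ b)" for a
        by (simp add: sum_distrib_left ac_simps)
      with that show ?thesis unfolding iff by (auto simp: free_module_def intro!: poly_ring_mult)
    qed
    show "component es j v \<in> ?Z" if v: "v \<in> ?Z" for v j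
      unfolding iff
    proof (intro conjI allI impI)
      show "component es j v \<in> free_module V ?k"
        using v by (auto simp: free_module_def component_def intro: restrict_monomials_poly_ring)
      fix a assume a: "a < ?n"
      have "(\<Sum>b<?k. M $$ (a, b) * component es j v $ b)
          = (\<Sum>b<?k. restrict_monomials (\<lambda>m. int (mon_degree m) = j - ds ! a) (M $$ (a, b) * v $ b))"
      proof (intro sum.cong refl)
        fix b assume b: "b \<in> {..<?k}"
        then have "homogeneous (es ! b - ds ! a) (M $$ (a, b))" using M a by (simp add: graded_map_def)
        from restrict_homogeneous_mult[OF this, of "j - ds ! a" "j - es ! b" "v $ b"] b
        show "M $$ (a, b) * component es j v $ b
            = restrict_monomials (\<lambda>m. int (mon_degree m) = j - ds ! a) (M $$ (a, b) * v $ b)"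
          by (simp add: component_def mult.commute)
      qed
      also have "\<dots> = restrict_monomials (\<lambda>m. int (mon_degree m) = j - ds ! a) (\<Sum>b<?k. M $$ (a, b) * v $ b)"
        by (rule restrict_monomials_sum[symmetric])
      also have "\<dots> = 0" using v a unfolding iff by simp
      finally show "(\<Sum>b<?k. M $$ (a, b) * component es j v $ b) = 0" .
    qed
  qed
qed

lemma minimal_cover:
  fixes Z :: "('v, 'k::field) mpoly vec set"
  assumes Z: "graded_submodule ds Z" and van: "module_vanishes ds Z r"
    and ds: "\<And>a. a < length ds \<Longrightarrow> ds ! a \<le> r"
  obtains es and M :: "('v, 'k) mpoly mat"
  where "graded_map V es ds M" "Z = (\<lambda>w. M *\<^sub>v w) ` free_module V (length es)"
    "\<And>w b. w \<in> free_module V (length es) \<Longrightarrow> M *\<^sub>v w = 0\<^sub>v (length ds) \<Longrightarrow> b < length es \<Longrightarrow>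
      Poly_Mapping.lookup (w $ b) 0 = 0"
proof (rule minimal_homogeneous_generators[OF assms])
  let ?n = "length ds"
  fix B
  assume B: "finite B" "B \<subseteq> Z" "\<And>b. b \<in> B \<Longrightarrow> \<exists>j. is_homogeneous ds j b"
      "\<And>v. v \<in> Z \<Longrightarrow> combination ?n B v"
    and const: "\<And>c b. (\<And>a. a < ?n \<Longrightarrow> (\<Sum>b\<in>B. c b * b $ a) = 0) \<Longrightarrow> (\<And>b. b \<in> B \<Longrightarrow> c b \<in> poly_ring V) \<Longrightarrow>
      b \<in> B \<Longrightarrow> Poly_Mapping.lookup (c b) 0 = 0"
  obtain \<delta> where \<delta>: "\<And>b. b \<in> B \<Longrightarrow> is_homogeneous ds (\<delta> b) b" using B(3) by metis
  obtain bs where bs: "set bs = B" "distinct bs" using finite_distinct_list[OF B(1)] by blast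
  define es where "es = map \<delta> bs"
  define M where "M = mat ?n (length bs) (\<lambda>(a, i). bs ! i $ a)"
  have bij: "bij_betw ((!) bs) {..<length bs} B" using bij_betw_nth[OF bs(2)] bs(1) by simp
  have len: "length es = length bs" by (simp add: es_def)
  have M_carrier: "M \<in> carrier_mat ?n (length es)" by (simp add: M_def len)
  have bsB: "i < length bs \<Longrightarrow> bs ! i \<in> B" for i using bs(1) by auto
  have bs_ring: "bs ! i $ a \<in> poly_ring V" if "i < length bs" "a < ?n" for i a
    by (rule graded_submoduleD(7)[OF Z subsetD[OF B(2) bsB[OF that(1)]] that(2)])
  have gm: "graded_map V es ds M"
    unfolding graded_map_def
    using M_carrier bsB \<delta> bs_ring
    by (auto simp: M_def len es_def is_homogeneous_def)
  have Mw: "(M *\<^sub>v w) $ a = (\<Sum>b\<in>B. w $ (inv_into {..<length bs} ((!) bs) b) * b $ a)"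
    if "w \<in> carrier_vec (length es)" "a < ?n" for w a
  proof -
    have "(M *\<^sub>v w) $ a = (\<Sum>i<length bs. w $ i * bs ! i $ a)"
      unfolding mat_vec_entry[OF M_carrier that] len
      by (intro sum.cong) (use that in \<open>auto simp: M_def\<close>)
    also have "\<dots> = (\<Sum>i<length bs. w $ (inv_into {..<length bs} ((!) bs) (bs ! i)) * bs ! i $ a)"
      using bij by (intro sum.cong) (auto simp: bij_betw_def)
    also have "\<dots> = (\<Sum>b\<in>B. w $ (inv_into {..<length bs} ((!) bs) b) * b $ a)"
      using sum.reindex_bij_betw[OF bij] .
    finally show ?thesis .
  qed
  have inv_lt: "inv_into {..<length bs} ((!) bs) b < length bs" if "b \<in> B" for b
    using bij that inv_into_into[of b "(!) bs" "{..<length bs}"] by (auto simp: bij_betw_def)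
  have w_coeff: "w $ (inv_into {..<length bs} ((!) bs) b) \<in> poly_ring V"
    if "w \<in> free_module V (length es)" "b \<in> B" for w b
    using that inv_lt[OF that(2)] by (simp add: free_module_def len)
  have image: "Z = (\<lambda>w. M *\<^sub>v w) ` free_module V (length es)"
  proof (intro equalityI subsetI)
    fix v assume v: "v \<in> Z"
    from B(4)[OF this] obtain c where c: "\<And>b. b \<in> B \<Longrightarrow> c b \<in> poly_ring V"
        "\<And>a. a < ?n \<Longrightarrow> v $ a = (\<Sum>b\<in>B. c b * b $ a)" unfolding combination_def by blast
    define w where "w = vec (length es) (\<lambda>i. c (bs ! i))"
    have w: "w \<in> free_module V (length es)"
      using c(1) bsB by (simp add: w_def free_module_def len)
    have wc: "w \<in> carrier_vec (length es)" by (simp add: w_def)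
    have "w $ (inv_into {..<length bs} ((!) bs) b) = c b" if "b \<in> B" for b
      using inv_lt[OF that] bij that by (simp add: w_def len bij_betw_def f_inv_into_f)
    then have "(M *\<^sub>v w) $ a = v $ a" if "a < ?n" for a
      unfolding Mw[OF wc that] c(2)[OF that] by (intro sum.cong) auto
    then have "v = M *\<^sub>v w"
      using graded_submoduleD(6)[OF Z v] M_carrier by (intro eq_vecI) (auto simp del: index_mult_mat_vec)
    with w show "v \<in> (\<lambda>w. M *\<^sub>v w) ` free_module V (length es)" by blast
  next
    fix v assume "v \<in> (\<lambda>w. M *\<^sub>v w) ` free_module V (length es)"
    then obtain w where w: "v = M *\<^sub>v w" "w \<in> free_module V (length es)" by blast
    have wc: "w \<in> carrier_vec (length es)" using w(2) by (simp add: free_module_def)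
    have "v = vec ?n (\<lambda>a. \<Sum>b\<in>B. w $ (inv_into {..<length bs} ((!) bs) b) * b $ a)"
      unfolding w(1) using M_carrier by (intro eq_vecI) (auto simp: Mw[OF wc] simp del: index_mult_mat_vec)
    then show "v \<in> Z"
      using combination_in_submodule[OF Z B(1,2), of "\<lambda>b. w $ (inv_into {..<length bs} ((!) bs) b)"]
        w_coeff[OF w(2)] by simp
  qed
  have "Poly_Mapping.lookup (w $ i) 0 = 0"
    if w: "w \<in> free_module V (length es)" and Mw0: "M *\<^sub>v w = 0\<^sub>v ?n" and i: "i < length es" for w i
  proof -
    have wc: "w \<in> carrier_vec (length es)" using w by (simp add: free_module_def)
    have "(\<Sum>b\<in>B. w $ (inv_into {..<length bs} ((!) bs) b) * b $ a) = 0" if "a < ?n" for a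
      using Mw[OF wc that] Mw0 that by simp
    from const[OF this w_coeff[OF w] bsB[of i]]
    have "Poly_Mapping.lookup (w $ (inv_into {..<length bs} ((!) bs) (bs ! i))) 0 = 0"
      using i len by simp
    moreover have "inv_into {..<length bs} ((!) bs) (bs ! i) = i"
      using bij i len by (simp add: bij_betw_def)
    ultimately show ?thesis by simp
  qed
  with gm image show ?thesis by (intro that)
qed

lemma support_ideal_graded_submodule:
  assumes mono: "mono U"
  shows "graded_submodule [0] {v \<in> free_module V (length [0 :: int]).
    vec 1 (\<lambda>_. 1) \<bullet> v \<in> (support_ideal U :: ('v, 'k::field) mpoly set)}" (is "graded_submodule _ ?Z")
proof -
  have iff: "v \<in> ?Z \<longleftrightarrow> v \<in> carrier_vec 1 \<and> v $ 0 \<in> support_ideal U" for v :: "('v, 'k) mpoly vec"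
  proof -
    have "v $ 0 \<in> poly_ring V" if "v $ 0 \<in> support_ideal U"
      using that unfolding support_ideal_def by (rule monomial_span_imp_poly_ring)
    then show ?thesis by (auto simp: free_module_def scalar_prod_def)
  qed
  have smult: "p * f \<in> support_ideal U" if "p \<in> poly_ring V" "f \<in> support_ideal U" for p f :: "('v, 'k) mpoly"
    using that unfolding poly_ring_eq support_ideal_def
    by (rule monomial_span_mult) (auto simp: keys_plus_nat intro: upward_closedD[OF mono])
  show ?thesis
    unfolding graded_submodule_def
  proof (intro conjI ballI allI)
    show "?Z \<subseteq> free_module V (length [0])" by auto
    show "0\<^sub>v (length [0]) \<in> ?Z" unfolding iff by (simp add: support_ideal_def)
    show "u + v \<in> ?Z" if "u \<in> ?Z" "v \<in> ?Z" for u v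
      using that unfolding iff by (auto simp: support_ideal_def intro: monomial_span_add)
    show "p \<cdot>\<^sub>v v \<in> ?Z" if "p \<in> poly_ring V" "v \<in> ?Z" for p v
      using that unfolding iff by (auto intro: smult)
    show "component [0] j v \<in> ?Z" if "v \<in> ?Z" for v j
      using that unfolding iff unfolding support_ideal_def
      by (auto simp: component_def intro: monomial_span_mono[OF restrict_monomials_in])
  qed
qed

text \<open>The resolution is built by dependent choice. Each stage consists of a free module and the submodule
to be covered next, which inherits from \<open>module_vanishes_syzygies\<close> the property that makes the next
minimal cover finite. A proper ideal is needed in order that the first free module be \<open>S\<close>
itself.\<close>
theorem minimal_resolution_exists:
  assumes mono: "mono U" and van: "koszul_vanishes TYPE('k::field) U r" and proper: "\<not> U {}"
  shows "\<exists>d g M. minimal_graded_free_resolution V (support_ideal U :: ('v, 'k) mpoly set) d g M"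
proof -
  define g :: "('v, 'k) mpoly vec" where "g = vec 1 (\<lambda>_. 1)"
  define Z0 where "Z0 = {v \<in> free_module V (length [0 :: int]). g \<bullet> v \<in> support_ideal U}"
  define syz :: "int list \<Rightarrow> int list \<Rightarrow> ('v, 'k) mpoly mat \<Rightarrow> ('v, 'k) mpoly vec set" where
    "syz es ds M = {w \<in> free_module V (length es). M *\<^sub>v w = 0\<^sub>v (length ds)}" for es ds M
  define good :: "nat \<Rightarrow> int list \<times> ('v, 'k) mpoly vec set \<Rightarrow> bool" where
    "good i = (\<lambda>(ds, Z). graded_submodule ds Z \<and> module_vanishes ds Z (r + int i) \<and>
       (\<forall>v\<in>Z. \<forall>a<length ds. Poly_Mapping.lookup (v $ a) 0 = 0) \<and> (i = 0 \<longrightarrow> ds = [0] \<and> Z = Z0))" for i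
  define linked :: "int list \<times> ('v, 'k) mpoly vec set \<Rightarrow> int list \<times> ('v, 'k) mpoly vec set \<Rightarrow>
      ('v, 'k) mpoly mat \<Rightarrow> bool" where
    "linked = (\<lambda>(ds, Z) (es, Z') M. graded_map V es ds M \<and>
       Z = (\<lambda>w. M *\<^sub>v w) ` free_module V (length es) \<and> Z' = syz es ds M)"
  have g_free: "g \<in> free_module V (length [0 :: int])" by (simp add: g_def free_module_def)
  have g_hom: "homogeneous ([0] ! a) (g $ a)" if "a < length [0 :: int]" for a
    using that by (simp add: g_def homogeneous_def)
  have g_surj: "\<exists>v\<in>free_module V (length [0 :: int]). f - g \<bullet> v \<in> support_ideal U"
    if "f \<in> poly_ring V" for f
    by (rule bexI[of _ "vec 1 (\<lambda>_. f)"])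
      (use that in \<open>simp_all add: g_def scalar_prod_def free_module_def support_ideal_def\<close>)
  have start: "good 0 ([0], Z0)"
  proof -
    have "Poly_Mapping.lookup (v $ 0) 0 = 0" if "v \<in> Z0" for v
    proof -
      have "g \<bullet> v = v $ 0" using that by (auto simp: Z0_def g_def scalar_prod_def free_module_def)
      then have "v $ 0 \<in> support_ideal U" using that by (simp add: Z0_def)
      then show ?thesis using proper unfolding support_ideal_def by (auto dest: monomial_spanD)
    qed
    then show ?thesis
      using support_ideal_graded_submodule[OF mono, where 'k='k]
        module_vanishes_start[OF mono van g_free g_hom g_surj]
      unfolding good_def by (simp add: Z0_def g_def)
  qed
  have step: "\<exists>y. good (Suc i) y \<and> (\<exists>M. linked x y M)" if x: "good i x" for i x
  proof -
    obtain ds Z where dsZ: "x = (ds, Z)" by (cases x)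
    have Z: "graded_submodule ds Z" and vZ: "module_vanishes ds Z (r + int i)"
      and const: "\<And>v a. v \<in> Z \<Longrightarrow> a < length ds \<Longrightarrow> Poly_Mapping.lookup (v $ a) 0 = 0"
      using x unfolding dsZ good_def by auto
    have le: "ds ! a \<le> r + int i" if "a < length ds" for a
      by (rule module_vanishes_shifts[OF vZ graded_submoduleD(2)[OF Z] that const])
    show ?thesis
    proof (rule minimal_cover[OF Z vZ le])
      fix es and M :: "('v, 'k) mpoly mat"
      assume M: "graded_map V es ds M" "Z = (\<lambda>w. M *\<^sub>v w) ` free_module V (length es)"
        "\<And>w b. w \<in> free_module V (length es) \<Longrightarrow> M *\<^sub>v w = 0\<^sub>v (length ds) \<Longrightarrow> b < length es \<Longrightarrow>
          Poly_Mapping.lookup (w $ b) 0 = 0"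
      have "good (Suc i) (es, syz es ds M)"
        unfolding good_def syz_def
        using syzygies_graded_submodule[OF M(1)] module_vanishes_syzygies[OF M(1) le M(2) vZ] M(3)
        by (auto simp: ac_simps)
      moreover have "linked x (es, syz es ds M) M" using M by (simp add: linked_def dsZ)
      ultimately show ?thesis by blast
    qed
  qed
  obtain F where F: "\<And>i. good i (F i)" "\<And>i. \<exists>M. linked (F i) (F (Suc i)) M"
    using dependent_nat_choice[of good "\<lambda>i x y. \<exists>M. linked x y M"] start step by blast
  then obtain M where M: "\<And>i. linked (F i) (F (Suc i)) (M i)" by metis
  define d where "d i = fst (F i)" for i
  define Z where "Z i = snd (F i)" for i
  have FdZ: "F i = (d i, Z i)" for i by (simp add: d_def Z_def)
  have gm: "graded_map V (d (Suc i)) (d i) (M i)"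
    and im: "Z i = (\<lambda>w. M i *\<^sub>v w) ` free_module V (length (d (Suc i)))"
    and ker: "Z (Suc i) = syz (d (Suc i)) (d i) (M i)" for i
    using M[of i] by (auto simp: FdZ linked_def)
  have const: "Poly_Mapping.lookup (v $ a) 0 = 0" if "v \<in> Z i" "a < length (d i)" for i v a
    using F(1)[of i] that by (auto simp: FdZ good_def)
  have 0: "d 0 = [0]" "Z 0 = Z0" using F(1)[of 0] by (auto simp: FdZ good_def)
  have "graded_free_resolution V (support_ideal U) d g M"
    unfolding graded_free_resolution_def
  proof (intro conjI allI ballI impI)
    show "{v \<in> free_module V (length (d 0)). g \<bullet> v \<in> support_ideal U} =
        (\<lambda>w. M 0 *\<^sub>v w) ` free_module V (length (d 1))"
      using im[of 0] 0 by (simp add: Z0_def)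
    show "{v \<in> free_module V (length (d (Suc i))). M i *\<^sub>v v = 0\<^sub>v (length (d i))} =
        (\<lambda>w. M (Suc i) *\<^sub>v w) ` free_module V (length (d (Suc (Suc i))))" for i
      using im[of "Suc i"] ker[of i] by (simp add: syz_def)
  qed (use g_free g_hom g_surj gm 0 in auto)
  moreover have "Poly_Mapping.lookup (M i $$ (a, b)) 0 = 0"
    if a: "a < length (d i)" and b: "b < length (d (Suc i))" for i a b
  proof -
    let ?k = "length (d (Suc i))"
    have Mc: "M i \<in> carrier_mat (length (d i)) ?k" using gm[of i] by (simp add: graded_map_def)
    have "unit_vec ?k b \<in> free_module V ?k" by (auto simp: free_module_def unit_vec_def)
    then have "M i *\<^sub>v unit_vec ?k b \<in> Z i" using im[of i] by blast
    from const[OF this a] show ?thesis using Mc a b by simp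
  qed
  ultimately show ?thesis unfolding minimal_graded_free_resolution_def by blast
qed

theorem quotient_regularity_le:
  assumes mono: "mono U" and van: "koszul_vanishes TYPE('k::field) U r" and proper: "\<not> U {}"
  shows "quotient_regularity V (support_ideal U :: ('v, 'k) mpoly set) \<le> ereal (real_of_int r)"
  unfolding quotient_regularity_def
proof (rule Sup_least)
  let ?I = "support_ideal U :: ('v, 'k) mpoly set"
  fix x assume "x \<in> {ereal (of_int (j - int i)) |i j. graded_betti V ?I i j \<noteq> 0}"
  then obtain i j where x: "x = ereal (of_int (j - int i))" and "graded_betti V ?I i j \<noteq> 0" by blast
  then have j: "j \<in> set (minimal_shifts V ?I i)"
    unfolding graded_betti_def by (metis count_list_0_iff)
  have "\<exists>g M. minimal_graded_free_resolution V ?I (minimal_shifts V ?I) g M"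
    unfolding minimal_shifts_def
    using someI_ex[of "\<lambda>d. \<exists>g M. minimal_graded_free_resolution V ?I d g M", OF minimal_resolution_exists[OF assms]] .
  then obtain g M where "minimal_graded_free_resolution V ?I (minimal_shifts V ?I) g M" by blast
  from minimal_resolution_shifts[OF mono van this j]
  show "x \<le> ereal (real_of_int r)" by (simp add: x)
qed

end

section \<open>The neighborhood ideal as a squarefree monomial ideal\<close>

lemma closed_nbhd_sym: "u \<in> closed_nbhd E v \<Longrightarrow> v \<in> closed_nbhd E u"
  by (auto simp: closed_nbhd_def nbhd_def insert_commute)

lemma simple_graph_edge:
  assumes "simple_graph V E" "{u, v} \<in> E"
  shows "u \<noteq> v" "u \<in> V" "v \<in> V"
proof -
  have "{u, v} \<subseteq> V" "card {u, v} = 2" using assms by (auto simp: simple_graph_def)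
  then show "u \<noteq> v" "u \<in> V" "v \<in> V" by auto
qed

lemma simple_graph_nbhd:
  assumes "simple_graph V E"
  shows "nbhd E v \<subseteq> V" "finite (nbhd E v)" "v \<notin> nbhd E v"
    "card (closed_nbhd E v) = Suc (vertex_degree E v)"
proof -
  show sub: "nbhd E v \<subseteq> V" using simple_graph_edge[OF assms] by (auto simp: nbhd_def)
  moreover have "finite V" using assms by (simp add: simple_graph_def)
  ultimately show fin: "finite (nbhd E v)" by (rule finite_subset)
  show notin: "v \<notin> nbhd E v" using simple_graph_edge[OF assms, of v v] by (auto simp: nbhd_def)
  show "card (closed_nbhd E v) = Suc (vertex_degree E v)"
    using fin notin by (simp add: closed_nbhd_def vertex_degree_def)
qed

text \<open>A set of variables contains \<open>W \<subseteq> N[i]\<close> with \<open>card W = deg i\<close>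
exactly if at most one element of \<open>N[i]\<close> is missing from it (\<open>nonface_iff\<close>); in this
form the complement of a face is a set that dominates every vertex twice.\<close>
definition nonface :: "'v set \<Rightarrow> 'v set set \<Rightarrow> 'v set \<Rightarrow> bool" where
  "nonface V E T \<longleftrightarrow> (\<exists>i\<in>V. card (closed_nbhd E i - T) \<le> 1)"

lemma nonface_iff:
  assumes G: "simple_graph V E"
  shows "nonface V E T \<longleftrightarrow> (\<exists>i\<in>V. \<exists>W\<subseteq>closed_nbhd E i. card W = vertex_degree E i \<and> W \<subseteq> T)"
proof -
  have "card (closed_nbhd E i - T) \<le> 1 \<longleftrightarrow> (\<exists>W\<subseteq>closed_nbhd E i. card W = vertex_degree E i \<and> W \<subseteq> T)" for i
  proof -
    let ?N = "closed_nbhd E i"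
    have fin: "finite ?N" using simple_graph_nbhd[OF G] by (simp add: closed_nbhd_def)
    have sum: "card (?N - T) + card (?N \<inter> T) = Suc (vertex_degree E i)"
      using card_Int_Diff[OF fin, of T] simple_graph_nbhd(4)[OF G] by simp
    show ?thesis
    proof
      assume "card (?N - T) \<le> 1"
      then have "vertex_degree E i \<le> card (?N \<inter> T)" using sum by simp
      then obtain W where "W \<subseteq> ?N \<inter> T" "card W = vertex_degree E i"
        by (meson obtain_subset_with_card_n)
      then show "\<exists>W\<subseteq>?N. card W = vertex_degree E i \<and> W \<subseteq> T" by blast
    next
      assume "\<exists>W\<subseteq>?N. card W = vertex_degree E i \<and> W \<subseteq> T"
      then obtain W where W: "W \<subseteq> ?N \<inter> T" "card W = vertex_degree E i" by blast
      then have "vertex_degree E i \<le> card (?N \<inter> T)"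
        using card_mono[of "?N \<inter> T" W] fin by auto
      then show "card (?N - T) \<le> 1" using sum by simp
    qed
  qed
  then show ?thesis by (simp add: nonface_def)
qed

lemma mono_nonface:
  assumes "simple_graph V E"
  shows "mono (nonface V E)"
proof (rule monoI, rule le_boolI)
  fix S T :: "'a set" assume "S \<subseteq> T" "nonface V E S"
  then show "nonface V E T" unfolding nonface_iff[OF assms] by blast
qed

lemma prod_var:
  assumes "finite W"
  shows "(\<Prod>j\<in>W. var j :: ('v, 'k::field) mpoly) = Poly_Mapping.single (\<Sum>j\<in>W. Poly_Mapping.single j 1) 1"
  using assms by (induction W rule: finite_induct) (auto simp: var_def mult_single)

lemma lookup_sum_single:
  "finite W \<Longrightarrow> Poly_Mapping.lookup (\<Sum>j\<in>W. Poly_Mapping.single j (1::nat)) v = (if v \<in> W then 1 else 0)"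
  by (simp add: lookup_sum lookup_single when_def)

lemma ideal_generated_add:
  assumes "f \<in> ideal_generated V A" "g \<in> ideal_generated V A"
  shows "f + g \<in> ideal_generated V A"
proof -
  obtain B c where f: "f = (\<Sum>a\<in>B. c a * a)" "finite B" "B \<subseteq> A" "\<forall>a\<in>B. c a \<in> poly_ring V"
    using assms(1) by (auto simp: ideal_generated_def)
  obtain B' c' where g: "g = (\<Sum>a\<in>B'. c' a * a)" "finite B'" "B' \<subseteq> A" "\<forall>a\<in>B'. c' a \<in> poly_ring V"
    using assms(2) by (auto simp: ideal_generated_def)
  define e where "e a = (if a \<in> B then c a else 0)" for a
  define e' where "e' a = (if a \<in> B' then c' a else 0)" for a
  have "f = (\<Sum>a\<in>B \<union> B'. e a * a)"
    unfolding f(1) by (rule sum.mono_neutral_cong_left) (use f(2) g(2) in \<open>auto simp: e_def\<close>)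
  moreover have "g = (\<Sum>a\<in>B \<union> B'. e' a * a)"
    unfolding g(1) by (rule sum.mono_neutral_cong_left) (use f(2) g(2) in \<open>auto simp: e'_def\<close>)
  ultimately have "f + g = (\<Sum>a\<in>B \<union> B'. (e a + e' a) * a)"
    by (simp add: distrib_right sum.distrib)
  moreover have "\<forall>a\<in>B \<union> B'. e a + e' a \<in> poly_ring V"
    using f(4) g(4) by (auto simp: e_def e'_def intro!: poly_ring_add)
  ultimately show ?thesis using f(2,3) g(2,3)
    unfolding ideal_generated_def by (intro CollectI exI[of _ "B \<union> B'"] exI[of _ "\<lambda>a. e a + e' a"]) auto
qed

lemma ideal_generated_0: "0 \<in> ideal_generated V A"
  unfolding ideal_generated_def by (intro CollectI exI[of _ "{}"]) auto

lemma ideal_generated_multiple: "p \<in> poly_ring V \<Longrightarrow> a \<in> A \<Longrightarrow> p * a \<in> ideal_generated V A"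
  unfolding ideal_generated_def by (intro CollectI exI[of _ "{a}"] exI[of _ "\<lambda>_. p"]) auto

text \<open>Each generator is a squarefree monomial, and every monomial divisible by one of them is a multiple
of a generator for a single vertex. Both sides are spanned by their monomials.\<close>
lemma neighborhood_ideal_eq:
  assumes G: "simple_graph V E"
  shows "(neighborhood_ideal V E (vertex_degree E) :: ('v, 'k::field) mpoly set) =
    monomial_span (\<lambda>m. Poly_Mapping.keys m \<subseteq> V \<and> nonface V E (Poly_Mapping.keys m))"
    (is "?N = ?M")
proof
  have finV: "finite V" using G by (simp add: simple_graph_def)
  define gens :: "'v \<Rightarrow> ('v, 'k) mpoly set" where
    "gens i = {\<Prod>j\<in>W. var j | W. W \<subseteq> closed_nbhd E i \<and> card W = vertex_degree E i}" for i
  have N: "?N = ideal_sum V (\<lambda>i. ideal_generated V (gens i))"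
    by (simp add: neighborhood_ideal_def gens_def)
  have fin_closed: "finite W" if "W \<subseteq> closed_nbhd E i" for W i
    using that simple_graph_nbhd[OF G] finite_subset by (fastforce simp: closed_nbhd_def)
  have closed_V: "closed_nbhd E i \<subseteq> V" if "i \<in> V" for i
    using that simple_graph_nbhd[OF G] by (auto simp: closed_nbhd_def)
  show "?N \<subseteq> ?M"
  proof
    fix f assume "f \<in> ?N"
    then obtain h where f: "f = (\<Sum>i\<in>V. h i)" and h: "\<And>i. i \<in> V \<Longrightarrow> h i \<in> ideal_generated V (gens i)"
      unfolding N ideal_sum_def by auto
    have "h i \<in> ?M" if i: "i \<in> V" for i
    proof -
      obtain B c where hi: "h i = (\<Sum>a\<in>B. c a * a)" and B: "B \<subseteq> gens i" "\<forall>a\<in>B. c a \<in> poly_ring V"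
        using h[OF i] by (auto simp: ideal_generated_def)
      have "c a * a \<in> ?M" if a: "a \<in> B" for a
      proof -
        obtain W where W: "a = (\<Prod>j\<in>W. var j)" "W \<subseteq> closed_nbhd E i" "card W = vertex_degree E i"
          using B(1) a by (auto simp: gens_def)
        have finW: "finite W" by (rule fin_closed[OF W(2)])
        have "c a \<in> monomial_span (\<lambda>m. Poly_Mapping.keys m \<subseteq> V)"
          using B(2) a by (simp add: poly_ring_eq)
        moreover have "a \<in> monomial_span (\<lambda>m. Poly_Mapping.keys m = W)"
          unfolding W(1) prod_var[OF finW]
          by (rule monomial_span_single) (auto simp: in_keys_iff lookup_sum_single[OF finW, unfolded One_nat_def] split: if_splits)
        ultimately show ?thesis
        proof (rule monomial_span_mult)
          fix p q :: "'v \<Rightarrow>\<^sub>0 nat"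
          assume "Poly_Mapping.keys p \<subseteq> V" "Poly_Mapping.keys q = W"
          then show "Poly_Mapping.keys (p + q) \<subseteq> V \<and> nonface V E (Poly_Mapping.keys (p + q))"
            unfolding nonface_iff[OF G] keys_plus_nat using i W closed_V[OF i] by blast
        qed
      qed
      then show ?thesis unfolding hi by (rule monomial_span_sum)
    qed
    then show "f \<in> ?M" unfolding f by (rule monomial_span_sum)
  qed
  show "?M \<subseteq> ?N"
  proof
    fix f :: "('v, 'k) mpoly" assume f: "f \<in> ?M"
    have add: "g + g' \<in> ?N" if g: "g \<in> ?N" and g': "g' \<in> ?N" for g g'
    proof -
      obtain h h' where "g = (\<Sum>i\<in>V. h i)" "\<forall>i\<in>V. h i \<in> ideal_generated V (gens i)"
          "g' = (\<Sum>i\<in>V. h' i)" "\<forall>i\<in>V. h' i \<in> ideal_generated V (gens i)"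
        using g g' unfolding N ideal_sum_def by auto
      then show ?thesis unfolding N ideal_sum_def
        by (intro CollectI exI[of _ "\<lambda>i. h i + h' i"]) (auto simp: sum.distrib intro!: ideal_generated_add)
    qed
    have zero: "0 \<in> ?N"
      unfolding N ideal_sum_def by (intro CollectI exI[of _ "\<lambda>_. 0"]) (simp add: ideal_generated_0)
    have monomial: "Poly_Mapping.single m k \<in> ?N"
      if m: "Poly_Mapping.keys m \<subseteq> V" "nonface V E (Poly_Mapping.keys m)" for m and k :: 'k
    proof -
      obtain i W where i: "i \<in> V" and W: "W \<subseteq> closed_nbhd E i" "card W = vertex_degree E i"
          "W \<subseteq> Poly_Mapping.keys m"
        using m(2) unfolding nonface_iff[OF G] by blast
      have finW: "finite W" by (rule fin_closed[OF W(1)])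
      define w where "w = (\<Sum>j\<in>W. Poly_Mapping.single j (1::nat))"
      have "m - w + w = m"
        by (rule poly_mapping_eqI)
          (use W(3) in \<open>auto simp: w_def lookup_add lookup_minus lookup_sum_single[OF finW, unfolded One_nat_def] in_keys_iff\<close>)
      then have eq: "Poly_Mapping.single m k = Poly_Mapping.single (m - w) k * (\<Prod>j\<in>W. var j)"
        unfolding prod_var[OF finW] w_def[symmetric] by (simp add: mult_single)
      have "Poly_Mapping.keys (m - w) \<subseteq> V"
        using m(1) by (auto simp: in_keys_iff lookup_minus)
      then have "Poly_Mapping.single m k \<in> ideal_generated V (gens i)"
        unfolding eq using W by (intro ideal_generated_multiple poly_ring_single) (auto simp: gens_def)
      then show ?thesis
        unfolding N ideal_sum_def using i finV
        by (intro CollectI exI[of _ "\<lambda>i'. if i' = i then Poly_Mapping.single m k else 0"])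
          (auto simp: ideal_generated_0)
    qed
    have "(\<Sum>m\<in>A. Poly_Mapping.single m (Poly_Mapping.lookup f m)) \<in> ?N"
      if "finite A" "A \<subseteq> Poly_Mapping.keys f" for A
      using that
    proof (induction A rule: finite_induct)
      case (insert m A)
      have "Poly_Mapping.single m (Poly_Mapping.lookup f m) \<in> ?N"
        by (rule monomial) (use f insert.prems in \<open>auto simp: monomial_span_def\<close>)
      with insert show ?case by (simp add: add)
    qed (simp add: zero)
    from this[OF finite_keys order_refl] show "f \<in> ?N" by (simp add: sum_monomials)
  qed
qed

section \<open>Simplicial vertices and the regularity bound\<close>

definition simplicial :: "'v set set \<Rightarrow> 'v \<Rightarrow> bool" where
  "simplicial E v \<longleftrightarrow> complete_edges (closed_nbhd E v) \<subseteq> E"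

definition independent :: "'v set set \<Rightarrow> 'v set \<Rightarrow> bool" where
  "independent E J \<longleftrightarrow> (\<forall>u\<in>J. \<forall>w\<in>J. {u, w} \<notin> E)"

lemma complete_edges_subset_iff:
  "complete_edges Q \<subseteq> E \<longleftrightarrow> (\<forall>u\<in>Q. \<forall>w\<in>Q. u \<noteq> w \<longrightarrow> {u, w} \<in> E)"
proof
  assume sub: "complete_edges Q \<subseteq> E"
  show "\<forall>u\<in>Q. \<forall>w\<in>Q. u \<noteq> w \<longrightarrow> {u, w} \<in> E"
  proof (intro ballI impI)
    fix u w assume "u \<in> Q" "w \<in> Q" "u \<noteq> w"
    then have "{u, w} \<in> complete_edges Q" by (simp add: complete_edges_def)
    with sub show "{u, w} \<in> E" ..
  qed
next
  assume "\<forall>u\<in>Q. \<forall>w\<in>Q. u \<noteq> w \<longrightarrow> {u, w} \<in> E"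
  then show "complete_edges Q \<subseteq> E" by (auto simp: complete_edges_def card_2_iff)
qed

lemma complete_edgesD: "complete_edges Q \<subseteq> E \<Longrightarrow> u \<in> Q \<Longrightarrow> w \<in> Q \<Longrightarrow> u \<noteq> w \<Longrightarrow> {u, w} \<in> E"
  by (simp add: complete_edges_subset_iff)

text \<open>Every generator that comes from a neighbor \<open>i\<close> of a simplicial vertex \<open>j\<close>
is thus divisible by a generator that comes from \<open>j\<close>. For adjacent simplicial vertices the two
closed neighborhoods coincide.\<close>
lemma simplicial_closed_nbhd:
  assumes "simplicial E j" "j \<in> closed_nbhd E i"
  shows "closed_nbhd E j \<subseteq> closed_nbhd E i"
proof
  fix u assume u: "u \<in> closed_nbhd E j"
  show "u \<in> closed_nbhd E i"
  proof (cases "u = i")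
    case False
    have "i \<in> closed_nbhd E j" by (rule closed_nbhd_sym[OF assms(2)])
    then have "{i, u} \<in> E"
      using complete_edgesD[OF assms(1)[unfolded simplicial_def]] u False by blast
    then show ?thesis by (simp add: closed_nbhd_def nbhd_def)
  qed (simp add: closed_nbhd_def)
qed

text \<open>The vertices outside \<open>S\<close> are queried. All neighbors of \<open>s \<in> S\<close> are
among them. If at most one neighbor is missing from the face \<open>L\<close>, the variable \<open>s\<close>
lies in the ideal. If two are missing, all generators involving \<open>s\<close> have been killed, since each is
divisible by one inside \<open>N[s]\<close>. For the size of \<open>L\<close>, the hypothesis
\<open>spread\<close> is applied to the members of \<open>I\<close> in \<open>L\<close> and the vertices of
\<open>V - (S \<union> I)\<close> missing from \<open>L\<close>.\<close>
lemma koszul_vanishes_nonface: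
  assumes "koszul V ord" and G: "simple_graph V E"
    and J: "S \<union> I \<subseteq> V" "S \<inter> I = {}" "S \<union> I \<noteq> {}" "independent E (S \<union> I)"
    and S: "\<And>s. s \<in> S \<Longrightarrow> simplicial E s"
    and spread: "\<And>I' D. I' \<subseteq> I \<Longrightarrow> I' \<noteq> {} \<Longrightarrow> D \<subseteq> V \<Longrightarrow> (\<And>i. i \<in> I' \<Longrightarrow> 2 \<le> card (nbhd E i \<inter> D)) \<Longrightarrow>
      card I' < card D"
  shows "koszul.koszul_vanishes V ord TYPE('k::field) (nonface V E) (int (card (V - (S \<union> I))) - 1)"
proof -
  interpret koszul V ord by fact
  let ?C = "V - (S \<union> I)"
  have nbhd_C: "nbhd E j \<subseteq> ?C" if "j \<in> S \<union> I" for j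
    using that J(4) simple_graph_nbhd(1)[OF G, of j] unfolding independent_def nbhd_def by blast
  have fin: "finite (closed_nbhd E i)" for i
    using simple_graph_nbhd(2)[OF G] by (simp add: closed_nbhd_def)
  show ?thesis
  proof (rule koszul_vanishes_by_faces[OF mono_nonface[OF G], where W = "V - S"])
    fix L j assume L: "L \<subseteq> V - S" and j: "j \<in> V - (V - S)"
    then have jS: "j \<in> S" and jV: "j \<in> V" by auto
    have nbhd_W: "nbhd E j \<subseteq> V - S" using nbhd_C[of j] jS by auto
    show "nonface V E (insert j L) \<or>
      (\<forall>T. T \<inter> (V - S - L) = {} \<longrightarrow> nonface V E (insert j T \<union> L) \<longrightarrow> nonface V E (T \<union> L))"
    proof (cases "card (nbhd E j - L) \<le> 1")
      case True
      have "closed_nbhd E j - insert j L \<subseteq> nbhd E j - L" by (auto simp: closed_nbhd_def)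
      then have "card (closed_nbhd E j - insert j L) \<le> card (nbhd E j - L)"
        by (intro card_mono) (use simple_graph_nbhd(2)[OF G] in auto)
      then show ?thesis using True jV unfolding nonface_def by fastforce
    next
      case False
      have "nonface V E (T \<union> L)" if T: "T \<inter> (V - S - L) = {}" and U: "nonface V E (insert j T \<union> L)" for T
      proof -
        obtain i where i: "i \<in> V" "card (closed_nbhd E i - (insert j T \<union> L)) \<le> 1"
          using U unfolding nonface_def by blast
        have "j \<notin> closed_nbhd E i"
        proof
          assume "j \<in> closed_nbhd E i"
          then have "closed_nbhd E j \<subseteq> closed_nbhd E i" by (rule simplicial_closed_nbhd[OF S[OF jS]])
          moreover have "nbhd E j - L \<subseteq> closed_nbhd E j - (insert j T \<union> L)"
            using T nbhd_W simple_graph_nbhd(3)[OF G, of j] by (auto simp: closed_nbhd_def)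
          ultimately have "nbhd E j - L \<subseteq> closed_nbhd E i - (insert j T \<union> L)" by blast
          then have "card (nbhd E j - L) \<le> card (closed_nbhd E i - (insert j T \<union> L))"
            by (intro card_mono) (use fin in auto)
          then show False using i(2) False by simp
        qed
        then have "closed_nbhd E i - (insert j T \<union> L) = closed_nbhd E i - (T \<union> L)" by auto
        then show ?thesis using i unfolding nonface_def by auto
      qed
      then show ?thesis by blast
    qed
  next
    fix L assume L: "L \<subseteq> V - S" and face: "\<not> nonface V E L"
    have two: "2 \<le> card (closed_nbhd E i - L)" if "i \<in> V" for i
      using face that unfolding nonface_def by (metis not_less_eq_eq numeral_2_eq_2 One_nat_def)
    let ?D = "?C - L" and ?I = "I \<inter> L"
    have finV: "finite V" using G by (simp add: simple_graph_def)
    have "card ?I < card ?D"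
    proof (cases "?I = {}")
      case True
      obtain j where j: "j \<in> S \<union> I" using J(3) by blast
      then have "j \<in> V" using J(1) by blast
      have "closed_nbhd E j - L \<subseteq> insert j (nbhd E j - L)" by (auto simp: closed_nbhd_def)
      then have "card (closed_nbhd E j - L) \<le> card (insert j (nbhd E j - L))"
        by (intro card_mono) (use simple_graph_nbhd(2)[OF G] in auto)
      then have two_le: "2 \<le> card (insert j (nbhd E j - L))" using two[OF \<open>j \<in> V\<close>] by simp
      have "nbhd E j - L \<noteq> {}"
      proof
        assume "nbhd E j - L = {}"
        from two_le[unfolded this] show False by simp
      qed
      then have "?D \<noteq> {}" using nbhd_C[OF j] by blast
      then show ?thesis using True finV by (simp add: card_gt_0_iff)
    next
      case False
      show ?thesis
      proof (rule spread[OF _ False])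
        fix i assume i: "i \<in> ?I"
        then have "closed_nbhd E i - L = nbhd E i - L" by (auto simp: closed_nbhd_def)
        moreover have "nbhd E i - L \<subseteq> nbhd E i \<inter> ?D" using nbhd_C[of i] i by blast
        then have "card (nbhd E i - L) \<le> card (nbhd E i \<inter> ?D)"
          by (intro card_mono) (use simple_graph_nbhd(2)[OF G] in auto)
        ultimately show "2 \<le> card (nbhd E i \<inter> ?D)" using two[of i] i J(1) by auto
      qed auto
    qed
    moreover have "card L = card (?C \<inter> L) + card ?I"
    proof -
      have "L = (?C \<inter> L) \<union> ?I" using L by blast
      then have "card L = card ((?C \<inter> L) \<union> ?I)" by simp
      also have "\<dots> = card (?C \<inter> L) + card ?I"
        by (rule card_Un_disjoint) (use finV J(1) in \<open>auto intro: finite_subset\<close>)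
      finally show ?thesis .
    qed
    moreover have "card ?C = card (?C \<inter> L) + card ?D"
      using card_Int_Diff[of ?C L] finV by simp
    ultimately show "int (card L) \<le> int (card ?C) - 1" by linarith
  qed auto
qed

text \<open>The complement of a vertex cover is independent, so it contains at most one vertex of each clique
\<open>Q j\<close>.\<close>
lemma vertex_cover_number_ge:
  assumes G: "simple_graph V E" and J: "J \<subseteq> V"
    and cover: "\<And>v. v \<in> V \<Longrightarrow> \<exists>j\<in>J. v \<in> Q j" and clique: "\<And>j. j \<in> J \<Longrightarrow> complete_edges (Q j) \<subseteq> E"
  shows "card (V - J) \<le> vertex_cover_number V E"
proof -
  have finV: "finite V" using G by (simp add: simple_graph_def)
  have "finite {C. vertex_cover V E C}"
    by (rule finite_subset[of _ "Pow V"]) (use finV in \<open>auto simp: vertex_cover_def\<close>)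
  moreover have "vertex_cover V E V"
  proof -
    have "e \<inter> V \<noteq> {}" if "e \<in> E" for e
    proof -
      have "e \<subseteq> V" "card e = 2" using G that by (auto simp: simple_graph_def)
      then show ?thesis by (auto simp: Int_absorb2)
    qed
    then show ?thesis by (simp add: vertex_cover_def)
  qed
  ultimately have "vertex_cover_number V E \<in> card ` {C. vertex_cover V E C}"
    unfolding vertex_cover_number_def by (intro Min_in) auto
  then obtain C where C: "vertex_cover V E C" "vertex_cover_number V E = card C" by auto
  have CV: "C \<subseteq> V" using C(1) by (simp add: vertex_cover_def)
  obtain f where f: "\<And>v. v \<in> V \<Longrightarrow> f v \<in> J \<and> v \<in> Q (f v)" using cover by metis
  have "inj_on f (V - C)"
  proof (rule inj_onI, rule ccontr)
    fix u w assume uw: "u \<in> V - C" "w \<in> V - C" "f u = f w" "u \<noteq> w"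
    have "u \<in> Q (f u)" "w \<in> Q (f u)" "f u \<in> J" using f[of u] f[of w] uw by auto
    then have "{u, w} \<in> E" using complete_edgesD[OF clique[of "f u"]] uw(4) by blast
    then have "{u, w} \<inter> C \<noteq> {}" using C(1) unfolding vertex_cover_def by blast
    then show False using uw by auto
  qed
  then have "card (V - C) \<le> card J"
    by (rule card_inj_on_le) (use f J finV finite_subset in auto)
  moreover have "card (V - C) = card V - card C" "card (V - J) = card V - card J"
    using CV J finV finite_subset by (auto intro!: card_Diff_subset)
  ultimately show ?thesis using C(2) by linarith
qed

definition near_simplicial :: "'v set \<Rightarrow> 'v set set \<Rightarrow> 'v set" where
  "near_simplicial V E = (\<Union>s\<in>{s \<in> V. simplicial E s}. closed_nbhd E s)"

text \<open>\<open>S\<close> is chosen as a maximal independent set of simplicial vertices. The closed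
neighborhoods of its members are cliques that cover all of \<open>near_simplicial V E\<close>: a simplicial
vertex outside \<open>S\<close> has a neighbor in \<open>S\<close> with the same closed neighborhood. The
cliques \<open>Q i\<close> cover the other vertices.\<close>
theorem regularity_le_vertex_cover_number:
  fixes V :: "'v set"
  assumes G: "simple_graph V E" and "V \<noteq> {}" and iso: "no_isolated_vertices V E"
    and I: "I \<subseteq> V - near_simplicial V E" "independent E I"
    and cover: "\<And>v. v \<in> V - near_simplicial V E \<Longrightarrow> \<exists>i\<in>I. v \<in> Q i"
    and clique: "\<And>i. i \<in> I \<Longrightarrow> complete_edges (Q i) \<subseteq> E"
    and spread: "\<And>I' D. I' \<subseteq> I \<Longrightarrow> I' \<noteq> {} \<Longrightarrow> D \<subseteq> V \<Longrightarrow> (\<And>i. i \<in> I' \<Longrightarrow> 2 \<le> card (nbhd E i \<inter> D)) \<Longrightarrow>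
      card I' < card D"
  shows "quotient_regularity V (neighborhood_ideal V E (vertex_degree E) :: ('v, 'k::field) mpoly set)
    \<le> ereal (real (vertex_cover_number V E) - 1)"
proof -
  have finV: "finite V" using G by (simp add: simple_graph_def)
  obtain ord :: "'v \<Rightarrow> nat" where "inj_on ord V"
    using finite_imp_inj_to_nat_seg[OF finV] by blast
  then interpret koszul V ord using finV by unfold_locales
  define \<S> where "\<S> = {S. S \<subseteq> {s \<in> V. simplicial E s} \<and> independent E S}"
  have "finite \<S>" by (rule finite_subset[of _ "Pow V"]) (use finV in \<open>auto simp: \<S>_def\<close>)
  moreover have "\<S> \<noteq> {}" by (auto simp: \<S>_def independent_def intro!: exI[of _ "{}"])
  ultimately obtain S where S: "S \<in> \<S>" and max: "\<And>S'. S' \<in> \<S> \<Longrightarrow> S \<subseteq> S' \<Longrightarrow> S = S'"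
    using finite_has_maximal by metis
  have SV: "S \<subseteq> V" and simp_S: "\<And>s. s \<in> S \<Longrightarrow> simplicial E s" and ind_S: "independent E S"
    using S by (auto simp: \<S>_def)
  have near: "\<exists>j\<in>S. v \<in> closed_nbhd E j" if "v \<in> near_simplicial V E" for v
  proof -
    obtain s where s: "s \<in> V" "simplicial E s" "v \<in> closed_nbhd E s"
      using \<open>v \<in> near_simplicial V E\<close> by (auto simp: near_simplicial_def)
    show ?thesis
    proof (cases "s \<in> S")
      case False
      have "\<not> independent E (insert s S)"
      proof
        assume "independent E (insert s S)"
        then have "insert s S \<in> \<S>" using s SV simp_S by (auto simp: \<S>_def)
        with max[of "insert s S"] False show False by auto
      qed
      moreover have "{s} \<notin> E" using simple_graph_edge(1)[OF G, of s s] by auto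
      ultimately obtain j where j: "j \<in> S" "{s, j} \<in> E"
        using ind_S unfolding independent_def by (auto simp: insert_commute)
      then have "s \<in> closed_nbhd E j" by (simp add: closed_nbhd_def nbhd_def insert_commute)
      from simplicial_closed_nbhd[OF s(2) this] s(3) j(1) show ?thesis by blast
    qed (use s(3) in blast)
  qed
  have S_near: "closed_nbhd E s \<subseteq> near_simplicial V E" if "s \<in> S" for s
    using that SV simp_S by (auto simp: near_simplicial_def)
  have disj: "S \<inter> I = {}"
    using I(1) S_near by (fastforce simp: closed_nbhd_def)
  have cross: "{s, i} \<notin> E" if "s \<in> S" "i \<in> I" for s i
    using I(1) S_near[OF that(1)] that(2) by (auto simp: closed_nbhd_def nbhd_def)
  have cross': "{i, s} \<notin> E" if "s \<in> S" "i \<in> I" for s i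
    using cross[OF that] by (simp add: insert_commute)
  have ind: "independent E (S \<union> I)"
    using ind_S I(2) cross cross' unfolding independent_def by blast
  have JV: "S \<union> I \<subseteq> V" using SV I(1) by blast
  define Q' where "Q' j = (if j \<in> S then closed_nbhd E j else Q j)" for j
  have cover': "\<exists>j\<in>S \<union> I. v \<in> Q' j" if v: "v \<in> V" for v
  proof (cases "v \<in> near_simplicial V E")
    case True
    then show ?thesis using near unfolding Q'_def by fastforce
  next
    case False
    then obtain i where "i \<in> I" "v \<in> Q i" using cover v by blast
    then show ?thesis using disj unfolding Q'_def by fastforce
  qed
  have clique': "complete_edges (Q' j) \<subseteq> E" if "j \<in> S \<union> I" for j
    using that simp_S clique unfolding Q'_def simplicial_def by auto
  have "S \<union> I \<noteq> {}" using cover' assms(2) by blast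
  from koszul_vanishes_nonface[OF koszul_axioms G JV disj this ind simp_S spread, where 'k='k]
  have van: "koszul_vanishes TYPE('k) (nonface V E) (int (card (V - (S \<union> I))) - 1)" by blast
  have "\<not> nonface V E {}"
  proof
    assume "nonface V E {}"
    then obtain i where i: "i \<in> V" "card (closed_nbhd E i) \<le> 1" by (auto simp: nonface_def)
    obtain e where e: "e \<in> E" "i \<in> e" using iso i(1) by (auto simp: no_isolated_vertices_def)
    then have "card e = 2" using G by (simp add: simple_graph_def)
    then obtain u where "e = {i, u}" using e(2) by (auto simp: card_2_iff)
    then have "u \<in> nbhd E i" using e(1) by (simp add: nbhd_def)
    then have "vertex_degree E i \<noteq> 0"
      using simple_graph_nbhd(2)[OF G] by (auto simp: vertex_degree_def)
    then show False using i(2) simple_graph_nbhd(4)[OF G, of i] by simp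
  qed
  from quotient_regularity_le[OF mono_nonface[OF G] van this]
  have "quotient_regularity V (neighborhood_ideal V E (vertex_degree E) :: ('v, 'k) mpoly set)
      \<le> ereal (real_of_int (int (card (V - (S \<union> I))) - 1))"
    by (simp add: neighborhood_ideal_eq[OF G] support_ideal_def)
  also have "\<dots> \<le> ereal (real (vertex_cover_number V E) - 1)"
    using vertex_cover_number_ge[OF G JV cover' clique'] by simp
  finally show ?thesis .
qed

section \<open>Clique-star graphs\<close>

lemma maximal_clique_containing:
  assumes "finite V" "clique V E K"
  obtains A where "maximal_clique V E A" "K \<subseteq> A"
proof -
  have "finite {C. clique V E C}"
    by (rule finite_subset[of _ "Pow V"]) (use assms(1) in \<open>auto simp: clique_def\<close>)
  from finite_has_maximal2[OF this, of K] assms(2) obtain A where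
    "clique V E A" "K \<subseteq> A" "\<And>B. clique V E B \<Longrightarrow> A \<subseteq> B \<Longrightarrow> A = B" by auto
  then show ?thesis by (intro that[of A]) (auto simp: maximal_clique_def)
qed

text \<open>A vertex outside the central clique \<open>F\<close> lies in only one maximal clique, because two of
them meet inside \<open>F\<close>; so its closed neighborhood is that clique and it is simplicial. A vertex of
\<open>F\<close> that lies in another maximal clique is adjacent to a vertex of that clique outside
\<open>F\<close>, and otherwise it is simplicial itself.\<close>
lemma clique_star_near_simplicial:
  assumes G: "simple_graph V E" and "clique_star_graph V E"
  shows "V \<subseteq> near_simplicial V E"
proof
  fix v assume v: "v \<in> V"
  have finV: "finite V" using G by (simp add: simple_graph_def)
  obtain F where F: "maximal_clique V E F"
    and meet: "\<And>A B. maximal_clique V E A \<Longrightarrow> maximal_clique V E B \<Longrightarrow> A \<noteq> B \<Longrightarrow> A \<inter> B \<subseteq> F"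
    using assms(2) by (auto simp: clique_star_graph_def central_clique_def)
  have edge_clique: "clique V E {a, b}" if "a \<in> V" "b \<in> V" "a = b \<or> {a, b} \<in> E" for a b
    using that unfolding clique_def complete_edges_subset_iff by (auto simp: insert_commute)
  have unique: "closed_nbhd E w \<subseteq> A"
    if w: "w \<in> V" and A: "maximal_clique V E A" and only: "\<And>B. maximal_clique V E B \<Longrightarrow> w \<in> B \<Longrightarrow> B = A" for w A
  proof
    fix u assume "u \<in> closed_nbhd E w"
    then have "u = w \<or> {w, u} \<in> E" by (auto simp: closed_nbhd_def nbhd_def)
    moreover from this have "u \<in> V" using w simple_graph_edge(3)[OF G] by blast
    ultimately have "clique V E {w, u}" using edge_clique w by blast
    then obtain B where "maximal_clique V E B" "{w, u} \<subseteq> B"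
      using maximal_clique_containing[OF finV] by metis
    with only show "u \<in> A" by blast
  qed
  have simp: "simplicial E w"
    if w: "w \<in> V" and A: "maximal_clique V E A" and only: "\<And>B. maximal_clique V E B \<Longrightarrow> w \<in> B \<Longrightarrow> B = A" for w A
  proof -
    have "complete_edges A \<subseteq> E" using A by (simp add: maximal_clique_def clique_def)
    moreover have "complete_edges (closed_nbhd E w) \<subseteq> complete_edges A"
      using unique[OF that] by (auto simp: complete_edges_def)
    ultimately show ?thesis by (simp add: simplicial_def)
  qed
  have outside: "simplicial E w" if w: "w \<in> V" "w \<notin> F" "maximal_clique V E A" "w \<in> A" for w A
  proof (rule simp[OF w(1,3)])
    fix B assume "maximal_clique V E B" "w \<in> B"
    then show "B = A" using meet[of B A] w by blast
  qed
  show "v \<in> near_simplicial V E"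
  proof (cases "\<exists>A. maximal_clique V E A \<and> A \<noteq> F \<and> v \<in> A")
    case False
    have "simplicial E v" by (rule simp[OF v F]) (use False in blast)
    then show ?thesis using v by (auto simp: near_simplicial_def closed_nbhd_def)
  next
    case True
    then obtain A where A: "maximal_clique V E A" "A \<noteq> F" "v \<in> A" by blast
    have "\<not> A \<subseteq> F" using A F unfolding maximal_clique_def by blast
    then obtain w where w: "w \<in> A" "w \<notin> F" by blast
    have wV: "w \<in> V" using A(1) w(1) by (auto simp: maximal_clique_def clique_def)
    have "v \<in> closed_nbhd E w"
    proof (cases "v = w")
      case False
      have "complete_edges A \<subseteq> E" using A(1) by (simp add: maximal_clique_def clique_def)
      then have "{w, v} \<in> E" by (rule complete_edgesD) (use A(3) w(1) False in auto)
      then show ?thesis by (simp add: closed_nbhd_def nbhd_def)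
    qed (simp add: closed_nbhd_def)
    then show ?thesis using outside[OF wV w(2) A(1) w(1)] wV by (auto simp: near_simplicial_def)
  qed
qed

section \<open>Generalized caterpillar graphs\<close>

text \<open>What the later arguments use of the construction: attaching cliques creates no new edges between
path vertices, and every vertex off the path is simplicial because it belongs to just one attached
clique.\<close>
lemma attached_to_path_structure:
  assumes "attached_to_path p V E"
  shows "distinct p" "set p \<subseteq> V" "path_edges p \<subseteq> E"
    "\<And>e. e \<in> E \<Longrightarrow> e \<subseteq> V"
    "\<And>e. e \<in> E \<Longrightarrow> e \<subseteq> set p \<Longrightarrow> e \<in> path_edges p"
    "\<And>v. v \<in> V - set p \<Longrightarrow> simplicial E v"
proof -
  have path_sub: "e \<subseteq> set p" if "e \<in> path_edges p" for e
    using that by (auto simp: path_edges_def)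
  have attach: "(\<forall>e\<in>E \<union> complete_edges Q. e \<subseteq> V \<union> Q) \<and>
      (\<forall>e\<in>E \<union> complete_edges Q. e \<subseteq> set p \<longrightarrow> e \<in> path_edges p) \<and>
      (\<forall>v\<in>(V \<union> Q) - set p. simplicial (E \<union> complete_edges Q) v)"
    if pV: "set p \<subseteq> V" and E: "\<forall>e\<in>E. e \<subseteq> V" "\<forall>e\<in>E. e \<subseteq> set p \<longrightarrow> e \<in> path_edges p"
      "\<forall>v\<in>V - set p. simplicial E v"
    and Q: "Q \<inter> V \<subseteq> set p" "\<And>e. e \<subseteq> Q \<inter> V \<Longrightarrow> card e = 2 \<Longrightarrow> e \<in> path_edges p" for V E Q
  proof (intro conjI ballI impI)
    fix e assume e: "e \<in> E \<union> complete_edges Q"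
    then show "e \<subseteq> V \<union> Q" using E(1) by (auto simp: complete_edges_def)
    assume ep: "e \<subseteq> set p"
    show "e \<in> path_edges p"
    proof (cases "e \<in> E")
      case False
      then have "e \<subseteq> Q" "card e = 2" using e by (auto simp: complete_edges_def)
      then show ?thesis using Q(2) ep pV by blast
    qed (use E(2) ep in blast)
  next
    fix v assume v: "v \<in> (V \<union> Q) - set p"
    show "simplicial (E \<union> complete_edges Q) v"
    proof (cases "v \<in> V")
      case True
      then have "v \<notin> Q" using v Q(1) by blast
      then have "closed_nbhd (E \<union> complete_edges Q) v = closed_nbhd E v"
        by (auto simp: closed_nbhd_def nbhd_def complete_edges_def)
      moreover have "simplicial E v" using True v E(3) by blast
      ultimately show ?thesis by (auto simp: simplicial_def)
    next
      case False
      then have "v \<in> Q" using v by blast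
      have "closed_nbhd (E \<union> complete_edges Q) v \<subseteq> Q"
        using False E(1) \<open>v \<in> Q\<close> by (auto simp: closed_nbhd_def nbhd_def complete_edges_def)
      then show ?thesis by (auto simp: simplicial_def complete_edges_def)
    qed
  qed
  have *: "distinct p \<and> set p \<subseteq> V \<and> path_edges p \<subseteq> E \<and> (\<forall>e\<in>E. e \<subseteq> V) \<and>
      (\<forall>e\<in>E. e \<subseteq> set p \<longrightarrow> e \<in> path_edges p) \<and> (\<forall>v\<in>V - set p. simplicial E v)"
    using assms
  proof (induction rule: attached_to_path.induct)
    case path
    then show ?case using path_sub by simp
  next
    case (attach_at_vertex V E v Q)
    have sub: "Q \<inter> V \<subseteq> set p" using attach_at_vertex.hyps by simp
    have edges: "e \<in> path_edges p" if "e \<subseteq> Q \<inter> V" "card e = 2" for e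
    proof -
      have "card e \<le> card {v}" using that(1) attach_at_vertex.hyps by (intro card_mono) auto
      with that(2) show ?thesis by simp
    qed
    note IH = attach_at_vertex.IH
    from IH have pV: "set p \<subseteq> V" by (elim conjE)
    from IH have E1: "\<forall>e\<in>E. e \<subseteq> V" by (elim conjE)
    from IH have E2: "\<forall>e\<in>E. e \<subseteq> set p \<longrightarrow> e \<in> path_edges p" by (elim conjE)
    from IH have E3: "\<forall>v\<in>V - set p. simplicial E v" by (elim conjE)
    from attach[OF pV E1 E2 E3 sub edges] IH show ?case by (elim conjE) (intro conjI; blast)
  next
    case (attach_at_edge V E e Q)
    have sub: "Q \<inter> V \<subseteq> set p" using attach_at_edge.hyps path_sub by simp
    have edges: "e' \<in> path_edges p" if "e' \<subseteq> Q \<inter> V" "card e' = 2" for e'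
    proof -
      obtain i where "e = {p ! i, p ! Suc i}" using attach_at_edge.hyps(2) by (auto simp: path_edges_def)
      then have "finite e" "card e \<le> card e'" using that(2) by (auto simp: card_insert_if)
      then have "e' = e" using that(1) attach_at_edge.hyps(4) by (intro card_seteq) auto
      then show ?thesis using attach_at_edge.hyps(2) by simp
    qed
    note IH = attach_at_edge.IH
    from IH have pV: "set p \<subseteq> V" by (elim conjE)
    from IH have E1: "\<forall>e\<in>E. e \<subseteq> V" by (elim conjE)
    from IH have E2: "\<forall>e\<in>E. e \<subseteq> set p \<longrightarrow> e \<in> path_edges p" by (elim conjE)
    from IH have E3: "\<forall>v\<in>V - set p. simplicial E v" by (elim conjE)
    from attach[OF pV E1 E2 E3 sub edges] IH show ?case by (elim conjE) (intro conjI; blast)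
  qed
  then show "distinct p" by (elim conjE)
  from * show "set p \<subseteq> V" by (elim conjE)
  from * show "path_edges p \<subseteq> E" by (elim conjE)
  from * show "\<And>e. e \<in> E \<Longrightarrow> e \<subseteq> V" by (elim conjE) simp
  from * show "\<And>e. e \<in> E \<Longrightarrow> e \<subseteq> set p \<Longrightarrow> e \<in> path_edges p" by (elim conjE) simp
  from * show "\<And>v. v \<in> V - set p \<Longrightarrow> simplicial E v" by (elim conjE) simp
qed

text \<open>Scanning from the left, a position satisfying \<open>P\<close> is selected unless the previous one
was. An unselected position satisfying \<open>P\<close> is therefore preceded by a selected one, with which it
shares an edge of the path.\<close>
fun greedy :: "(nat \<Rightarrow> bool) \<Rightarrow> nat \<Rightarrow> bool" where
  "greedy P 0 \<longleftrightarrow> P 0"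
| "greedy P (Suc n) \<longleftrightarrow> P (Suc n) \<and> \<not> greedy P n"

lemma greedy_imp: "greedy P n \<Longrightarrow> P n"
  by (cases n) auto

text \<open>A vertex in no closed neighborhood of a simplicial one (\<open>far\<close>) has no neighbor off the
path, so its neighbors are the adjacent path vertices. The cliques \<open>Q\<close> consist of a selected vertex
and its successor on the path.\<close>
lemma caterpillar_regularity:
  fixes V :: "'v set"
  assumes G: "simple_graph V E" and "V \<noteq> {}" and iso: "no_isolated_vertices V E"
    and "attached_to_path p V E"
  shows "quotient_regularity V (neighborhood_ideal V E (vertex_degree E) :: ('v, 'k::field) mpoly set)
    \<le> ereal (real (vertex_cover_number V E) - 1)"
proof -
  note A = attached_to_path_structure[OF assms(4)]
  define far where "far = V - near_simplicial V E"
  have far_nbhd: "u \<in> set p" if "v \<in> far" "u \<in> closed_nbhd E v" for u v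
  proof (rule ccontr)
    assume "u \<notin> set p"
    have "u \<in> V" using that simple_graph_nbhd(1)[OF G] by (auto simp: far_def closed_nbhd_def)
    moreover have "simplicial E u" using A(6) \<open>u \<in> V\<close> \<open>u \<notin> set p\<close> by blast
    moreover have "v \<in> closed_nbhd E u" by (rule closed_nbhd_sym[OF that(2)])
    ultimately have "v \<in> near_simplicial V E" by (auto simp: near_simplicial_def)
    then show False using that(1) by (simp add: far_def)
  qed
  have far_nbr: "\<exists>m<length p. u = p ! m \<and> (n = Suc m \<or> m = Suc n)"
    if n: "n < length p" "p ! n \<in> far" and u: "u \<in> nbhd E (p ! n)" for n u
  proof -
    have "u \<in> set p" using far_nbhd[OF n(2)] u by (simp add: closed_nbhd_def)
    then have "{p ! n, u} \<in> path_edges p"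
      using A(5)[of "{p ! n, u}"] u n(1) by (auto simp: nbhd_def)
    then obtain i where i: "Suc i < length p" "{p ! n, u} = {p ! i, p ! Suc i}"
      by (auto simp: path_edges_def)
    then consider "p ! n = p ! i" "u = p ! Suc i" | "p ! n = p ! Suc i" "u = p ! i"
      by (auto simp: doubleton_eq_iff)
    then show ?thesis
    proof cases
      case 1
      then have "n = i" using nth_eq_iff_index_eq[OF A(1) n(1)] i(1) by simp
      then show ?thesis using 1 i(1) by blast
    next
      case 2
      then have "n = Suc i" using nth_eq_iff_index_eq[OF A(1) n(1)] i(1) by simp
      then show ?thesis using 2 i(1) by (intro exI[of _ i]) simp
    qed
  qed
  define P where "P n \<longleftrightarrow> n < length p \<and> p ! n \<in> far" for n
  define I where "I = (!) p ` {n. greedy P n}"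
  define Q where "Q v = insert v {p ! Suc n | n. Suc n < length p \<and> v = p ! n}" for v
  have P: "n < length p" "p ! n \<in> far" if "greedy P n" for n
    using greedy_imp[OF that] by (auto simp: P_def)
  show ?thesis
  proof (rule regularity_le_vertex_cover_number[OF G assms(2) iso, of I Q])
    show "I \<subseteq> V - near_simplicial V E" using P(2) by (auto simp: I_def far_def)
    show "independent E I"
      unfolding independent_def
    proof (intro ballI notI)
      fix u w assume "u \<in> I" "w \<in> I" and e: "{u, w} \<in> E"
      then obtain n m where n: "greedy P n" "u = p ! n" and m: "greedy P m" "w = p ! m"
        by (auto simp: I_def)
      have "w \<in> nbhd E (p ! n)" using e n by (simp add: nbhd_def)
      from far_nbr[OF P[OF n(1)] this] obtain m' where
        m': "m' < length p" "w = p ! m'" "n = Suc m' \<or> m' = Suc n" by blast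
      have "m' = m" using m'(1,2) m(2) nth_eq_iff_index_eq[OF A(1) m'(1) P(1)[OF m(1)]] by simp
      then show False using m'(3) n(1) m(1) by auto
    qed
    show "\<exists>i\<in>I. v \<in> Q i" if v: "v \<in> V - near_simplicial V E" for v
    proof -
      have "v \<in> far" using v by (simp add: far_def)
      then have "v \<in> set p" using far_nbhd[of v v] by (simp add: closed_nbhd_def)
      then obtain n where n: "n < length p" "v = p ! n" by (auto simp: in_set_conv_nth)
      then have Pn: "P n" using \<open>v \<in> far\<close> by (simp add: P_def)
      show ?thesis
      proof (cases "greedy P n")
        case True
        then show ?thesis using n by (auto simp: I_def Q_def)
      next
        case False
        then obtain m where "n = Suc m" "greedy P m" using Pn by (cases n) auto
        then show ?thesis using n by (intro bexI[of _ "p ! m"]) (auto simp: I_def Q_def)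
      qed
    qed
    show "complete_edges (Q i) \<subseteq> E" if iI: "i \<in> I" for i
    proof -
      obtain n where n: "n < length p" "i = p ! n" using iI P(1) by (auto simp: I_def)
      have idx: "m = n" if "Suc m < length p" "i = p ! m" for m
        using that n nth_eq_iff_index_eq[OF A(1) n(1), of m] by simp
      have "Q i \<subseteq> {p ! n, p ! Suc n}" "Suc n \<ge> length p \<Longrightarrow> Q i = {p ! n}"
        unfolding Q_def using idx n(2) by (blast, fastforce)
      note Qi = this
      show ?thesis
        unfolding complete_edges_subset_iff
      proof (intro ballI impI)
        fix u w assume uw: "u \<in> Q i" "w \<in> Q i" "u \<noteq> w"
        then have "Suc n < length p" using Qi(2) by (cases "Suc n < length p") auto
        then have "{p ! n, p ! Suc n} \<in> E" using A(3) by (auto simp: path_edges_def)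
        moreover have "{u, w} = {p ! n, p ! Suc n}" using uw Qi(1) by blast
        ultimately show "{u, w} \<in> E" by simp
      qed
    qed
    show "card I' < card D"
      if I': "I' \<subseteq> I" "I' \<noteq> {}" and D: "D \<subseteq> V" "\<And>i. i \<in> I' \<Longrightarrow> 2 \<le> card (nbhd E i \<inter> D)" for I' D
    proof -
      define N where "N = {n. n < length p \<and> p ! n \<in> I'}"
      have finN: "finite N" by (simp add: N_def)
      have I'_N: "I' = (!) p ` N" using I'(1) P(1) by (auto simp: N_def I_def)
      then have "N \<noteq> {}" using I'(2) by auto
      have both: "n > 0 \<and> Suc n < length p \<and> p ! (n - 1) \<in> D \<and> p ! Suc n \<in> D" if "n \<in> N" for n
      proof -
        have n: "n < length p" "p ! n \<in> I'" using that by (auto simp: N_def)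
        obtain n' where n': "greedy P n'" "p ! n = p ! n'" using n(2) I'(1) by (auto simp: I_def)
        have far_n: "p ! n \<in> far" using P(2)[OF n'(1)] n'(2) by simp
        obtain u w where uw: "u \<noteq> w" "u \<in> nbhd E (p ! n) \<inter> D" "w \<in> nbhd E (p ! n) \<inter> D"
          using D(2)[OF n(2)] by (auto simp: card_le_Suc_iff numeral_2_eq_2)
        obtain k where k: "k < length p" "u = p ! k" "n = Suc k \<or> k = Suc n"
          using far_nbr[OF n(1) far_n] uw(2) by blast
        obtain l where l: "l < length p" "w = p ! l" "n = Suc l \<or> l = Suc n"
          using far_nbr[OF n(1) far_n] uw(3) by blast
        show ?thesis using k l uw by auto
      qed
      define n0 where "n0 = Min N"
      have n0: "n0 \<in> N" "\<And>n. n \<in> N \<Longrightarrow> n0 \<le> n"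
        using Min_in[OF finN \<open>N \<noteq> {}\<close>] Min_le[OF finN] by (auto simp: n0_def)
      \<comment> \<open>\<open>D\<close> contains the path vertices after all positions in \<open>N\<close> and,
        as one vertex more, the one before the first of them.\<close>
      define K where "K = insert (n0 - 1) (Suc ` N)"
      have "n0 - 1 \<notin> Suc ` N" using n0 both[OF n0(1)] by force
      then have "card K = Suc (card N)" using finN by (simp add: K_def card_image)
      moreover have "card K \<le> card D"
      proof (rule card_inj_on_le)
        have "\<forall>k\<in>K. k < length p" using both both[OF n0(1)] by (auto simp: K_def)
        then show "inj_on ((!) p) K" by (rule inj_on_nth[OF A(1)])
        show "(!) p ` K \<subseteq> D" using both n0 by (auto simp: K_def)
        show "finite D" using D(1) G finite_subset by (auto simp: simple_graph_def)
      qed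
      moreover have "card I' \<le> card N" unfolding I'_N by (rule card_image_le[OF finN])
      ultimately show ?thesis by linarith
    qed
  qed
qed

theorem theorem3p6:
  fixes V :: "'v set" and E :: "'v set set"
  assumes "simple_graph V E"
    and "V \<noteq> {}"
    and "no_isolated_vertices V E"
    and "clique_star_graph V E \<or> generalized_caterpillar_graph V E"
  shows "quotient_regularity V (neighborhood_ideal V E (vertex_degree E) :: ('v, 'k::field) mpoly set)
    \<le> ereal (real (vertex_cover_number V E) - 1)"
  using assms(4)
proof
  assume "clique_star_graph V E"
  then have "V - near_simplicial V E = {}"
    using clique_star_near_simplicial[OF assms(1)] by blast
  then show ?thesis
    by (intro regularity_le_vertex_cover_number[OF assms(1-3), of "{}" "\<lambda>_. {}"])
      (auto simp: independent_def)
next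
  assume "generalized_caterpillar_graph V E"
  then show ?thesis
    using caterpillar_regularity[OF assms(1-3)] by (auto simp: generalized_caterpillar_graph_def)
qed

end
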